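(* Let $X$ be the generalized fractional Brownian motion with parameters $(\alpha,\gamma)$, where $\gamma\in[0,1)$ and $\alpha\in\left(-\frac12+\frac{\gamma}{2},\ \frac12+\frac{\gamma}{2}\right)$, driven by $B$, and let $\mathcal F^{B}(\cdot)$ be the filtration generated by $B$. The following properties hold. (i) If $\gamma\in(0,1)$ and $\frac12<\alpha<\frac{1+\gamma}{2}$, then $X$ is a semimartingale with respect to $\mathcal F^{B}(\cdot)$; more specifically, it is a process of finite variation: $$\frac{\mathrm d X(t)}{\mathrm d t}=c\int_{-\infty}^{t}\Psi_t(s)\,\mathrm dB(s),\qquad t\ge 0,$$ where $\Psi_t(s):=\alpha(t-s)^{\alpha-1}|s|^{-\gamma/2}$ for $s<t$ and $\Psi_t(s):=0$ for $s>t$. (ii) If $\gamma\in(0,1)$ and $\alpha\in\left(-\frac12+\frac{\gamma}{2},\ \frac12\right)\setminus\{0\}$, then $X$ is not a semimartingale with respect to $\mathcal F^{B}(\cdot)$. In particular, if $\gamma=2\alpha\in(0,1)$ (so that $H=1/2$), then $X$ is not a semimartingale with respect to $\mathcal F^{B}(\cdot)$. (iii) If $\gamma\in[0,1)$ and $\alpha=0$, then $X$, which in this case is given by $X(t)=c\int_0^t u^{-\gamma/2}B(\mathrm du)$, is a square-integrable martingale (hence a semimartingale) with respect to $\mathcal F^{B}(\cdot)$. (iv) If $\gamma=0$ and $\alpha\in(-\frac12,0)\cup(0,\frac12)$, then $X$ is reduced to a fractional Brownian motion and is not a semimartingale.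
   Context: Let $B(\mathrm du)$ be a Gaussian random measure on $\mathbb R$ with Lebesgue control measure $\mathrm du$ (two-sided Brownian motion), and let $\mathcal F^{B}(\cdot)$ be the filtration generated by $B$. For $\gamma\in[0,1)$ and $\alpha\in(-\frac12+\frac\gamma2,\frac12+\frac\gamma2)$, the generalized fractional Brownian motion (GFBM) is $$X(t)=c\int_{\mathbb R}\left((t-u)_+^{\alpha}-(-u)_+^{\alpha}\right)|u|^{-\gamma/2}B(\mathrm du),$$ considered for $t\ge0$; for $\alpha=0$ this is $X(t)=c\int_0^tu^{-\gamma/2}B(\mathrm du)$. Here $c=c(\alpha,\gamma)>0$ is the normalization constant $$c=\left(\int_0^1(1-v)^{2\alpha}v^{-\gamma}\mathrm dv+\int_0^\infty[(1+v)^\alpha-v^\alpha]^2v^{-\gamma}\mathrm dv\right)^{-1/2}$$ (with $c(0,\gamma)=(1-\gamma)^{1/2}$), for which $\mathbb E[X(t)^2]=t^{2H}$ with $H=\alpha-\frac\gamma2+\frac12\in(0,1)$. $X$ is a continuous, centered, $H$-self-similar Gaussian process; for $\gamma=0$ it is a fractional Brownian motion with Hurst parameter $\alpha+\frac12$.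
   Formalization: In (i) the derivative formula is proved for all t > 0 rather than t ≥ 0, since Ψ_0 is not square-integrable and the integral at t = 0 is undefined; in addition X(t) is shown to equal the integral of the derivative over (0,t] for all t ≥ 0. *)

theory Defs
  imports "HOL-Probability.Probability"
begin

section \<open>Gaussian random measure and Wiener integral\<close>

text \<open>The case \<open>v = 0\<close> is the point mass at 0.\<close>

definition centered_normal :: "real \<Rightarrow> real measure" where
  "centered_normal v = distr std_normal_distribution borel (\<lambda>x. sqrt v * x)"

locale gaussian_random_measure = prob_space M
  for M :: "'a measure" and B :: "real set \<Rightarrow> 'a \<Rightarrow> real" +
  assumes random_variable_B: "A \<in> fmeasurable lborel \<Longrightarrow> B A \<in> borel_measurable M"
    and distr_B: "A \<in> fmeasurable lborel \<Longrightarrow>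
          distr M borel (B A) = centered_normal (measure lborel A)"
    and indep_B: "disjoint_family (C :: nat \<Rightarrow> real set) \<Longrightarrow> range C \<subseteq> fmeasurable lborel \<Longrightarrow>
          indep_vars (\<lambda>_. borel) (\<lambda>i. B (C i)) UNIV"
    and countably_additive_B: "disjoint_family (C :: nat \<Rightarrow> real set) \<Longrightarrow>
          range C \<subseteq> fmeasurable lborel \<Longrightarrow> (\<Union>i. C i) \<in> fmeasurable lborel \<Longrightarrow>
          AE \<omega> in M. (\<lambda>i. B (C i) \<omega>) sums B (\<Union>i. C i) \<omega>"

text \<open>The value of \<open>B\<close> on the possibly infinite-measure level set of \<open>y = 0\<close> does not matter.\<close>

definition simple_wiener_integral ::
  "(real set \<Rightarrow> 'a \<Rightarrow> real) \<Rightarrow> (real \<Rightarrow> real) \<Rightarrow> 'a \<Rightarrow> real" where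
  "simple_wiener_integral B f \<omega> = (\<Sum>y\<in>range f. y * B (f -` {y}) \<omega>)"

text \<open>\<open>Z\<close> is a version of the Wiener integral of \<open>f\<close> with respect to \<open>B\<close>:
  the \<open>L\<^sup>2\<close>-limit of integrals of simple functions approximating \<open>f\<close> in \<open>L\<^sup>2\<close>.\<close>

definition has_wiener_integral ::
  "'a measure \<Rightarrow> (real set \<Rightarrow> 'a \<Rightarrow> real) \<Rightarrow> (real \<Rightarrow> real) \<Rightarrow> ('a \<Rightarrow> real) \<Rightarrow> bool" where
  "has_wiener_integral M B f Z \<longleftrightarrow>
     f \<in> borel_measurable lborel \<and> Z \<in> borel_measurable M \<and>
     (\<exists>s. (\<forall>n::nat. Bochner_Integration.simple_bochner_integrable lborel (s n)) \<and>
          (\<lambda>n. \<integral>\<^sup>+ u. ennreal ((f u - s n u)\<^sup>2) \<partial>lborel) \<longlonglongrightarrow> 0 \<and>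
          (\<lambda>n. \<integral>\<^sup>+ \<omega>. ennreal ((Z \<omega> - simple_wiener_integral B (s n) \<omega>)\<^sup>2) \<partial>M) \<longlonglongrightarrow> 0)"

text \<open>Augmented by the null sets, since stochastic integrals are only determined almost surely.\<close>

definition generated_filtration ::
  "'a measure \<Rightarrow> (real set \<Rightarrow> 'a \<Rightarrow> real) \<Rightarrow> real \<Rightarrow> 'a measure" where
  "generated_filtration M B t = sigma (space M)
     ({B A -` S \<inter> space M | A S. A \<in> fmeasurable lborel \<and> A \<subseteq> {..t} \<and> S \<in> sets borel}
      \<union> null_sets M)"

section \<open>Semimartingales on the time axis \<open>[0, \<infinity>)\<close>\<close>

text \<open>Processes and filtrations are indexed by \<^typ>\<open>real\<close>; processes are only looked at for
  times \<open>t \<ge> 0\<close>. Path properties are required almost surely.\<close>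

definition adapted_process :: "(real \<Rightarrow> 'a measure) \<Rightarrow> (real \<Rightarrow> 'a \<Rightarrow> real) \<Rightarrow> bool" where
  "adapted_process F X \<longleftrightarrow> (\<forall>t\<ge>0. X t \<in> borel_measurable (F t))"

definition martingale :: "'a measure \<Rightarrow> (real \<Rightarrow> 'a measure) \<Rightarrow> (real \<Rightarrow> 'a \<Rightarrow> real) \<Rightarrow> bool" where
  "martingale M F X \<longleftrightarrow> adapted_process F X \<and> (\<forall>t\<ge>0. integrable M (X t)) \<and>
     (\<forall>s t. 0 \<le> s \<and> s \<le> t \<longrightarrow> (AE \<omega> in M. real_cond_exp M (F s) (X t) \<omega> = X s \<omega>))"

definition cadlag_path :: "(real \<Rightarrow> real) \<Rightarrow> bool" where
  "cadlag_path f \<longleftrightarrow>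
     (\<forall>t\<ge>0. continuous (at_right t) f) \<and> (\<forall>t>0. \<exists>l. (f \<longlongrightarrow> l) (at_left t))"

definition finite_variation_path :: "(real \<Rightarrow> real) \<Rightarrow> bool" where
  "finite_variation_path f \<longleftrightarrow> (\<forall>T\<ge>0. \<exists>K. \<forall>(n::nat) p.
     0 \<le> p 0 \<and> (\<forall>i<n. p i \<le> p (Suc i)) \<and> p n \<le> T \<longrightarrow>
     (\<Sum>i<n. \<bar>f (p (Suc i)) - f (p i)\<bar>) \<le> K)"

definition finite_variation_process ::
  "'a measure \<Rightarrow> (real \<Rightarrow> 'a measure) \<Rightarrow> (real \<Rightarrow> 'a \<Rightarrow> real) \<Rightarrow> bool" where
  "finite_variation_process M F A \<longleftrightarrow> adapted_process F A \<and>
     (AE \<omega> in M. cadlag_path (\<lambda>t. A t \<omega>) \<and> finite_variation_path (\<lambda>t. A t \<omega>))"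

text \<open>Finite localizing times are no restriction: replace \<open>\<tau> n\<close> by \<open>min (\<tau> n) n\<close>.\<close>

definition local_martingale ::
  "'a measure \<Rightarrow> (real \<Rightarrow> 'a measure) \<Rightarrow> (real \<Rightarrow> 'a \<Rightarrow> real) \<Rightarrow> bool" where
  "local_martingale M F N \<longleftrightarrow> adapted_process F N \<and> (AE \<omega> in M. cadlag_path (\<lambda>t. N t \<omega>)) \<and>
     (\<exists>\<tau> :: nat \<Rightarrow> 'a \<Rightarrow> real.
        (\<forall>n. stopping_time F (\<tau> n) \<and> (\<forall>\<omega>\<in>space M. 0 \<le> \<tau> n \<omega>)) \<and>
        (AE \<omega> in M. incseq (\<lambda>n. \<tau> n \<omega>) \<and> filterlim (\<lambda>n. \<tau> n \<omega>) at_top sequentially) \<and>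
        (\<forall>n. martingale M F (\<lambda>t \<omega>. N (min t (\<tau> n \<omega>)) \<omega> - N 0 \<omega>)))"

definition semimartingale ::
  "'a measure \<Rightarrow> (real \<Rightarrow> 'a measure) \<Rightarrow> (real \<Rightarrow> 'a \<Rightarrow> real) \<Rightarrow> bool" where
  "semimartingale M F X \<longleftrightarrow> adapted_process F X \<and>
     (\<exists>N A. local_martingale M F N \<and> finite_variation_process M F A \<and>
        (AE \<omega> in M. N 0 \<omega> = 0 \<and> A 0 \<omega> = 0 \<and> (\<forall>t\<ge>0. X t \<omega> = X 0 \<omega> + N t \<omega> + A t \<omega>)))"

section \<open>Fractional Brownian motion and its generalization\<close>

definition continuous_process :: "'a measure \<Rightarrow> (real \<Rightarrow> 'a \<Rightarrow> real) \<Rightarrow> bool" where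
  "continuous_process M X \<longleftrightarrow> (\<forall>t\<ge>0. X t \<in> borel_measurable M) \<and>
     (AE \<omega> in M. continuous_on {0..} (\<lambda>t. X t \<omega>))"

definition centered_gaussian_process :: "'a measure \<Rightarrow> (real \<Rightarrow> 'a \<Rightarrow> real) \<Rightarrow> bool" where
  "centered_gaussian_process M X \<longleftrightarrow> (\<forall>t\<ge>0. X t \<in> borel_measurable M) \<and>
     (\<forall>I a. finite I \<and> I \<subseteq> {0..} \<longrightarrow>
        (\<exists>v\<ge>0. distr M borel (\<lambda>\<omega>. \<Sum>t\<in>I. a t * X t \<omega>) = centered_normal v))"

definition fractional_brownian_motion ::
  "'a measure \<Rightarrow> real \<Rightarrow> (real \<Rightarrow> 'a \<Rightarrow> real) \<Rightarrow> bool" where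
  "fractional_brownian_motion M H X \<longleftrightarrow>
     centered_gaussian_process M X \<and> continuous_process M X \<and>
     (\<forall>s\<ge>0. \<forall>t\<ge>0. (\<integral>\<omega>. X s \<omega> * X t \<omega> \<partial>M) =
        (s powr (2 * H) + t powr (2 * H) - \<bar>t - s\<bar> powr (2 * H)) / 2)"

definition gfbm_const :: "real \<Rightarrow> real \<Rightarrow> real" where
  "gfbm_const \<alpha> \<gamma> =
     ((LBINT v:{0<..<1}. (1 - v) powr (2 * \<alpha>) * v powr (- \<gamma>))
      + (LBINT v:{0<..}. ((1 + v) powr \<alpha> - v powr \<alpha>)\<^sup>2 * v powr (- \<gamma>))) powr (- 1 / 2)"

text \<open>Since \<open>0 powr \<alpha> = 0\<close>, the term \<open>max x 0 powr \<alpha>\<close> is \<open>x\<close> to the power \<open>\<alpha>\<close> for \<open>x > 0\<close> and 0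
  for \<open>x \<le> 0\<close>, also for \<open>\<alpha> \<le> 0\<close>. For \<open>\<alpha> = 0\<close> the difference below is the indicator of \<open>[0, t)\<close>,
  which gives the separate definition of the process in that case.\<close>

definition gfbm_kernel :: "real \<Rightarrow> real \<Rightarrow> real \<Rightarrow> real \<Rightarrow> real" where
  "gfbm_kernel \<alpha> \<gamma> t u =
     (max (t - u) 0 powr \<alpha> - max (- u) 0 powr \<alpha>) * \<bar>u\<bar> powr (- \<gamma> / 2)"

lemma gfbm_kernel_0: "t \<ge> 0 \<Longrightarrow> gfbm_kernel 0 \<gamma> t u = indicator {0..<t} u * u powr (- \<gamma> / 2)"
  by (auto simp: gfbm_kernel_def max_def indicator_def)

text \<open>Equality of functions in the second conjunct is no restriction, because \<open>Z\<close> may be any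
  version of the integral.\<close>

definition gfbm ::
  "'a measure \<Rightarrow> (real set \<Rightarrow> 'a \<Rightarrow> real) \<Rightarrow> real \<Rightarrow> real \<Rightarrow> (real \<Rightarrow> 'a \<Rightarrow> real) \<Rightarrow> bool" where
  "gfbm M B \<alpha> \<gamma> X \<longleftrightarrow> continuous_process M X \<and>
     (\<forall>t\<ge>0. \<exists>Z. has_wiener_integral M B (gfbm_kernel \<alpha> \<gamma> t) Z \<and>
                X t = (\<lambda>\<omega>. gfbm_const \<alpha> \<gamma> * Z \<omega>))"

definition gfbm_Psi :: "real \<Rightarrow> real \<Rightarrow> real \<Rightarrow> real \<Rightarrow> real" where
  "gfbm_Psi \<alpha> \<gamma> t s = (if s < t then \<alpha> * (t - s) powr (\<alpha> - 1) * \<bar>s\<bar> powr (- \<gamma> / 2) else 0)"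

end

theory Submission imports Defs begin

text \<open>The Wiener integral is an \<open>L\<^sup>2\<close>-isometry onto centered Gaussian variables, measurable with
  respect to the past when the integrand lives on the past, and orthogonal to the past when it
  lives on the future. For \<open>\<alpha> = 0\<close> this makes \<open>X\<close> a martingale.

  For a semimartingale, the sums \<open>\<Sum>i<n. H\<^sub>i (X(t\<^sub>i\<^sub>+\<^sub>1) - X(t\<^sub>i))\<close> over uniform partitions of \<open>[1,2]\<close>
  are bounded in probability, uniformly in \<open>n\<close> and in the predictable weights \<open>\<bar>H\<^sub>i\<bar> \<le> 1\<close>; for the
  martingale part this is Burkholder's weak type inequality. If \<open>\<alpha> < 0\<close>, the weights
  \<open>H\<^sub>i = X(t\<^sub>i)/K\<close> (truncated) violate this because the sum controls the quadratic variation,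
  which explodes. If \<open>0 < \<alpha> < 1/2\<close>, adjacent increments are positively correlated with correlation
  bounded below, and the weight given by the preceding increment (rescaled and truncated) produces
  sums of order \<open>n\<close> times the standard deviation \<open>n powr (- \<alpha> - 1 / 2)\<close> of an increment.
  In both cases the Paley-Zygmund inequality gives a probability bounded below.

  If \<open>\<alpha> > 1/2\<close>, the second differences of \<open>X\<close> with step \<open>h\<close> have standard deviation
  \<open>O(h\<^sup>1\<^sup>+\<^sup>\<theta>)\<close> for some \<open>\<theta> > 0\<close>; by Borel-Cantelli at dyadic points, almost every path is differentiable
  on \<open>(0,\<infinity>)\<close>, and the derivative is an \<open>L\<^sup>2\<close>-limit of difference quotients, hence a Wiener integral.\<close>

subsection \<open>Simple integrands\<close>

text \<open>Away from 0 the weight \<open>\<bar>u\<bar> powr (- \<gamma> / 2)\<close> is harmless,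
  so on [1,2] the increments of X have the local size known from fractional Brownian motion with
  parameter \<alpha> + 1/2, whatever the self-similarity exponent H is. This is why the threshold is
  \<alpha> = 1/2, and why H = 1/2 with \<gamma> > 0 gives no semimartingale. The semimartingale
  property is tested on finite sums only, so neither stochastic integrals nor the quadratic
  variation of the unknown martingale part appear. A filtration enters only through adaptedness;
  hence the negative results hold in every filtration. For 0 < \<alpha> < 1/2 the quadratic
  variation tends to 0 and cannot be the test; correlation of neighbouring increments replaces it.
  For \<alpha> > 1/2 the obstacle is time 0: the standard deviation of the derivative is a multiple
  of \<open>t powr ((2 * \<alpha> - 1 - \<gamma>) / 2)\<close>, with an exponent in (-1/2, 0). It
  blows up at 0 but stays integrable, so X is the integral of its derivative from 0 on and has
  finite variation up to 0.\<close>

abbreviation simple_integrable :: "(real \<Rightarrow> real) \<Rightarrow> bool" where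
  "simple_integrable \<equiv> Bochner_Integration.simple_bochner_integrable lborel"

lemma simple_integrableD:
  assumes "simple_integrable f"
  shows "finite (range f)" "f \<in> borel_measurable borel" "y \<noteq> 0 \<Longrightarrow> f -` {y} \<in> fmeasurable lborel"
    "{u. f u \<noteq> 0} \<in> fmeasurable lborel"
proof -
  from assms have sf: "simple_function lborel f" and e: "emeasure lborel {y. f y \<noteq> 0} \<noteq> \<infinity>"
    by (auto elim!: Bochner_Integration.simple_bochner_integrable.cases)
  show "finite (range f)" using sf by (auto simp: simple_function_def)
  show m [measurable]: "f \<in> borel_measurable borel"
    using borel_measurable_simple_function[OF sf] by simp
  show *: "{u. f u \<noteq> 0} \<in> fmeasurable lborel"
    using e by (intro fmeasurableI) (auto simp: less_top)
  have "f -` {y} = {u. f u = y}" by auto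
  then show "y \<noteq> 0 \<Longrightarrow> f -` {y} \<in> fmeasurable lborel"
    by (intro fmeasurableI2[OF *]) auto
qed

lemma simple_integrableI_indicator_sum:
  assumes "finite I" "\<And>i. i \<in> I \<Longrightarrow> D i \<in> fmeasurable lborel"
  shows "simple_integrable (\<lambda>u. \<Sum>i\<in>I. a i * indicator (D i) u)"
proof (rule Bochner_Integration.simple_bochner_integrableI_bounded)
  have [measurable]: "\<And>i. i \<in> I \<Longrightarrow> D i \<in> sets borel"
    using assms(2) fmeasurableD by force
  show "simple_function lborel (\<lambda>u. \<Sum>i\<in>I. a i * indicator (D i) u)"
    by (intro simple_function_sum) (auto intro!: simple_function_mult[OF simple_function_const simple_function_indicator])
  have "integrable lborel (\<lambda>u. \<Sum>i\<in>I. a i * indicator (D i) u)"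
    using assms(2) by (auto simp: fmeasurable_def)
  then show "(\<integral>\<^sup>+u. norm (\<Sum>i\<in>I. a i * indicator (D i) u) \<partial>lborel) < \<infinity>"
    by (simp add: integrable_iff_bounded)
qed

lemma disjoint_indicator_sum:
  fixes a :: "'i \<Rightarrow> real"
  assumes "finite I" "disjoint_family_on D I" "i \<in> I" "u \<in> D i"
  shows "(\<Sum>j\<in>I. a j * indicator (D j) u) = a i"
proof -
  have "(\<Sum>j\<in>I. a j * indicator (D j) u) = (\<Sum>j\<in>I. if j = i then a i else 0)"
    using assms by (intro sum.cong) (auto simp: disjoint_family_on_def indicator_def)
  then show ?thesis using assms by simp
qed

text \<open>The nonzero level sets are enumerated by natural numbers and padded with empty sets,
  because independence and additivity of a Gaussian random measure are assumed for sequences. The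
  last claim holds at every \<omega>, since it only reindexes the defining sum.\<close>

lemma simple_integrable_repr:
  assumes "simple_integrable f"
  obtains n :: nat and a :: "nat \<Rightarrow> real" and C :: "nat \<Rightarrow> real set" where
    "disjoint_family C" "range C \<subseteq> fmeasurable lborel" "\<And>k. C k \<subseteq> {u. f u \<noteq> 0}"
    "\<And>u. f u = (\<Sum>k<n. a k * indicator (C k) u)"
    "\<And>B \<omega>. simple_wiener_integral B f \<omega> = (\<Sum>k<n. a k * B (C k) \<omega>)"
proof -
  define I where "I = range f - {0}"
  have fin: "finite I" using simple_integrableD(1)[OF assms] by (simp add: I_def)
  then obtain e where e: "bij_betw e {..<card I} I"
    using ex_bij_betw_nat_finite[OF fin] by (auto simp: atLeast0LessThan)
  define C where "C k = (if k < card I then f -` {e k} else {})" for k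
  have eI: "e k \<in> I" if "k < card I" for k using e that by (auto simp: bij_betw_def)
  have inj: "e k = e l \<Longrightarrow> k < card I \<Longrightarrow> l < card I \<Longrightarrow> k = l" for k l
    using e by (auto simp: bij_betw_def inj_on_def)
  have dis: "disjoint_family C"
    using inj by (auto simp: disjoint_family_on_def C_def)
  show thesis
  proof (rule that[of C e "card I"])
    show "disjoint_family C" by fact
    show "range C \<subseteq> fmeasurable lborel"
      using eI simple_integrableD(3)[OF assms] by (auto simp: C_def I_def)
    show "C k \<subseteq> {u. f u \<noteq> 0}" for k using eI by (auto simp: C_def I_def)
    show "f u = (\<Sum>k<card I. e k * indicator (C k) u)" for u
    proof (cases "f u = 0")
      case True
      then have "indicator (C k) u = (0::real)" for k using eI[of k] by (auto simp: C_def I_def indicator_def)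
      then show ?thesis using True by simp
    next
      case False
      then have "f u \<in> e ` {..<card I}" using bij_betw_imp_surj_on[OF e] by (auto simp: I_def)
      then obtain k where "k < card I" "e k = f u"
        by auto
      then show ?thesis
        using disjoint_indicator_sum[of "{..<card I}" C k u e] disjoint_family_on_mono[OF _ dis]
        by (simp add: C_def)
    qed
    show "simple_wiener_integral B f \<omega> = (\<Sum>k<card I. e k * B (C k) \<omega>)" for B :: "real set \<Rightarrow> 'b \<Rightarrow> real" and \<omega>
    proof -
      have "simple_wiener_integral B f \<omega> = (\<Sum>y\<in>I. y * B (f -` {y}) \<omega>)"
        unfolding simple_wiener_integral_def I_def using simple_integrableD(1)[OF assms]
        by (intro sum.mono_neutral_right) auto
      also have "\<dots> = (\<Sum>k<card I. e k * B (f -` {e k}) \<omega>)"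
        by (rule sum.reindex_bij_betw[OF e, symmetric])
      finally show ?thesis by (simp add: C_def)
    qed
  qed
qed

subsection \<open>Centered normal distributions\<close>

lemma real_distribution_centered_normal: "real_distribution (centered_normal v)"
  unfolding centered_normal_def
  by (intro prob_space.real_distribution_distr real_distribution.axioms(1)[OF real_dist_normal_dist])
     (auto intro!: borel_measurable_times)

lemma char_centered_normal:
  assumes "0 \<le> v"
  shows "char (centered_normal v) t = complex_of_real (exp (- v * t\<^sup>2 / 2))"
proof -
  have "char (centered_normal v) t = char std_normal_distribution (sqrt v * t)"
    unfolding centered_normal_def char_def by (subst integral_distr) (auto simp: ac_simps)
  also have "\<dots> = complex_of_real (exp (- v * t\<^sup>2 / 2))"
    using assms by (simp add: char_std_normal_distribution power_mult_distrib)
  finally show ?thesis .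
qed

lemma centered_normal_moment:
  assumes "0 \<le> v"
  shows "integrable (centered_normal v) (\<lambda>x. x ^ k)"
    and "(\<integral>x. x ^ (2 * k) \<partial>centered_normal v) = v ^ k * (fact (2 * k) / (2 ^ k * fact k))"
    and "(\<integral>x. x \<partial>centered_normal v) = 0"
proof -
  have m: "(\<lambda>x. sqrt v * x) \<in> measurable std_normal_distribution borel" by simp
  show "integrable (centered_normal v) (\<lambda>x. x ^ k)"
    unfolding centered_normal_def
    by (subst integrable_distr_eq[OF m])
       (auto simp: power_mult_distrib intro!: integrable_mult_right integrable_std_normal_distribution_moment)
  show "(\<integral>x. x ^ (2 * k) \<partial>centered_normal v) = v ^ k * (fact (2 * k) / (2 ^ k * fact k))"
    unfolding centered_normal_def
    using assms by (subst integral_distr[OF m])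
      (auto simp: power_mult_distrib power_mult std_normal_distribution_even_moments(1)[unfolded power_mult])
  show "(\<integral>x. x \<partial>centered_normal v) = 0"
    unfolding centered_normal_def
    using integral_std_normal_distribution_moment_odd[of 1]
    by (subst integral_distr[OF m]) auto
qed

context prob_space begin

text \<open>Without \<open>0 \<le> v\<close> the parameter would not have to be the variance:
  \<open>sqrt\<close> of a negative number is minus the root of its absolute value, so
  \<open>centered_normal (- v)\<close> equals \<open>centered_normal v\<close> by symmetry.\<close>

definition gaussian_rv :: "real \<Rightarrow> ('a \<Rightarrow> real) \<Rightarrow> bool" where
  "gaussian_rv v Z \<longleftrightarrow> 0 \<le> v \<and> Z \<in> borel_measurable M \<and> distr M borel Z = centered_normal v"

text \<open>By Levy's uniqueness theorem. In this form the property passes to independent sums,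
  where characteristic functions multiply, and to limits.\<close>

lemma gaussian_rv_char_iff:
  assumes "Z \<in> borel_measurable M" "0 \<le> v"
  shows "gaussian_rv v Z \<longleftrightarrow> (\<forall>t. char (distr M borel Z) t = complex_of_real (exp (- v * t\<^sup>2 / 2)))"
proof
  assume "\<forall>t. char (distr M borel Z) t = complex_of_real (exp (- v * t\<^sup>2 / 2))"
  then have "distr M borel Z = centered_normal v"
    using assms char_centered_normal[of v]
    by (intro Levy_uniqueness real_distribution_centered_normal real_distribution_distr) auto
  then show "gaussian_rv v Z" using assms by (simp add: gaussian_rv_def)
qed (use assms char_centered_normal in \<open>auto simp: gaussian_rv_def\<close>)

lemma gaussian_rv_moment:
  assumes "gaussian_rv v Z"
  shows "integrable M (\<lambda>\<omega>. Z \<omega> ^ k)"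
    and "expectation (\<lambda>\<omega>. Z \<omega> ^ (2 * k)) = v ^ k * (fact (2 * k) / (2 ^ k * fact k))"
    and "integrable M Z" "expectation Z = 0" "integrable M (\<lambda>\<omega>. (Z \<omega>)\<^sup>2)"
    and "expectation (\<lambda>\<omega>. (Z \<omega>)\<^sup>2) = v"
    and "expectation (\<lambda>\<omega>. (Z \<omega>)^4) = 3 * v\<^sup>2"
proof -
  have [measurable]: "Z \<in> borel_measurable M" and d: "distr M borel Z = centered_normal v" and v: "0 \<le> v"
    using assms by (auto simp: gaussian_rv_def)
  show i: "integrable M (\<lambda>\<omega>. Z \<omega> ^ k)" for k
    using centered_normal_moment(1)[OF v, of k] integrable_distr_eq[of Z M borel "\<lambda>x. x ^ k"]
    by (simp add: d)
  show e: "expectation (\<lambda>\<omega>. Z \<omega> ^ (2 * k)) = v ^ k * (fact (2 * k) / (2 ^ k * fact k))" for k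
    using centered_normal_moment(2)[OF v, of k] integral_distr[of Z M borel "\<lambda>x. x ^ (2 * k)"]
    by (simp add: d)
  show "integrable M Z" using i[of 1] by simp
  have "expectation Z = (\<integral>x. x \<partial>distr M borel Z)"
    by (subst integral_distr) auto
  then show "expectation Z = 0"
    unfolding d centered_normal_moment(3)[OF v] .
  show "integrable M (\<lambda>\<omega>. (Z \<omega>)\<^sup>2)" by (rule i)
  show "expectation (\<lambda>\<omega>. (Z \<omega>)\<^sup>2) = v" using e[of 1] by simp
  show "expectation (\<lambda>\<omega>. (Z \<omega>)^4) = 3 * v\<^sup>2" using e[of 2] by (simp add: fact_numeral)
qed

lemma gaussian_rv_sum_indep:
  assumes "indep_vars (\<lambda>_. borel) Z I" "finite I" "\<And>i. i \<in> I \<Longrightarrow> gaussian_rv (v i) (Z i)"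
  shows "gaussian_rv (\<Sum>i\<in>I. (a i)\<^sup>2 * v i) (\<lambda>\<omega>. \<Sum>i\<in>I. a i * Z i \<omega>)"
proof -
  have [measurable]: "\<And>i. i \<in> I \<Longrightarrow> Z i \<in> borel_measurable M" and v: "\<And>i. i \<in> I \<Longrightarrow> 0 \<le> v i"
    using assms(3) by (auto simp: gaussian_rv_def)
  have ind: "indep_vars (\<lambda>_. borel) (\<lambda>i \<omega>. a i * Z i \<omega>) I"
    using indep_vars_compose2[OF assms(1), of "\<lambda>i x. a i * x" "\<lambda>_. borel"] by simp
  have "char (distr M borel (\<lambda>\<omega>. a i * Z i \<omega>)) t = complex_of_real (exp (- ((a i)\<^sup>2 * v i) * t\<^sup>2 / 2))"
    if "i \<in> I" for i t
  proof -
    have "char (distr M borel (\<lambda>\<omega>. a i * Z i \<omega>)) t = char (distr M borel (Z i)) (a i * t)"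
      using that unfolding char_def by (subst (1 2) integral_distr) (auto simp: ac_simps)
    also have "\<dots> = complex_of_real (exp (- v i * (a i * t)\<^sup>2 / 2))"
      using assms(3)[OF that] gaussian_rv_char_iff[of "Z i" "v i"] v[OF that] that by auto
    finally show ?thesis by (simp add: power_mult_distrib ac_simps)
  qed
  then have "char (distr M borel (\<lambda>\<omega>. \<Sum>i\<in>I. a i * Z i \<omega>)) t =
      complex_of_real (exp (- (\<Sum>i\<in>I. (a i)\<^sup>2 * v i) * t\<^sup>2 / 2))" for t
    using assms(2) by (simp add: char_distr_sum[OF ind] exp_sum[symmetric] sum_distrib_right sum_negf sum_divide_distrib
        flip: of_real_prod of_real_sum)
  then show ?thesis
    using v by (subst gaussian_rv_char_iff) (auto intro!: sum_nonneg)
qed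

text \<open>The variance of \<open>\<bar>Y \<omega>\<bar>\<close> is nonnegative.\<close>

lemma expectation_abs_le_sqrt:
  fixes Y :: "'a \<Rightarrow> real"
  assumes [measurable]: "Y \<in> borel_measurable M" and i: "integrable M (\<lambda>\<omega>. (Y \<omega>)\<^sup>2)"
  shows "expectation (\<lambda>\<omega>. \<bar>Y \<omega>\<bar>) \<le> sqrt (expectation (\<lambda>\<omega>. (Y \<omega>)\<^sup>2))"
proof -
  have "integrable M (\<lambda>\<omega>. \<bar>Y \<omega>\<bar>)"
    using square_integrable_imp_integrable[OF _ i] by simp
  then have "0 \<le> expectation (\<lambda>\<omega>. (Y \<omega>)\<^sup>2) - (expectation (\<lambda>\<omega>. \<bar>Y \<omega>\<bar>))\<^sup>2"
    using variance_eq[of "\<lambda>\<omega>. \<bar>Y \<omega>\<bar>"] variance_positive[of "\<lambda>\<omega>. \<bar>Y \<omega>\<bar>"] i by simp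
  then show ?thesis by (intro real_le_rsqrt) simp
qed

text \<open>Characteristic functions are stable under \<open>L\<^sup>1\<close>-convergence because
  \<open>y \<mapsto> exp (i t y)\<close> is Lipschitz.\<close>

lemma gaussian_rv_limit:
  assumes g: "\<And>n. gaussian_rv (v n) (Z n)" and [measurable]: "W \<in> borel_measurable M"
    and lim: "(\<lambda>n. \<integral>\<^sup>+ \<omega>. ennreal ((W \<omega> - Z n \<omega>)\<^sup>2) \<partial>M) \<longlonglongrightarrow> 0" and v: "v \<longlonglongrightarrow> w"
  shows "gaussian_rv w W"
proof -
  have [measurable]: "Z n \<in> borel_measurable M" for n using g by (auto simp: gaussian_rv_def)
  have w: "0 \<le> w" using v g by (auto simp: gaussian_rv_def intro!: LIMSEQ_le_const)
  have "char (distr M borel W) t = complex_of_real (exp (- w * t\<^sup>2 / 2))" for t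
  proof (rule LIMSEQ_unique)
    have "(\<lambda>n. complex_of_real (exp (- v n * t\<^sup>2 / 2))) \<longlonglongrightarrow> complex_of_real (exp (- w * t\<^sup>2 / 2))"
      by (intro tendsto_intros v) simp
    then show "(\<lambda>n. char (distr M borel (Z n)) t) \<longlonglongrightarrow> complex_of_real (exp (- w * t\<^sup>2 / 2))"
      using g gaussian_rv_char_iff[of "Z n" "v n" for n] by (simp add: gaussian_rv_def)
  next
    have fin: "eventually (\<lambda>n. (\<integral>\<^sup>+ \<omega>. ennreal ((W \<omega> - Z n \<omega>)\<^sup>2) \<partial>M) < 1) sequentially"
      using order_tendstoD(2)[OF lim, of 1] by simp
    \<comment> \<open>Finiteness of the distance makes the difference \<open>W - Z n\<close>
      integrable; characteristic functions exist anyway, so only this difference has to be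
      controlled.\<close>
    have bd: "norm (char (distr M borel (Z n)) t - char (distr M borel W) t)
        \<le> \<bar>t\<bar> * sqrt (enn2real (\<integral>\<^sup>+ \<omega>. ennreal ((W \<omega> - Z n \<omega>)\<^sup>2) \<partial>M))"
      if "(\<integral>\<^sup>+ \<omega>. ennreal ((W \<omega> - Z n \<omega>)\<^sup>2) \<partial>M) < 1" for n
    proof -
      have i2: "integrable M (\<lambda>\<omega>. (W \<omega> - Z n \<omega>)\<^sup>2)"
        using that by (intro integrableI_nonneg) (auto intro: less_trans)
      have i1: "integrable M (\<lambda>\<omega>. W \<omega> - Z n \<omega>)"
        using square_integrable_imp_integrable[OF _ i2] by simp
      have "char (distr M borel (Z n)) t - char (distr M borel W) t
         = (CLINT \<omega>|M. iexp (t * Z n \<omega>) - iexp (t * W \<omega>))"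
        unfolding char_def
        by (subst (1 2) integral_distr) (auto intro!: Bochner_Integration.integral_diff[symmetric] integrable_iexp)
      also have "norm \<dots> \<le> (\<integral>\<omega>. norm (iexp (t * Z n \<omega>) - iexp (t * W \<omega>)) \<partial>M)"
        by (rule integral_norm_bound)
      also have "\<dots> \<le> (\<integral>\<omega>. \<bar>t\<bar> * \<bar>W \<omega> - Z n \<omega>\<bar> \<partial>M)"
      proof (rule integral_mono_AE')
        show "integrable M (\<lambda>\<omega>. \<bar>t\<bar> * \<bar>W \<omega> - Z n \<omega>\<bar>)" using i1 by auto
        have "norm (iexp x - iexp y) \<le> \<bar>x - y\<bar>" for x y :: real
        proof -
          have "iexp x - iexp y = iexp y * (iexp (x - y) - 1)"
            by (simp add: algebra_simps flip: exp_add)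
          then have "norm (iexp x - iexp y) = norm (iexp (x - y) - 1)"
            by (simp add: norm_mult)
          also have "\<dots> \<le> \<bar>x - y\<bar>" using iexp_approx1[of "x - y" 0] by simp
          finally show ?thesis .
        qed
        from this[of "t * Z n \<omega>" "t * W \<omega>" for \<omega>]
        show "AE \<omega> in M. norm (iexp (t * Z n \<omega>) - iexp (t * W \<omega>)) \<le> \<bar>t\<bar> * \<bar>W \<omega> - Z n \<omega>\<bar>"
          by (auto simp: abs_mult[symmetric] right_diff_distrib abs_minus_commute simp del: of_real_mult)
      qed auto
      also have "\<dots> = \<bar>t\<bar> * expectation (\<lambda>\<omega>. \<bar>W \<omega> - Z n \<omega>\<bar>)" by simp
      also have "expectation (\<lambda>\<omega>. \<bar>W \<omega> - Z n \<omega>\<bar>) \<le> sqrt (expectation (\<lambda>\<omega>. (W \<omega> - Z n \<omega>)\<^sup>2))"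
        using expectation_abs_le_sqrt[OF _ i2] by simp
      also have "expectation (\<lambda>\<omega>. (W \<omega> - Z n \<omega>)\<^sup>2) = enn2real (\<integral>\<^sup>+ \<omega>. ennreal ((W \<omega> - Z n \<omega>)\<^sup>2) \<partial>M)"
        by (rule integral_eq_nn_integral) auto
      finally show ?thesis by (simp add: mult_left_mono)
    qed
    have "(\<lambda>n. \<bar>t\<bar> * sqrt (enn2real (\<integral>\<^sup>+ \<omega>. ennreal ((W \<omega> - Z n \<omega>)\<^sup>2) \<partial>M))) \<longlonglongrightarrow> \<bar>t\<bar> * sqrt (enn2real 0)"
      using lim by (intro tendsto_intros tendsto_enn2real) auto
    then have "(\<lambda>n. \<bar>t\<bar> * sqrt (enn2real (\<integral>\<^sup>+ \<omega>. ennreal ((W \<omega> - Z n \<omega>)\<^sup>2) \<partial>M))) \<longlonglongrightarrow> 0" by simp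
    then have "(\<lambda>n. char (distr M borel (Z n)) t - char (distr M borel W) t) \<longlonglongrightarrow> 0"
      by (rule Lim_null_comparison[rotated]) (use fin bd in \<open>auto elim: eventually_mono\<close>)
    then show "(\<lambda>n. char (distr M borel (Z n)) t) \<longlonglongrightarrow> char (distr M borel W) t"
      by (simp add: LIM_zero_iff)
  qed
  then show ?thesis using w by (subst gaussian_rv_char_iff) auto
qed

end

subsection \<open>Square-integrable functions\<close>

text \<open>The polynomial in t given by the integral of \<open>(t * x w + y w)\<^sup>2\<close> is
  nonnegative; it is evaluated at its minimum \<open>- ?C / ?A\<close>.\<close>

lemma Cauchy_Schwarz_integral:
  fixes x y :: "'b \<Rightarrow> real"
  assumes [measurable]: "x \<in> borel_measurable M" "y \<in> borel_measurable M"
    and x2: "integrable M (\<lambda>w. (x w)\<^sup>2)" and y2: "integrable M (\<lambda>w. (y w)\<^sup>2)"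
  shows "integrable M (\<lambda>w. x w * y w)"
    and "(\<integral>w. x w * y w \<partial>M)\<^sup>2 \<le> (\<integral>w. (x w)\<^sup>2 \<partial>M) * (\<integral>w. (y w)\<^sup>2 \<partial>M)"
proof -
  have "\<bar>x w * y w\<bar> \<le> (x w)\<^sup>2 + (y w)\<^sup>2" for w
  proof -
    have "2 * \<bar>x w * y w\<bar> \<le> (x w)\<^sup>2 + (y w)\<^sup>2"
      using sum_squares_bound[of "\<bar>x w\<bar>" "\<bar>y w\<bar>"] by (simp add: abs_mult)
    then show ?thesis by linarith
  qed
  then show xy: "integrable M (\<lambda>w. x w * y w)"
    using x2 y2 by (intro Bochner_Integration.integrable_bound[OF Bochner_Integration.integrable_add[OF x2 y2]]) auto
  let ?A = "\<integral>w. (x w)\<^sup>2 \<partial>M" and ?B = "\<integral>w. (y w)\<^sup>2 \<partial>M" and ?C = "\<integral>w. x w * y w \<partial>M"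
  have q: "0 \<le> t\<^sup>2 * ?A + 2 * t * ?C + ?B" for t
  proof -
    have "0 \<le> (\<integral>w. (t * x w + y w)\<^sup>2 \<partial>M)" by simp
    also have "\<dots> = (\<integral>w. t\<^sup>2 * (x w)\<^sup>2 + 2 * t * (x w * y w) + (y w)\<^sup>2 \<partial>M)"
      by (intro Bochner_Integration.integral_cong refl) (simp add: power2_eq_square algebra_simps)
    also have "\<dots> = t\<^sup>2 * ?A + 2 * t * ?C + ?B"
      using x2 y2 xy by simp
    finally show ?thesis .
  qed
  show "?C\<^sup>2 \<le> ?A * ?B"
  proof (cases "?A = 0")
    case True
    \<comment> \<open>With \<open>?A = 0\<close> the polynomial is affine in t; if its slope were
      nonzero, the chosen t would give it the value -1.\<close>
    have "?C = 0"
    proof (rule ccontr)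
      assume "?C \<noteq> 0"
      then show False using q[of "- (?B + 1) / (2 * ?C)"] True by (simp add: field_simps)
    qed
    then show ?thesis using True by simp
  next
    case False
    then have "0 < ?A" by (simp add: order_less_le)
    then show ?thesis
      using mult_nonneg_nonneg[OF less_imp_le q[of "- ?C / ?A"], of ?A]
      by (simp add: power2_eq_square algebra_simps)
  qed
qed

text \<open>The square of the distance, whence the factors 2 in the triangle inequality below.
  Values in \<open>ennreal\<close> let convergence be stated before square integrability of the
  limit is known.\<close>

definition l2dist :: "'b measure \<Rightarrow> ('b \<Rightarrow> real) \<Rightarrow> ('b \<Rightarrow> real) \<Rightarrow> ennreal" where
  "l2dist M f g = (\<integral>\<^sup>+ w. ennreal ((f w - g w)\<^sup>2) \<partial>M)"

lemma l2dist_commute: "l2dist M f g = l2dist M g f"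
  by (simp add: l2dist_def power2_commute)

lemma square_diff_triangle: "((a::real) - c)\<^sup>2 \<le> 2 * (a - b)\<^sup>2 + 2 * (b - c)\<^sup>2"
  using sum_squares_bound[of "a - b" "b - c"] by (simp add: power2_eq_square algebra_simps)

lemma l2dist_triangle:
  assumes [measurable]: "f \<in> borel_measurable M" "g \<in> borel_measurable M" "h \<in> borel_measurable M"
  shows "l2dist M f h \<le> 2 * l2dist M f g + 2 * l2dist M g h"
proof -
  have "l2dist M f h \<le> (\<integral>\<^sup>+ w. 2 * ennreal ((f w - g w)\<^sup>2) + 2 * ennreal ((g w - h w)\<^sup>2) \<partial>M)"
    unfolding l2dist_def
  proof (intro nn_integral_mono)
    fix w
    have "ennreal ((f w - h w)\<^sup>2) \<le> ennreal (2 * (f w - g w)\<^sup>2 + 2 * (g w - h w)\<^sup>2)"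
      by (intro ennreal_leI square_diff_triangle)
    then show "ennreal ((f w - h w)\<^sup>2) \<le> 2 * ennreal ((f w - g w)\<^sup>2) + 2 * ennreal ((g w - h w)\<^sup>2)"
      by (simp add: ennreal_mult)
  qed
  then show ?thesis by (simp add: l2dist_def nn_integral_add nn_integral_cmult)
qed

lemma l2dist_cong_AE:
  "AE w in M. f w = f' w \<Longrightarrow> AE w in M. g w = g' w \<Longrightarrow> l2dist M f g = l2dist M f' g'"
  unfolding l2dist_def by (intro nn_integral_cong_AE) (auto elim: eventually_elim2)

lemma l2dist_integral:
  assumes "integrable M (\<lambda>w. (f w - g w)\<^sup>2)"
  shows "l2dist M f g = ennreal (\<integral>w. (f w - g w)\<^sup>2 \<partial>M)"
  unfolding l2dist_def using assms by (intro nn_integral_eq_integral) auto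

lemma square_integrable_l2dist:
  assumes [measurable]: "f \<in> borel_measurable M" "g \<in> borel_measurable M"
    and g: "integrable M (\<lambda>w. (g w)\<^sup>2)" and d: "l2dist M f g < \<infinity>"
  shows "integrable M (\<lambda>w. (f w)\<^sup>2)"
proof -
  have i: "integrable M (\<lambda>w. (f w - g w)\<^sup>2)"
    using d by (intro integrableI_nonneg) (auto simp: l2dist_def)
  have "(f w)\<^sup>2 \<le> 2 * (f w - g w)\<^sup>2 + 2 * (g w)\<^sup>2" for w
    using square_diff_triangle[of "f w" 0 "g w"] by simp
  then show ?thesis
    by (intro Bochner_Integration.integrable_bound[OF Bochner_Integration.integrable_add[OF
         integrable_mult_right[of 2, OF i] integrable_mult_right[of 2, OF g]]]) auto
qed

lemma square_integrable_lin:
  fixes f g :: "'b \<Rightarrow> real"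
  assumes [measurable]: "f \<in> borel_measurable M" "g \<in> borel_measurable M"
    and f: "integrable M (\<lambda>w. (f w)\<^sup>2)" and g: "integrable M (\<lambda>w. (g w)\<^sup>2)"
  shows "integrable M (\<lambda>w. (a * f w + b * g w)\<^sup>2)"
    and "(\<integral>w. (a * f w + b * g w)\<^sup>2 \<partial>M) =
      a\<^sup>2 * (\<integral>w. (f w)\<^sup>2 \<partial>M) + 2 * a * b * (\<integral>w. f w * g w \<partial>M) + b\<^sup>2 * (\<integral>w. (g w)\<^sup>2 \<partial>M)"
proof -
  have eq: "(\<lambda>w. (a * f w + b * g w)\<^sup>2) = (\<lambda>w. a\<^sup>2 * (f w)\<^sup>2 + 2 * a * b * (f w * g w) + b\<^sup>2 * (g w)\<^sup>2)"
    by (auto simp: power2_eq_square algebra_simps)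
  note fg = Cauchy_Schwarz_integral(1)[OF assms]
  show "integrable M (\<lambda>w. (a * f w + b * g w)\<^sup>2)" unfolding eq using f g fg by simp
  show "(\<integral>w. (a * f w + b * g w)\<^sup>2 \<partial>M) =
      a\<^sup>2 * (\<integral>w. (f w)\<^sup>2 \<partial>M) + 2 * a * b * (\<integral>w. f w * g w \<partial>M) + b\<^sup>2 * (\<integral>w. (g w)\<^sup>2 \<partial>M)"
    unfolding eq using f g fg by simp
qed

text \<open>The squared norm of \<open>s n\<close> is that of f, minus twice the inner product of f
  with \<open>f - s n\<close>, plus the squared distance. Cauchy-Schwarz sends the mixed term to
  0.\<close>

lemma l2dist_tendsto_norm:
  assumes [measurable]: "f \<in> borel_measurable M" "\<And>n. s n \<in> borel_measurable M"
    and s: "\<And>n. integrable M (\<lambda>w. (s n w)\<^sup>2)" and lim: "(\<lambda>n. l2dist M f (s n)) \<longlonglongrightarrow> 0"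
  shows "integrable M (\<lambda>w. (f w)\<^sup>2)"
    and "(\<lambda>n. \<integral>w. (s n w)\<^sup>2 \<partial>M) \<longlonglongrightarrow> (\<integral>w. (f w)\<^sup>2 \<partial>M)"
proof -
  have "eventually (\<lambda>n. l2dist M f (s n) < \<infinity>) sequentially"
    using order_tendstoD(2)[OF lim, of \<infinity>] by simp
  then obtain n where "l2dist M f (s n) < \<infinity>" by (auto simp: eventually_sequentially)
  from square_integrable_l2dist[OF _ _ s this] show f: "integrable M (\<lambda>w. (f w)\<^sup>2)" by simp
  have i: "integrable M (\<lambda>w. (f w - s n w)\<^sup>2)" for n
    using square_integrable_lin(1)[OF assms(1,2) f s[of n], where a = 1 and b = "- 1"] by simp
  define d where "d n = (\<integral>w. (f w - s n w)\<^sup>2 \<partial>M)" for n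
  have "l2dist M f (s n) = ennreal (d n)" for n using l2dist_integral[OF i] by (simp add: d_def)
  then have d0: "d \<longlonglongrightarrow> 0"
    using lim ennreal_tendsto_0_iff[of d] by (simp add: d_def)
  define e where "e n = (\<integral>w. f w * (f w - s n w) \<partial>M)" for n
  let ?F = "\<integral>w. (f w)\<^sup>2 \<partial>M"
  have eq: "(\<integral>w. (s n w)\<^sup>2 \<partial>M) = ?F - 2 * e n + d n" for n
    using square_integrable_lin(2)[OF _ _ f i[of n], where a = 1 and b = "- 1"] by (simp add: e_def d_def)
  have "norm (e n) \<le> sqrt (?F * d n)" for n
    using Cauchy_Schwarz_integral(2)[OF _ _ f i[of n]] by (auto simp: e_def d_def intro!: real_le_rsqrt)
  moreover have "(\<lambda>n. sqrt (?F * d n)) \<longlonglongrightarrow> sqrt (?F * 0)" by (intro tendsto_intros d0)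
  ultimately have "e \<longlonglongrightarrow> 0"
    by (intro Lim_null_comparison[of e "\<lambda>n. sqrt (?F * d n)"]) auto
  then have "(\<lambda>n. ?F - 2 * e n + d n) \<longlonglongrightarrow> ?F - 2 * 0 + 0" by (intro tendsto_intros d0)
  then show "(\<lambda>n. \<integral>w. (s n w)\<^sup>2 \<partial>M) \<longlonglongrightarrow> ?F" by (simp add: eq)
qed

text \<open>The sum of the squared differences has a finite integral, so it is finite almost
  everywhere and its terms tend to 0.\<close>

lemma AE_tendsto_of_summable_l2dist:
  assumes [measurable]: "f \<in> borel_measurable M" "\<And>n. s n \<in> borel_measurable M"
    and b: "\<And>n. l2dist M f (s n) \<le> ennreal ((1 / 2) ^ n)"
  shows "AE w in M. (\<lambda>n. s n w) \<longlonglongrightarrow> f w"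
proof -
  have "(\<integral>\<^sup>+ w. (\<Sum>n. ennreal ((f w - s n w)\<^sup>2)) \<partial>M) = (\<Sum>n. l2dist M f (s n))"
    unfolding l2dist_def by (rule nn_integral_suminf) simp
  also have "\<dots> \<le> (\<Sum>n. ennreal ((1 / 2) ^ n))" by (intro suminf_le b) auto
  also have "\<dots> < \<infinity>" by (subst suminf_ennreal_eq[OF _ power_half_series[THEN sums_mult, of 2, simplified]])
      (auto simp: power_half_series)
  finally have "AE w in M. (\<Sum>n. ennreal ((f w - s n w)\<^sup>2)) \<noteq> \<infinity>"
    by (intro nn_integral_noteq_infinite) auto
  then show ?thesis
  proof (rule AE_mp, intro AE_I2 impI)
    fix w assume "(\<Sum>n. ennreal ((f w - s n w)\<^sup>2)) \<noteq> \<infinity>"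
    then have "summable (\<lambda>n. (f w - s n w)\<^sup>2)"
      by (intro summable_suminf_not_top) (auto simp: top_ennreal_def)
    from summable_LIMSEQ_zero[OF this] have "(\<lambda>n. sqrt ((f w - s n w)\<^sup>2)) \<longlonglongrightarrow> sqrt 0"
      by (intro tendsto_intros)
    then have "(\<lambda>n. f w - s n w) \<longlonglongrightarrow> 0" by (simp add: tendsto_rabs_zero_iff)
    from tendsto_diff[OF tendsto_const[of "f w"] this] show "(\<lambda>n. s n w) \<longlonglongrightarrow> f w" by simp
  qed
qed

lemma simple_integrable_square_integrable:
  assumes "simple_integrable f"
  shows "integrable lborel (\<lambda>u. (f u)\<^sup>2)"
proof -
  have "simple_integrable (\<lambda>u. f u * f u)"
    using Bochner_Integration.simple_bochner_integrable_compose2[of "(*)", OF _ assms assms] by simp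
  then show ?thesis
    using Bochner_Integration.integrableI_simple_bochner_integrable by (simp add: power2_eq_square)
qed

lemma simple_integrable_lin:
  assumes "simple_integrable f" "simple_integrable g"
  shows "simple_integrable (\<lambda>u. a * f u + b * g u)"
  by (rule Bochner_Integration.simple_bochner_integrable_compose2[of "\<lambda>x y. a * x + b * y", OF _ assms]) simp

lemma simple_integrable_indicator:
  assumes "simple_integrable f" "A \<in> sets borel"
  shows "simple_integrable (\<lambda>u. f u * indicator A u)"
proof -
  from assms have sf: "simple_function lborel f" and e: "emeasure lborel {y. f y \<noteq> 0} \<noteq> \<infinity>"
    by (auto elim!: Bochner_Integration.simple_bochner_integrable.cases)
  have [measurable]: "f \<in> borel_measurable borel" by (rule simple_integrableD) fact
  have "emeasure lborel {y. f y * indicator A y \<noteq> 0} \<le> emeasure lborel {y. f y \<noteq> 0}"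
    by (intro emeasure_mono) auto
  then show ?thesis
    using sf e assms(2)
    by (intro Bochner_Integration.simple_bochner_integrable.intros simple_function_mult simple_function_indicator)
       (auto simp: top_unique)
qed

subsection \<open>The Wiener integral\<close>

lemma tendsto_0_le_ennreal:
  fixes p q :: "nat \<Rightarrow> ennreal"
  assumes "\<And>n. p n \<le> q n" "q \<longlonglongrightarrow> 0"
  shows "p \<longlonglongrightarrow> 0"
  by (rule tendsto_sandwich[OF _ _ tendsto_const assms(2)]) (simp_all add: assms(1))

context gaussian_random_measure begin

text \<open>Additivity for the constant sequence of empty sets makes a constant series converge, so
  the constant is 0.\<close>

lemma AE_B_empty: "AE \<omega> in M. B {} \<omega> = 0"
proof -
  have "AE \<omega> in M. (\<lambda>i::nat. B {} \<omega>) sums B (\<Union>i::nat. {}) \<omega>"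
    by (rule countably_additive_B) (auto simp: disjoint_family_on_def)
  then show ?thesis
  proof (rule AE_mp, intro AE_I2 impI)
    fix \<omega> assume "(\<lambda>i::nat. B {} \<omega>) sums B (\<Union>i::nat. {}) \<omega>"
    then have "summable (\<lambda>i::nat. B {} \<omega>)" by (rule sums_summable)
    then show "B {} \<omega> = 0" by (simp add: summable_const_iff)
  qed
qed

text \<open>Countable additivity for the family padded with empty sets, on which B vanishes almost
  surely.\<close>

lemma AE_B_UN:
  assumes "finite I" "disjoint_family_on D I" "\<And>i. i \<in> I \<Longrightarrow> D i \<in> fmeasurable lborel"
  shows "AE \<omega> in M. B (\<Union>i\<in>I. D i) \<omega> = (\<Sum>i\<in>I. B (D i) \<omega>)"
proof -
  obtain e where e: "bij_betw e {..<card I} I"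
    using ex_bij_betw_nat_finite[OF assms(1)] by (auto simp: atLeast0LessThan)
  define C where "C k = (if k < card I then D (e k) else {})" for k
  have eI: "e k \<in> I" if "k < card I" for k using e that by (auto simp: bij_betw_def)
  have inj: "e k = e l \<Longrightarrow> k < card I \<Longrightarrow> l < card I \<Longrightarrow> k = l" for k l
    using e by (auto simp: bij_betw_def inj_on_def)
  have dis: "disjoint_family C"
    unfolding disjoint_family_on_def
  proof (intro ballI impI)
    fix m n :: nat assume "m \<noteq> n"
    then show "C m \<inter> C n = {}"
      using inj[of m n] eI[of m] eI[of n] assms(2) by (auto simp: C_def disjoint_family_on_def)
  qed
  have UN: "(\<Union>k. C k) = (\<Union>i\<in>I. D i)"
  proof -
    have "(\<Union>k. C k) = (\<Union>k\<in>{..<card I}. D (e k))" by (auto simp: C_def split: if_splits)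
    also have "\<dots> = (\<Union>i\<in>e ` {..<card I}. D i)" by auto
    finally show ?thesis by (simp add: bij_betw_imp_surj_on[OF e])
  qed
  have fm: "range C \<subseteq> fmeasurable lborel" using eI assms(3) by (auto simp: C_def)
  have "(\<Union>i\<in>I. D i) \<in> fmeasurable lborel" using assms(1,3) by (intro fmeasurable.finite_UN) auto
  then have "AE \<omega> in M. (\<lambda>k. B (C k) \<omega>) sums B (\<Union>i\<in>I. D i) \<omega>"
    using countably_additive_B[OF dis fm] by (simp add: UN)
  with AE_B_empty show ?thesis
  proof eventually_elim
    fix \<omega> assume 0: "B {} \<omega> = 0" and s: "(\<lambda>k. B (C k) \<omega>) sums B (\<Union>i\<in>I. D i) \<omega>"
    have "(\<lambda>k. B (C k) \<omega>) sums (\<Sum>k<card I. B (C k) \<omega>)"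
      by (rule sums_finite) (auto simp: C_def 0)
    with s have "B (\<Union>i\<in>I. D i) \<omega> = (\<Sum>k<card I. B (C k) \<omega>)" by (rule sums_unique2)
    also have "\<dots> = (\<Sum>k<card I. B (D (e k)) \<omega>)" by (intro sum.cong) (auto simp: C_def)
    also have "\<dots> = (\<Sum>i\<in>I. B (D i) \<omega>)" by (rule sum.reindex_bij_betw[OF e])
    finally show "B (\<Union>i\<in>I. D i) \<omega> = (\<Sum>i\<in>I. B (D i) \<omega>)" .
  qed
qed

abbreviation swi :: "(real \<Rightarrow> real) \<Rightarrow> 'a \<Rightarrow> real" where
  "swi \<equiv> simple_wiener_integral B"

abbreviation hwi :: "(real \<Rightarrow> real) \<Rightarrow> ('a \<Rightarrow> real) \<Rightarrow> bool" where
  "hwi \<equiv> has_wiener_integral M B"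

text \<open>The representation need not be canonical. Several \<open>D i\<close> may carry the same
  coefficient; additivity merges them into a level set of f. A coefficient that is not a value of f
  belongs to an empty \<open>D i\<close>.\<close>

lemma AE_swi_indicator_sum:
  assumes fin: "finite I" and dis: "disjoint_family_on D I" and fm: "\<And>i. i \<in> I \<Longrightarrow> D i \<in> fmeasurable lborel"
    and f: "\<And>u. f u = (\<Sum>i\<in>I. a i * indicator (D i) u)"
  shows "AE \<omega> in M. swi f \<omega> = (\<Sum>i\<in>I. a i * B (D i) \<omega>)"
proof -
  have ext: "f = (\<lambda>u. \<Sum>i\<in>I. a i * indicator (D i) u)" using f by auto
  have fr: "finite (range f)" unfolding ext by (intro simple_integrableD(1) simple_integrableI_indicator_sum fin fm)
  define J where "J y = {i\<in>I. a i = y}" for y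
  have val: "f u = a i" if "i \<in> I" "u \<in> D i" for u i
    unfolding f using disjoint_indicator_sum[OF fin dis that] .
  have zero: "f u = 0" if "\<And>i. i \<in> I \<Longrightarrow> u \<notin> D i" for u
    unfolding f using that by (intro sum.neutral) auto
  have pre: "f -` {y} = (\<Union>i\<in>J y. D i)" if "y \<noteq> 0" for y
  proof (intro set_eqI iffI)
    fix u assume "u \<in> f -` {y}"
    then have "f u = y" by simp
    then have "\<exists>i\<in>I. u \<in> D i" using zero[of u] that by auto
    then obtain i where "i \<in> I" "u \<in> D i" by auto
    then show "u \<in> (\<Union>i\<in>J y. D i)" using val \<open>f u = y\<close> by (auto simp: J_def)
  qed (use val in \<open>auto simp: J_def\<close>)
  have "AE \<omega> in M. \<forall>y\<in>range f. y \<noteq> 0 \<longrightarrow> B (f -` {y}) \<omega> = (\<Sum>i\<in>J y. B (D i) \<omega>)"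
  proof (subst AE_ball_countable, simp add: fr countable_finite, intro ballI)
    fix y
    have "AE \<omega> in M. B (\<Union>i\<in>J y. D i) \<omega> = (\<Sum>i\<in>J y. B (D i) \<omega>)"
      using fin dis fm by (intro AE_B_UN) (auto simp: J_def disjoint_family_on_def)
    then show "AE \<omega> in M. y \<noteq> 0 \<longrightarrow> B (f -` {y}) \<omega> = (\<Sum>i\<in>J y. B (D i) \<omega>)"
      by (auto simp: pre)
  qed
  with AE_B_empty show ?thesis
  proof eventually_elim
    fix \<omega> assume 0: "B {} \<omega> = 0" and B: "\<forall>y\<in>range f. y \<noteq> 0 \<longrightarrow> B (f -` {y}) \<omega> = (\<Sum>i\<in>J y. B (D i) \<omega>)"
    have "swi f \<omega> = (\<Sum>y\<in>range f. \<Sum>i\<in>J y. a i * B (D i) \<omega>)"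
      unfolding simple_wiener_integral_def
    proof (intro sum.cong refl)
      fix y assume "y \<in> range f"
      with B have "y * B (f -` {y}) \<omega> = y * (\<Sum>i\<in>J y. B (D i) \<omega>)" by (cases "y = 0") auto
      also have "\<dots> = (\<Sum>i\<in>J y. a i * B (D i) \<omega>)"
        unfolding sum_distrib_left by (intro sum.cong) (auto simp: J_def)
      finally show "y * B (f -` {y}) \<omega> = (\<Sum>i\<in>J y. a i * B (D i) \<omega>)" .
    qed
    also have "\<dots> = (\<Sum>i\<in>(\<Union>y\<in>range f. J y). a i * B (D i) \<omega>)"
      using fr fin by (intro sum.UNION_disjoint[symmetric]) (auto simp: J_def)
    also have "\<dots> = (\<Sum>i\<in>I. a i * B (D i) \<omega>)"
    proof (rule sum.mono_neutral_left[OF fin])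
      show "\<forall>i\<in>I - (\<Union>y\<in>range f. J y). a i * B (D i) \<omega> = 0"
      proof
        fix i assume i: "i \<in> I - (\<Union>y\<in>range f. J y)"
        then have "D i = {}" using val[of i] by (auto simp: J_def) (metis equals0I rangeI)
        then show "a i * B (D i) \<omega> = 0" by (simp add: 0)
      qed
    qed (auto simp: J_def)
    finally show "swi f \<omega> = (\<Sum>i\<in>I. a i * B (D i) \<omega>)" .
  qed
qed

text \<open>All three integrals are written over the joint level sets of f and g. The pair (0,0) is
  left out because its level set has infinite measure; it contributes nothing to any of the
  sums.\<close>

lemma AE_swi_lin:
  assumes f: "simple_integrable f" and g: "simple_integrable g"
  shows "AE \<omega> in M. swi (\<lambda>u. a * f u + b * g u) \<omega> = a * swi f \<omega> + b * swi g \<omega>"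
proof -
  define h where "h u = (f u, g u)" for u
  define I where "I = range h - {(0, 0)}"
  define D where "D p = h -` {p}" for p
  have "range h \<subseteq> range f \<times> range g" by (auto simp: h_def)
  then have fin: "finite I" using simple_integrableD(1)[OF f] simple_integrableD(1)[OF g]
    unfolding I_def by (intro finite_Diff) (rule finite_subset, auto)
  have dis: "disjoint_family_on D I" by (auto simp: D_def disjoint_family_on_def)
  have fm: "D p \<in> fmeasurable lborel" if "p \<in> I" for p
  proof -
    have [measurable]: "f \<in> borel_measurable borel" "g \<in> borel_measurable borel"
      using f g simple_integrableD by auto
    have eq: "D p = {u. f u = fst p \<and> g u = snd p}" by (auto simp: D_def h_def)
    have "D p \<in> sets lborel" unfolding eq by measurable
    moreover have "D p \<subseteq> {u. f u \<noteq> 0} \<union> {u. g u \<noteq> 0}" using that by (auto simp: D_def I_def h_def)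
    ultimately show ?thesis
      by (rule fmeasurableI2[OF fmeasurable.Un[OF simple_integrableD(4)[OF f] simple_integrableD(4)[OF g]], rotated])
  qed
  have rep: "k u = (\<Sum>p\<in>I. v p * indicator (D p) u)" if "\<And>u. k u = v (h u)" "v (0,0) = 0"
    for k :: "real \<Rightarrow> real" and v :: "real \<times> real \<Rightarrow> real" and u
  proof (cases "h u = (0, 0)")
    case True
    have "(\<Sum>p\<in>I. v p * indicator (D p) u) = 0"
    proof (intro sum.neutral ballI)
      fix p assume "p \<in> I"
      then have "u \<notin> D p" using True by (auto simp: D_def I_def)
      then show "v p * indicator (D p) u = 0" by simp
    qed
    then show ?thesis using that True by simp
  next
    case False
    then have "h u \<in> I" "u \<in> D (h u)" by (simp_all add: I_def D_def)
    from disjoint_indicator_sum[OF fin dis this, of v] show ?thesis by (simp only: that)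
  qed
  have "AE \<omega> in M. swi (\<lambda>u. a * f u + b * g u) \<omega> = (\<Sum>p\<in>I. (a * fst p + b * snd p) * B (D p) \<omega>)"
    by (intro AE_swi_indicator_sum[OF fin dis fm] rep) (auto simp: h_def)
  moreover have "AE \<omega> in M. swi f \<omega> = (\<Sum>p\<in>I. fst p * B (D p) \<omega>)"
    by (intro AE_swi_indicator_sum[OF fin dis fm] rep) (auto simp: h_def)
  moreover have "AE \<omega> in M. swi g \<omega> = (\<Sum>p\<in>I. snd p * B (D p) \<omega>)"
    by (intro AE_swi_indicator_sum[OF fin dis fm] rep) (auto simp: h_def)
  ultimately show ?thesis
    by eventually_elim (simp add: sum_distrib_left sum.distrib[symmetric] algebra_simps)
qed

lemma gaussian_rv_B: "A \<in> fmeasurable lborel \<Longrightarrow> gaussian_rv (measure lborel A) (B A)"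
  using random_variable_B distr_B by (simp add: gaussian_rv_def)

lemma gaussian_rv_swi:
  assumes "simple_integrable f"
  shows "gaussian_rv (\<integral>u. (f u)\<^sup>2 \<partial>lborel) (swi f)"
proof (rule simple_integrable_repr[OF assms])
  fix n :: nat and a :: "nat \<Rightarrow> real" and C :: "nat \<Rightarrow> real set"
  assume C: "disjoint_family C" "range C \<subseteq> fmeasurable lborel"
    and f: "\<And>u. f u = (\<Sum>k<n. a k * indicator (C k) u)"
    and swi: "\<And>(B :: real set \<Rightarrow> 'a \<Rightarrow> real) \<omega>. simple_wiener_integral B f \<omega> = (\<Sum>k<n. a k * B (C k) \<omega>)"
  have "gaussian_rv (\<Sum>k<n. (a k)\<^sup>2 * measure lborel (C k)) (\<lambda>\<omega>. \<Sum>k<n. a k * B (C k) \<omega>)"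
  proof (rule gaussian_rv_sum_indep)
    show "indep_vars (\<lambda>_. borel) (\<lambda>k. B (C k)) {..<n}"
      by (rule indep_vars_subset[OF indep_B[OF C]]) simp
    show "gaussian_rv (measure lborel (C k)) (B (C k))" for k
      by (rule gaussian_rv_B) (use C(2) in \<open>simp add: image_subset_iff\<close>)
  qed simp
  moreover have "(\<integral>u. (f u)\<^sup>2 \<partial>lborel) = (\<Sum>k<n. (a k)\<^sup>2 * measure lborel (C k))"
  proof -
    have "(f u)\<^sup>2 = (\<Sum>k<n. (a k)\<^sup>2 * indicator (C k) u)" for u
    proof (cases "\<exists>k<n. u \<in> C k")
      case True
      then obtain k where k: "k < n" "u \<in> C k" by auto
      have d: "disjoint_family_on C {..<n}" using C(1) by (rule disjoint_family_on_mono[rotated]) simp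
      show ?thesis unfolding f
        using disjoint_indicator_sum[OF _ d, of k u a] disjoint_indicator_sum[OF _ d, of k u "\<lambda>k. (a k)\<^sup>2"] k by simp
    next
      case False
      then have "(\<Sum>k<n. a k * indicator (C k) u) = 0" "(\<Sum>k<n. (a k)\<^sup>2 * indicator (C k) u) = 0"
        by (intro sum.neutral; auto)+
      then show ?thesis by (simp add: f)
    qed
    then have "(\<integral>u. (f u)\<^sup>2 \<partial>lborel) = (\<integral>u. (\<Sum>k<n. (a k)\<^sup>2 * indicator (C k) u) \<partial>lborel)"
      by (simp only:)
    also have "\<dots> = (\<Sum>k<n. \<integral>u. (a k)\<^sup>2 * indicator (C k) u \<partial>lborel)"
      using C(2) by (intro Bochner_Integration.integral_sum) (auto simp: fmeasurable_def subset_eq)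
    also have "\<dots> = (\<Sum>k<n. (a k)\<^sup>2 * measure lborel (C k))"
      by simp
    finally show ?thesis .
  qed
  moreover have "swi f = (\<lambda>\<omega>. \<Sum>k<n. a k * B (C k) \<omega>)" using swi by auto
  ultimately show ?thesis by simp
qed

lemma measurable_swi [measurable]: "simple_integrable f \<Longrightarrow> swi f \<in> borel_measurable M"
  using gaussian_rv_swi by (auto simp: gaussian_rv_def)

text \<open>Linearity reduces the distance to the variance of a single simple integral.\<close>

lemma l2dist_swi:
  assumes f: "simple_integrable f" and g: "simple_integrable g"
  shows "l2dist M (swi f) (swi g) = l2dist lborel f g"
proof -
  have s: "simple_integrable (\<lambda>u. f u - g u)" using simple_integrable_lin[OF f g, of 1 "-1"] by simp
  have "AE \<omega> in M. swi (\<lambda>u. f u - g u) \<omega> = swi f \<omega> - swi g \<omega>"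
    using AE_swi_lin[OF f g, of 1 "-1"] by simp
  then have "l2dist M (swi f) (swi g) = l2dist M (swi (\<lambda>u. f u - g u)) (\<lambda>_. 0)"
    unfolding l2dist_def by (intro nn_integral_cong_AE) (auto elim!: eventually_mono)
  also have "\<dots> = ennreal (\<integral>u. (f u - g u)\<^sup>2 \<partial>lborel)"
    using gaussian_rv_moment[OF gaussian_rv_swi[OF s]] by (subst l2dist_integral) auto
  also have "\<dots> = l2dist lborel f g"
    using simple_integrable_square_integrable[OF s] by (subst l2dist_integral) auto
  finally show ?thesis .
qed

lemma hwiI:
  assumes "f \<in> borel_measurable borel" "Z \<in> borel_measurable M"
    and "\<And>n. simple_integrable (s n)" "(\<lambda>n. l2dist lborel f (s n)) \<longlonglongrightarrow> 0" "(\<lambda>n. l2dist M Z (swi (s n))) \<longlonglongrightarrow> 0"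
  shows "hwi f Z"
  unfolding has_wiener_integral_def
proof (intro conjI exI[of _ s] allI)
qed (use assms in \<open>simp_all add: l2dist_def\<close>)

lemma hwiE:
  assumes "hwi f Z"
  obtains s where "f \<in> borel_measurable borel" "Z \<in> borel_measurable M" "\<And>n. simple_integrable (s n)"
    "(\<lambda>n. l2dist lborel f (s n)) \<longlonglongrightarrow> 0" "(\<lambda>n. l2dist M Z (swi (s n))) \<longlonglongrightarrow> 0"
proof -
  from assms obtain s where "\<forall>n. simple_integrable (s n)"
    "(\<lambda>n. \<integral>\<^sup>+ u. ennreal ((f u - s n u)\<^sup>2) \<partial>lborel) \<longlonglongrightarrow> 0"
    "(\<lambda>n. \<integral>\<^sup>+ \<omega>. ennreal ((Z \<omega> - swi (s n) \<omega>)\<^sup>2) \<partial>M) \<longlonglongrightarrow> 0"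
    unfolding has_wiener_integral_def by (elim conjE exE)
  with assms show thesis
    by (intro that[of s]) (simp_all add: l2dist_def has_wiener_integral_def)
qed

lemma hwi_measurable: "hwi f Z \<Longrightarrow> f \<in> borel_measurable borel" "hwi f Z \<Longrightarrow> Z \<in> borel_measurable M"
  by (auto simp: has_wiener_integral_def)

lemma hwi_gaussian:
  assumes "hwi f Z"
  shows "integrable lborel (\<lambda>u. (f u)\<^sup>2)" "gaussian_rv (\<integral>u. (f u)\<^sup>2 \<partial>lborel) Z"
proof -
  from hwiE[OF assms] obtain s where [measurable]: "f \<in> borel_measurable borel" "Z \<in> borel_measurable M"
    and s: "\<And>n. simple_integrable (s n)" and l: "(\<lambda>n. l2dist lborel f (s n)) \<longlonglongrightarrow> 0"
      "(\<lambda>n. l2dist M Z (swi (s n))) \<longlonglongrightarrow> 0" by metis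
  have [measurable]: "s n \<in> borel_measurable borel" for n using simple_integrableD(2)[OF s] .
  show "integrable lborel (\<lambda>u. (f u)\<^sup>2)"
    using l2dist_tendsto_norm(1)[OF _ _ simple_integrable_square_integrable[OF s] l(1)] by simp
  show "gaussian_rv (\<integral>u. (f u)\<^sup>2 \<partial>lborel) Z"
  proof (rule gaussian_rv_limit[OF gaussian_rv_swi[OF s]])
    show "(\<lambda>n. \<integral>u. (s n u)\<^sup>2 \<partial>lborel) \<longlonglongrightarrow> (\<integral>u. (f u)\<^sup>2 \<partial>lborel)"
      using l2dist_tendsto_norm(2)[OF _ _ simple_integrable_square_integrable[OF s] l(1)] by simp
  qed (use l in \<open>auto simp: l2dist_def\<close>)
qed

lemma l2dist_lin:
  assumes [measurable]: "f \<in> borel_measurable N" "g \<in> borel_measurable N" "f' \<in> borel_measurable N" "g' \<in> borel_measurable N"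
  shows "l2dist N (\<lambda>u. a * f u + b * g u) (\<lambda>u. a * f' u + b * g' u)
    \<le> ennreal (2 * a\<^sup>2) * l2dist N f f' + ennreal (2 * b\<^sup>2) * l2dist N g g'"
proof -
  have "l2dist N (\<lambda>u. a * f u + b * g u) (\<lambda>u. a * f' u + b * g' u)
    \<le> (\<integral>\<^sup>+ u. ennreal (2 * a\<^sup>2) * ennreal ((f u - f' u)\<^sup>2) + ennreal (2 * b\<^sup>2) * ennreal ((g u - g' u)\<^sup>2) \<partial>N)"
    unfolding l2dist_def
  proof (intro nn_integral_mono)
    fix u
    have "(a * f u + b * g u - (a * f' u + b * g' u))\<^sup>2 \<le> 2 * a\<^sup>2 * (f u - f' u)\<^sup>2 + 2 * b\<^sup>2 * (g u - g' u)\<^sup>2"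
      using square_diff_triangle[of "a * (f u - f' u)" "- (b * (g u - g' u))" 0]
      by (simp only: power_mult_distrib[symmetric] mult.assoc) (simp add: algebra_simps power_mult_distrib)
    then show "ennreal ((a * f u + b * g u - (a * f' u + b * g' u))\<^sup>2) \<le>
       ennreal (2 * a\<^sup>2) * ennreal ((f u - f' u)\<^sup>2) + ennreal (2 * b\<^sup>2) * ennreal ((g u - g' u)\<^sup>2)"
      by (simp flip: ennreal_mult ennreal_plus add: ennreal_leI)
  qed
  then show ?thesis by (simp add: l2dist_def nn_integral_add nn_integral_cmult)
qed

lemma hwi_lin:
  assumes f: "hwi f Z" and g: "hwi g W"
  shows "hwi (\<lambda>u. a * f u + b * g u) (\<lambda>\<omega>. a * Z \<omega> + b * W \<omega>)"
proof -
  from hwiE[OF f] obtain s where [measurable]: "f \<in> borel_measurable borel" "Z \<in> borel_measurable M"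
    and s: "\<And>n. simple_integrable (s n)" and ls: "(\<lambda>n. l2dist lborel f (s n)) \<longlonglongrightarrow> 0"
      "(\<lambda>n. l2dist M Z (swi (s n))) \<longlonglongrightarrow> 0" by metis
  from hwiE[OF g] obtain r where [measurable]: "g \<in> borel_measurable borel" "W \<in> borel_measurable M"
    and r: "\<And>n. simple_integrable (r n)" and lr: "(\<lambda>n. l2dist lborel g (r n)) \<longlonglongrightarrow> 0"
      "(\<lambda>n. l2dist M W (swi (r n))) \<longlonglongrightarrow> 0" by metis
  have [measurable]: "s n \<in> borel_measurable borel" "r n \<in> borel_measurable borel" for n
    using simple_integrableD(2)[OF s] simple_integrableD(2)[OF r] by auto
  note [measurable] = measurable_swi[OF s] measurable_swi[OF r]
  have lim0: "(\<lambda>n. ennreal (2 * a\<^sup>2) * p n + ennreal (2 * b\<^sup>2) * q n) \<longlonglongrightarrow> 0"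
    if "p \<longlonglongrightarrow> 0" "q \<longlonglongrightarrow> 0" for p q :: "nat \<Rightarrow> ennreal"
    using tendsto_add[OF ennreal_tendsto_cmult[OF _ that(1), of "ennreal (2 * a\<^sup>2)"]
       ennreal_tendsto_cmult[OF _ that(2), of "ennreal (2 * b\<^sup>2)"]] by simp
  show ?thesis
  proof (rule hwiI[where s = "\<lambda>n u. a * s n u + b * r n u"])
    show "(\<lambda>n. l2dist lborel (\<lambda>u. a * f u + b * g u) (\<lambda>u. a * s n u + b * r n u)) \<longlonglongrightarrow> 0"
      by (rule tendsto_0_le_ennreal[OF l2dist_lin lim0[OF ls(1) lr(1)]]) auto
    have "l2dist M (\<lambda>\<omega>. a * Z \<omega> + b * W \<omega>) (swi (\<lambda>u. a * s n u + b * r n u))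
        \<le> ennreal (2 * a\<^sup>2) * l2dist M Z (swi (s n)) + ennreal (2 * b\<^sup>2) * l2dist M W (swi (r n))" for n
    proof -
      have "l2dist M (\<lambda>\<omega>. a * Z \<omega> + b * W \<omega>) (swi (\<lambda>u. a * s n u + b * r n u))
        = l2dist M (\<lambda>\<omega>. a * Z \<omega> + b * W \<omega>) (\<lambda>\<omega>. a * swi (s n) \<omega> + b * swi (r n) \<omega>)"
        by (rule l2dist_cong_AE[OF _ AE_swi_lin[OF s r]]) simp
      also have "\<dots> \<le> ennreal (2 * a\<^sup>2) * l2dist M Z (swi (s n)) + ennreal (2 * b\<^sup>2) * l2dist M W (swi (r n))"
        by (rule l2dist_lin) auto
      finally show ?thesis .
    qed
    then show "(\<lambda>n. l2dist M (\<lambda>\<omega>. a * Z \<omega> + b * W \<omega>) (swi (\<lambda>u. a * s n u + b * r n u))) \<longlonglongrightarrow> 0"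
      by (rule tendsto_0_le_ennreal[OF _ lim0[OF ls(2) lr(2)]])
    show "simple_integrable (\<lambda>u. a * s n u + b * r n u)" for n by (rule simple_integrable_lin[OF s r])
    show "(\<lambda>u. a * f u + b * g u) \<in> borel_measurable borel" by measurable
    show "(\<lambda>\<omega>. a * Z \<omega> + b * W \<omega>) \<in> borel_measurable M" by measurable
  qed
qed

lemma hwi_cmult: "hwi f Z \<Longrightarrow> hwi (\<lambda>u. a * f u) (\<lambda>\<omega>. a * Z \<omega>)"
  using hwi_lin[where f = f and Z = Z and g = f and W = Z and a = a and b = 0] by (simp only: mult_zero_left add_0_right)

lemma hwi_diff: "hwi f Z \<Longrightarrow> hwi g W \<Longrightarrow> hwi (\<lambda>u. f u - g u) (\<lambda>\<omega>. Z \<omega> - W \<omega>)"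
  using hwi_lin[where f = f and Z = Z and g = g and W = W and a = 1 and b = "- 1"]
  by (simp only: mult_minus1 mult_1 diff_conv_add_uminus)

lemma hwi_0: "hwi (\<lambda>_. 0) (\<lambda>_. 0)"
proof (rule hwiI[where s = "\<lambda>n _. 0"])
  show *: "simple_integrable (\<lambda>_. 0)" by (rule Bochner_Integration.simple_bochner_integrable.intros) simp_all
  have "AE \<omega> in M. swi (\<lambda>_. 0) \<omega> = 0"
    using AE_swi_lin[OF * *, of 0 0] by simp
  then show "(\<lambda>n. l2dist M (\<lambda>_. 0) (swi (\<lambda>_. 0))) \<longlonglongrightarrow> 0"
    using l2dist_cong_AE[of "\<lambda>_. 0" "\<lambda>_. 0" M "swi (\<lambda>_. 0)" "\<lambda>_. 0"] by (simp add: l2dist_def)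
qed (auto simp: l2dist_def)

lemma hwi_sum:
  assumes "finite I" "\<And>i. i \<in> I \<Longrightarrow> hwi (f i) (Z i)"
  shows "hwi (\<lambda>u. \<Sum>i\<in>I. a i * f i u) (\<lambda>\<omega>. \<Sum>i\<in>I. a i * Z i \<omega>)"
  using assms
proof (induction I rule: finite_induct)
  case (insert i I)
  have "hwi (\<lambda>u. a i * f i u + 1 * (\<Sum>i\<in>I. a i * f i u)) (\<lambda>\<omega>. a i * Z i \<omega> + 1 * (\<Sum>i\<in>I. a i * Z i \<omega>))"
    by (rule hwi_lin) (use insert in simp_all)
  then show ?case using insert.hyps by simp
qed (simp add: hwi_0)

lemma hwi_cong_AE:
  assumes "hwi f Z" "AE u in lborel. f u = g u" "g \<in> borel_measurable borel"
    "AE \<omega> in M. Z \<omega> = W \<omega>" "W \<in> borel_measurable M"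
  shows "hwi g W"
proof -
  from hwiE[OF assms(1)] obtain s where s: "\<And>n. simple_integrable (s n)" and l: "(\<lambda>n. l2dist lborel f (s n)) \<longlonglongrightarrow> 0"
      "(\<lambda>n. l2dist M Z (swi (s n))) \<longlonglongrightarrow> 0" by metis
  show ?thesis
  proof (rule hwiI[OF assms(3,5) s])
    show "(\<lambda>n. l2dist lborel g (s n)) \<longlonglongrightarrow> 0"
      using l(1) l2dist_cong_AE[OF assms(2) AE_I2[OF refl]] by simp
    show "(\<lambda>n. l2dist M W (swi (s n))) \<longlonglongrightarrow> 0"
      using l(2) l2dist_cong_AE[OF assms(4) AE_I2[OF refl]] by simp
  qed
qed

text \<open>Polarization: the variance of \<open>Z + W\<close> is the squared norm of
  \<open>f + g\<close>, and the squares of the single terms cancel.\<close>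

lemma hwi_covariance:
  assumes f: "hwi f Z" and g: "hwi g W"
  shows "integrable M (\<lambda>\<omega>. Z \<omega> * W \<omega>)"
    and "expectation (\<lambda>\<omega>. Z \<omega> * W \<omega>) = (\<integral>u. f u * g u \<partial>lborel)"
proof -
  note Z = gaussian_rv_moment[OF hwi_gaussian(2)[OF f]]
  note W = gaussian_rv_moment[OF hwi_gaussian(2)[OF g]]
  note ZW = gaussian_rv_moment(6)[OF hwi_gaussian(2)[OF hwi_lin[OF f g, of 1 1]]]
  note [measurable] = hwi_measurable[OF f] hwi_measurable[OF g]
  show "integrable M (\<lambda>\<omega>. Z \<omega> * W \<omega>)"
    using Cauchy_Schwarz_integral(1)[OF _ _ Z(5) W(5)] by simp
  show "expectation (\<lambda>\<omega>. Z \<omega> * W \<omega>) = (\<integral>u. f u * g u \<partial>lborel)"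
    using square_integrable_lin(2)[OF _ _ Z(5) W(5), of 1 1] ZW Z(6) W(6)
      square_integrable_lin(2)[OF _ _ hwi_gaussian(1)[OF f] hwi_gaussian(1)[OF g], of 1 1]
    by simp
qed

lemma l2dist_hwi:
  assumes f: "hwi f Z" and g: "hwi g W"
  shows "l2dist M Z W = l2dist lborel f g"
proof -
  note h = hwi_gaussian[OF hwi_diff[OF f g]]
  show ?thesis
    using gaussian_rv_moment[OF h(2)] h(1) by (simp add: l2dist_integral)
qed

lemma hwi_unique:
  assumes "hwi f Z" "hwi f W"
  shows "AE \<omega> in M. Z \<omega> = W \<omega>"
proof -
  note [measurable] = hwi_measurable[OF assms(1)] hwi_measurable[OF assms(2)]
  have "l2dist M Z W = 0" using l2dist_hwi[OF assms] by (simp add: l2dist_def)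
  then show ?thesis by (auto simp: l2dist_def nn_integral_0_iff_AE elim!: eventually_mono)
qed

text \<open>For a variable W that is given as an almost sure limit, such as a pathwise derivative,
  while convergence in the mean is known only for the integrands. By the isometry the variables form
  a Cauchy sequence in L2, and Fatou's lemma identifies the two limits.\<close>

lemma hwi_limit:
  assumes hwi: "\<And>n. hwi (f n) (Z n)" and [measurable]: "g \<in> borel_measurable borel" "W \<in> borel_measurable M"
    and l: "(\<lambda>n. l2dist lborel g (f n)) \<longlonglongrightarrow> 0" and ae: "AE \<omega> in M. (\<lambda>n. Z n \<omega>) \<longlonglongrightarrow> W \<omega>"
  shows "hwi g W"
proof -
  have [measurable]: "f n \<in> borel_measurable borel" "Z n \<in> borel_measurable M" for n
    using hwi_measurable[OF hwi] by auto
  have ZW: "l2dist M W (Z n) \<le> 2 * l2dist lborel g (f n)" for n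
  proof -
    have "l2dist M W (Z n) = (\<integral>\<^sup>+ \<omega>. liminf (\<lambda>m. ennreal ((Z m \<omega> - Z n \<omega>)\<^sup>2)) \<partial>M)"
      unfolding l2dist_def
    proof (rule nn_integral_cong_AE, use ae in eventually_elim)
      fix \<omega> assume "(\<lambda>m. Z m \<omega>) \<longlonglongrightarrow> W \<omega>"
      then have "(\<lambda>m. ennreal ((Z m \<omega> - Z n \<omega>)\<^sup>2)) \<longlonglongrightarrow> ennreal ((W \<omega> - Z n \<omega>)\<^sup>2)"
        by (intro tendsto_intros)
      then show "ennreal ((W \<omega> - Z n \<omega>)\<^sup>2) = liminf (\<lambda>m. ennreal ((Z m \<omega> - Z n \<omega>)\<^sup>2))"
        by (intro lim_imp_Liminf[symmetric] sequentially_bot)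
    qed
    also have "\<dots> \<le> liminf (\<lambda>m. l2dist M (Z m) (Z n))"
      unfolding l2dist_def by (rule nn_integral_liminf) simp
    also have "\<dots> \<le> liminf (\<lambda>m. 2 * l2dist lborel g (f m) + 2 * l2dist lborel g (f n))"
    proof (rule Liminf_mono, rule always_eventually, rule allI)
      fix m
      show "l2dist M (Z m) (Z n) \<le> 2 * l2dist lborel g (f m) + 2 * l2dist lborel g (f n)"
        unfolding l2dist_hwi[OF hwi hwi] using l2dist_triangle[of "f m" lborel g "f n"]
        by (simp add: l2dist_commute[of lborel "f m"])
    qed
    also have "\<dots> = 2 * 0 + 2 * l2dist lborel g (f n)"
      by (intro lim_imp_Liminf tendsto_add ennreal_tendsto_cmult l tendsto_const) auto
    finally show ?thesis by simp
  qed
  \<comment> \<open>Diagonal choice: one simple function for each n, close to \<open>f n\<close> and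
    with an integral close to \<open>Z n\<close>.\<close>
  have "\<exists>s. simple_integrable s \<and> l2dist lborel (f n) s \<le> ennreal (1 / Suc n) \<and> l2dist M (Z n) (swi s) \<le> ennreal (1 / Suc n)" for n
  proof -
    from hwiE[OF hwi[of n]] obtain s where s: "\<And>k. simple_integrable (s k)" and l: "(\<lambda>k. l2dist lborel (f n) (s k)) \<longlonglongrightarrow> 0"
      "(\<lambda>k. l2dist M (Z n) (swi (s k))) \<longlonglongrightarrow> 0" by metis
    have "eventually (\<lambda>k. l2dist lborel (f n) (s k) < ennreal (1 / Suc n) \<and> l2dist M (Z n) (swi (s k)) < ennreal (1 / Suc n)) sequentially"
      by (intro eventually_conj order_tendstoD(2)[OF l(1)] order_tendstoD(2)[OF l(2)]) auto
    then show ?thesis using s by (auto simp: eventually_sequentially intro: less_imp_le)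
  qed
  then obtain s where s: "\<And>n. simple_integrable (s n)" "\<And>n. l2dist lborel (f n) (s n) \<le> ennreal (1 / Suc n)"
    "\<And>n. l2dist M (Z n) (swi (s n)) \<le> ennreal (1 / Suc n)" by metis
  have [measurable]: "s n \<in> borel_measurable borel" for n by (rule simple_integrableD(2)[OF s(1)])
  note [measurable] = measurable_swi[OF s(1)]
  have e0: "(\<lambda>n. ennreal (1 / Suc n)) \<longlonglongrightarrow> 0"
    using LIMSEQ_Suc[OF lim_1_over_n] by (simp add: ennreal_tendsto_0_iff)
  have lim0: "(\<lambda>n. 2 * (2 * l2dist lborel g (f n)) + 2 * ennreal (1 / Suc n)) \<longlonglongrightarrow> 0"
    using tendsto_add[OF ennreal_tendsto_cmult[OF _ ennreal_tendsto_cmult[OF _ l, of 2], of 2]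
        ennreal_tendsto_cmult[OF _ e0, of 2]] by simp
  show ?thesis
  proof (rule hwiI[OF _ _ s(1)])
    have "l2dist lborel g (s n) \<le> 2 * (2 * l2dist lborel g (f n)) + 2 * ennreal (1 / Suc n)" for n
    proof -
      have "l2dist lborel g (s n) \<le> 2 * l2dist lborel g (f n) + 2 * l2dist lborel (f n) (s n)"
        by (rule l2dist_triangle) auto
      also have "\<dots> \<le> 2 * (2 * l2dist lborel g (f n)) + 2 * ennreal (1 / Suc n)"
        by (intro add_mono mult_left_mono s(2)) (auto simp: mult_2)
      finally show ?thesis .
    qed
    then show "(\<lambda>n. l2dist lborel g (s n)) \<longlonglongrightarrow> 0"
      by (rule tendsto_0_le_ennreal[OF _ lim0])
    have "l2dist M W (swi (s n)) \<le> 2 * (2 * l2dist lborel g (f n)) + 2 * ennreal (1 / Suc n)" for n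
    proof -
      have "l2dist M W (swi (s n)) \<le> 2 * l2dist M W (Z n) + 2 * l2dist M (Z n) (swi (s n))"
        by (rule l2dist_triangle) auto
      also have "\<dots> \<le> 2 * (2 * l2dist lborel g (f n)) + 2 * ennreal (1 / Suc n)"
        by (intro add_mono mult_left_mono s(3) ZW) auto
      finally show ?thesis .
    qed
    then show "(\<lambda>n. l2dist M W (swi (s n))) \<longlonglongrightarrow> 0"
      by (rule tendsto_0_le_ennreal[OF _ lim0])
  qed auto
qed

end

subsection \<open>The augmented filtration of a Gaussian random measure\<close>

context gaussian_random_measure begin

abbreviation filt :: "real \<Rightarrow> 'a measure" where
  "filt \<equiv> generated_filtration M B"

lemma filt_generators_Pow:
  "{B A -` S \<inter> space M | A S. A \<in> fmeasurable lborel \<and> A \<subseteq> {..t} \<and> S \<in> sets borel} \<union> null_sets M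
     \<subseteq> Pow (space M)"
  using sets.sets_into_space by (auto simp: null_sets_def)

lemma space_filt [simp]: "space (filt t) = space M"
  unfolding generated_filtration_def by (rule space_measure_of[OF filt_generators_Pow])

lemma sets_filt:
  "sets (filt t) = sigma_sets (space M)
    ({B A -` S \<inter> space M | A S. A \<in> fmeasurable lborel \<and> A \<subseteq> {..t} \<and> S \<in> sets borel} \<union> null_sets M)"
  unfolding generated_filtration_def by (rule sets_measure_of[OF filt_generators_Pow])

lemma null_sets_filt: "N \<in> null_sets M \<Longrightarrow> N \<in> sets (filt t)"
  unfolding sets_filt by (intro sigma_sets.Basic) simp

lemma subalgebra_filt: "subalgebra M (filt t)"
proof -
  have "sets (filt t) \<subseteq> sets M"
    unfolding sets_filt
  proof (rule sets.sigma_sets_subset, rule subsetI)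
    fix G assume "G \<in> {B A -` S \<inter> space M | A S. A \<in> fmeasurable lborel \<and> A \<subseteq> {..t} \<and> S \<in> sets borel} \<union> null_sets M"
    then show "G \<in> sets M"
      using measurable_sets[OF random_variable_B] by auto
  qed
  then show ?thesis by (simp add: subalgebra_def)
qed

lemma filtration_filt: "filtration (space M) filt"
proof
  fix s t :: real assume "s \<le> t"
  then show "sets (filt s) \<subseteq> sets (filt t)"
    unfolding sets_filt by (intro sigma_sets_mono') (auto, metis order_trans atMost_subset_iff)
qed simp

lemma measurable_B_filt:
  assumes "A \<in> fmeasurable lborel" "A \<subseteq> {..t}"
  shows "B A \<in> borel_measurable (filt t)"
proof (rule measurableI)
  fix S :: "real set" assume "S \<in> sets borel"
  then show "B A -` S \<inter> space (filt t) \<in> sets (filt t)"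
    using assms unfolding sets_filt space_filt by (intro sigma_sets.Basic) auto
qed simp

text \<open>This is where the null sets in \<open>generated_filtration\<close> act: every version of
  an adapted variable is adapted.\<close>

lemma measurable_filt_AE:
  fixes Z W :: "'a \<Rightarrow> real"
  assumes W: "W \<in> borel_measurable (filt t)" and Z: "Z \<in> borel_measurable M"
    and ae: "AE \<omega> in M. Z \<omega> = W \<omega>"
  shows "Z \<in> borel_measurable (filt t)"
proof (rule measurableI)
  fix S :: "real set" assume S: "S \<in> sets borel"
  have WM: "W \<in> borel_measurable M" using measurable_from_subalg[OF subalgebra_filt W] .
  note [measurable] = Z WM
  define N where "N = {\<omega>\<in>space M. Z \<omega> \<noteq> W \<omega>}"
  have N: "N \<in> null_sets M"
  proof (subst AE_iff_null_sets)
    show "N \<in> sets M" unfolding N_def by measurable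
    show "AE \<omega> in M. \<omega> \<notin> N" using ae by (auto simp: N_def elim: eventually_mono)
  qed
  have "Z -` S \<inter> space M = (W -` S \<inter> space M - N) \<union> (Z -` S \<inter> space M \<inter> N)"
    by (auto simp: N_def)
  moreover have "Z -` S \<inter> space M \<inter> N \<in> null_sets M"
    using null_set_Int1[OF N measurable_sets[OF Z S]] by simp
  ultimately show "Z -` S \<inter> space (filt t) \<in> sets (filt t)"
    using measurable_sets[OF W S] null_sets_filt[OF N, of t] null_sets_filt[of _ t]
    by (metis sets.Un sets.Diff space_filt)
qed simp

lemma measurable_swi_filt:
  assumes f: "simple_integrable f" and 0: "\<And>u. t < u \<Longrightarrow> f u = 0"
  shows "swi f \<in> borel_measurable (filt t)"
proof (rule simple_integrable_repr[OF f])
  fix n :: nat and a :: "nat \<Rightarrow> real" and C :: "nat \<Rightarrow> real set"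
  assume C: "range C \<subseteq> fmeasurable lborel" "\<And>k. C k \<subseteq> {u. f u \<noteq> 0}"
    and swi: "\<And>(B :: real set \<Rightarrow> 'a \<Rightarrow> real) \<omega>. simple_wiener_integral B f \<omega> = (\<Sum>k<n. a k * B (C k) \<omega>)"
  have "C k \<subseteq> {..t}" for k using C(2)[of k] 0 by (force simp: not_le[symmetric])
  then have [measurable]: "B (C k) \<in> borel_measurable (filt t)" for k
    using C(1) by (intro measurable_B_filt) auto
  have "swi f = (\<lambda>\<omega>. \<Sum>k<n. a k * B (C k) \<omega>)" using swi by auto
  then show ?thesis by simp
qed

text \<open>Cutting the approximating simple functions down to A keeps the approximation: outside A
  the function f is 0, so what is cut off is part of the error \<open>f - s n\<close>.\<close>

lemma hwi_supported_approx:
  assumes f: "hwi f Z" and A: "A \<in> sets borel" and 0: "\<And>u. u \<notin> A \<Longrightarrow> f u = 0" and e: "0 < e"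
  obtains r where "simple_integrable r" "\<And>u. u \<notin> A \<Longrightarrow> r u = 0" "l2dist M Z (swi r) < e"
proof -
  from hwiE[OF f] obtain s where [measurable]: "f \<in> borel_measurable borel" "Z \<in> borel_measurable M"
    and s: "\<And>n. simple_integrable (s n)" and l: "(\<lambda>n. l2dist lborel f (s n)) \<longlonglongrightarrow> 0"
      "(\<lambda>n. l2dist M Z (swi (s n))) \<longlonglongrightarrow> 0" by metis
  define r where "r n u = s n u * indicator A u" for n u
  have r: "simple_integrable (r n)" for n unfolding r_def by (rule simple_integrable_indicator[OF s A])
  have "l2dist lborel (s n) (r n) \<le> l2dist lborel f (s n)" for n
    unfolding l2dist_def r_def using 0
    by (intro nn_integral_mono) (auto simp: indicator_def power2_commute)
  then have "l2dist M Z (swi (r n)) \<le> 2 * l2dist M Z (swi (s n)) + 2 * l2dist lborel f (s n)" for n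
    using l2dist_triangle[of Z M "swi (s n)" "swi (r n)"] l2dist_swi[OF s r] measurable_swi[OF s] measurable_swi[OF r]
    by (auto intro: order_trans[OF _ add_left_mono[OF mult_left_mono]])
  moreover have "(\<lambda>n. 2 * l2dist M Z (swi (s n)) + 2 * l2dist lborel f (s n)) \<longlonglongrightarrow> 0"
    using tendsto_add[OF ennreal_tendsto_cmult[OF _ l(2), of 2] ennreal_tendsto_cmult[OF _ l(1), of 2]] by simp
  ultimately have "(\<lambda>n. l2dist M Z (swi (r n))) \<longlonglongrightarrow> 0"
    by (rule tendsto_0_le_ennreal)
  from order_tendstoD(2)[OF this e] obtain n where "l2dist M Z (swi (r n)) < e"
    by (auto simp: eventually_sequentially)
  then show thesis by (intro that[of "r n"] r) (auto simp: r_def)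
qed

text \<open>Simple integrals of functions living on the past converge almost surely to Z if the
  approximation is fast enough, and Z agrees almost surely with their measurable pointwise
  limit.\<close>

lemma hwi_adapted:
  assumes f: "hwi f Z" and 0: "\<And>u. t < u \<Longrightarrow> f u = 0"
  shows "Z \<in> borel_measurable (filt t)"
proof -
  note [measurable] = hwi_measurable[OF f]
  have "\<exists>r. simple_integrable r \<and> (\<forall>u. t < u \<longrightarrow> r u = 0) \<and> l2dist M Z (swi r) < ennreal ((1 / 2) ^ n)" for n
  proof (rule hwi_supported_approx[OF f, of "{..t}" "ennreal ((1 / 2) ^ n)"])
    fix r assume "simple_integrable r" "\<And>u. u \<notin> {..t} \<Longrightarrow> r u = 0" "l2dist M Z (swi r) < ennreal ((1 / 2) ^ n)"
    then show ?thesis by (intro exI[of _ r]) auto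
  qed (use 0 in auto)
  then obtain r where r: "\<And>n. simple_integrable (r n)" "\<And>n u. t < u \<Longrightarrow> r n u = 0"
     "\<And>n. l2dist M Z (swi (r n)) < ennreal ((1 / 2) ^ n)" by metis
  have rm: "swi (r n) \<in> borel_measurable (filt t)" for n by (rule measurable_swi_filt[OF r(1,2)])
  have "AE \<omega> in M. (\<lambda>n. swi (r n) \<omega>) \<longlonglongrightarrow> Z \<omega>"
    by (rule AE_tendsto_of_summable_l2dist) (simp_all add: measurable_swi[OF r(1)] less_imp_le[OF r(3)])
  then have ae: "AE \<omega> in M. Z \<omega> = lim (\<lambda>n. swi (r n) \<omega>)"
    by eventually_elim (simp add: limI)
  show ?thesis
    by (rule measurable_filt_AE[OF borel_measurable_lim_metric[OF rm] _ ae]) simp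
qed

text \<open>The values of \<open>B\<close> on finitely many sets are sums of its values on the atoms of the
  algebra they generate, so independence over disjoint sets gives independence of the past.\<close>

lemma expectation_swi_past_finite:
  assumes g: "simple_integrable g" and g0: "\<And>u. u \<le> s \<Longrightarrow> g u = 0"
    and R: "finite R" "R \<subseteq> {(A, S). A \<in> fmeasurable lborel \<and> A \<subseteq> {..s} \<and> S \<in> sets borel}"
  shows "expectation (\<lambda>\<omega>. indicator {\<omega>\<in>space M. \<forall>(A, S)\<in>R. B A \<omega> \<in> S} \<omega> * swi g \<omega>) = 0"
proof (rule simple_integrable_repr[OF g])
  fix n :: nat and a :: "nat \<Rightarrow> real" and C :: "nat \<Rightarrow> real set"
  assume C: "disjoint_family C" "range C \<subseteq> fmeasurable lborel" "\<And>k. C k \<subseteq> {u. g u \<noteq> 0}"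
    and swi': "\<And>(B :: real set \<Rightarrow> 'a \<Rightarrow> real) \<omega>. simple_wiener_integral B g \<omega> = (\<Sum>k<n. a k * B (C k) \<omega>)"
  define \<A> where "\<A> = fst ` R"
  have fin: "finite \<A>" using R(1) by (simp add: \<A>_def)
  have \<A>: "A \<in> fmeasurable lborel" "A \<subseteq> {..s}" if "A \<in> \<A>" for A
    using that R(2) by (auto simp: \<A>_def)
  \<comment> \<open>The atom of points that lie in exactly those members of \<A> which belong to T.
    The empty T is excluded below: its atom is the complement of the union and has infinite
    measure.\<close>
  define D where "D T = {u. {A\<in>\<A>. u \<in> A} = T}" for T
  define I where "I = Pow \<A> - {{}}"
  have finI: "finite I" using fin by (simp add: I_def)
  have D_sub: "D T \<subseteq> {..s}" "D T \<in> fmeasurable lborel" if "T \<in> I" for T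
  proof -
    from that obtain A where A: "A \<in> T" "A \<in> \<A>" "T \<subseteq> \<A>" by (auto simp: I_def)
    have DA: "D T \<subseteq> A" using A by (auto simp: D_def)
    then show "D T \<subseteq> {..s}" using \<A>(2)[OF A(2)] by blast
    have "D T = {u. \<forall>A\<in>\<A>. u \<in> A \<longleftrightarrow> A \<in> T}" using A(3) by (auto simp: D_def)
    also have "\<dots> = (\<Inter>A\<in>\<A>. if A \<in> T then A else - A)" by (auto split: if_splits)
    also have "\<dots> \<in> sets lborel"
    proof (intro sets.finite_INT fin)
      fix A' assume "A' \<in> \<A>"
      then have "A' \<in> sets borel" using fmeasurableD[OF \<A>(1)] by simp
      then show "(if A' \<in> T then A' else - A') \<in> sets lborel" by (simp add: borel_comp)
    qed (use A(2) in auto)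
    finally show "D T \<in> fmeasurable lborel"
      using fmeasurableI2[OF \<A>(1)[OF A(2)] DA] by simp
  qed
  obtain e where e: "bij_betw e {..<card I} I"
    using ex_bij_betw_nat_finite[OF finI] by (auto simp: atLeast0LessThan)
  define m where "m = card I"
  have eI: "e k \<in> I" if "k < m" for k using e that by (auto simp: bij_betw_def m_def)
  have inj: "e k = e l \<Longrightarrow> k < m \<Longrightarrow> l < m \<Longrightarrow> k = l" for k l
    using e by (auto simp: bij_betw_def inj_on_def m_def)
  \<comment> \<open>Atoms of the past first, then the level sets of g: one disjoint sequence, so
    that \<open>indep_B\<close> separates its first m members from the others.\<close>
  define E where "E i = (if i < m then D (e i) else C (i - m))" for i
  have Cs: "C k \<inter> {..s} = {}" for k using C(3)[of k] g0 by auto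
  have disE: "disjoint_family E"
    unfolding disjoint_family_on_def
  proof (intro ballI impI)
    fix i j :: nat assume "i \<noteq> j"
    show "E i \<inter> E j = {}"
    proof (cases "i < m"; cases "j < m")
      assume "i < m" "j < m"
      then have "e i \<noteq> e j" using inj \<open>i \<noteq> j\<close> by blast
      then show ?thesis using \<open>i < m\<close> \<open>j < m\<close> by (auto simp: E_def D_def)
    next
      assume "i < m" "\<not> j < m"
      then show ?thesis using D_sub(1)[OF eI, of i] Cs[of "j - m"] by (auto simp: E_def)
    next
      assume "\<not> i < m" "j < m"
      then show ?thesis using D_sub(1)[OF eI, of j] Cs[of "i - m"] by (auto simp: E_def)
    next
      assume "\<not> i < m" "\<not> j < m"
      then have "i - m \<noteq> j - m" using \<open>i \<noteq> j\<close> by simp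
      then show ?thesis using C(1) \<open>\<not> i < m\<close> \<open>\<not> j < m\<close> by (simp add: E_def disjoint_family_on_def)
    qed
  qed
  have fmE: "range E \<subseteq> fmeasurable lborel"
    using D_sub(2)[OF eI] C(2) by (auto simp: E_def)
  have [measurable]: "B (E i) \<in> borel_measurable M" for i
    using fmE by (intro random_variable_B) auto
  let ?J = "{..<m}" and ?K = "{m..<m + n}"
  have ind: "indep_var (PiM ?J (\<lambda>_. borel)) (\<lambda>\<omega>. restrict (\<lambda>i. B (E i) \<omega>) ?J)
      (PiM ?K (\<lambda>_. borel)) (\<lambda>\<omega>. restrict (\<lambda>i. B (E i) \<omega>) ?K)"
    by (rule indep_var_restrict[OF indep_B[OF disE fmE]]) auto
  \<comment> \<open>The event as a function of the values of B on the atoms: \<open>B A\<close> is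
    the sum over those atoms whose index contains A.\<close>
  define \<phi> :: "(nat \<Rightarrow> real) \<Rightarrow> real" where "\<phi> x = indicator {x\<in>space (PiM ?J (\<lambda>_. borel)). \<forall>(A, S)\<in>R. (\<Sum>i | i < m \<and> A \<in> e i. x i) \<in> S} x" for x
  define \<psi> where "\<psi> x = (\<Sum>k<n. a k * x (m + k))" for x :: "nat \<Rightarrow> real"
  have \<phi>m: "\<phi> \<in> borel_measurable (PiM ?J (\<lambda>_. borel))"
  proof -
    have "{x\<in>space (PiM ?J (\<lambda>_. borel)). (\<Sum>i | i < m \<and> fst p \<in> e i. x i) \<in> snd p} \<in> sets (PiM ?J (\<lambda>_. borel :: real measure))"
      if "p \<in> R" for p
    proof -
      have [measurable]: "snd p \<in> sets borel" using that R(2) by auto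
      have [measurable]: "(\<lambda>x. \<Sum>i | i < m \<and> fst p \<in> e i. x i) \<in> borel_measurable (PiM ?J (\<lambda>_. borel :: real measure))"
        by (intro borel_measurable_sum measurable_component_singleton) auto
      show ?thesis by measurable
    qed
    then have "{x\<in>space (PiM ?J (\<lambda>_. borel)). \<forall>p\<in>R. (\<Sum>i | i < m \<and> fst p \<in> e i. x i) \<in> snd p} \<in> sets (PiM ?J (\<lambda>_. borel :: real measure))"
      by (intro sets.sets_Collect_finite_All R(1))
    then show ?thesis unfolding \<phi>_def by (simp add: case_prod_beta)
  qed
  have \<psi>m: "\<psi> \<in> borel_measurable (PiM ?K (\<lambda>_. borel))"
    unfolding \<psi>_def by (intro borel_measurable_sum borel_measurable_times borel_measurable_const measurable_component_singleton) auto
  note ind2 = indep_var_compose[OF ind \<phi>m \<psi>m]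
  have swi_eq: "(\<psi> \<circ> (\<lambda>\<omega>. restrict (\<lambda>i. B (E i) \<omega>) ?K)) = swi g"
    using swi' by (auto simp: \<psi>_def E_def fun_eq_iff)
  have \<phi>_bd: "norm (\<phi> x) \<le> 1" for x by (simp add: \<phi>_def indicator_def)
  have int\<phi>: "integrable M (\<phi> \<circ> (\<lambda>\<omega>. restrict (\<lambda>i. B (E i) \<omega>) ?J))"
    using \<phi>_bd by (intro integrable_const_bound[of _ 1] indep_var_rv1[OF ind2]) auto
  note gm = gaussian_rv_moment[OF gaussian_rv_swi[OF g]]
  have zero: "expectation (\<lambda>\<omega>. (\<phi> \<circ> (\<lambda>\<omega>. restrict (\<lambda>i. B (E i) \<omega>) ?J)) \<omega> * swi g \<omega>) = 0"
    using indep_var_lebesgue_integral[OF ind2[unfolded swi_eq] int\<phi> gm(3)] gm(4) by simp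
  have "AE \<omega> in M. (\<phi> \<circ> (\<lambda>\<omega>. restrict (\<lambda>i. B (E i) \<omega>) ?J)) \<omega>
      = indicator {\<omega>\<in>space M. \<forall>(A, S)\<in>R. B A \<omega> \<in> S} \<omega>"
  proof -
    have "AE \<omega> in M. B A \<omega> = (\<Sum>i | i < m \<and> A \<in> e i. B (E i) \<omega>)" if "A \<in> \<A>" for A
    proof -
      have "A = (\<Union>T\<in>{T\<in>I. A \<in> T}. D T)" using that by (auto simp: D_def I_def)
      also have "\<dots> = (\<Union>i\<in>{i. i < m \<and> A \<in> e i}. E i)"
        using bij_betw_imp_surj_on[OF e] by (fastforce simp: E_def m_def[symmetric])
      finally have "B A = B (\<Union>i\<in>{i. i < m \<and> A \<in> e i}. E i)" by simp
      moreover have "AE \<omega> in M. B (\<Union>i\<in>{i. i < m \<and> A \<in> e i}. E i) \<omega> = (\<Sum>i\<in>{i. i < m \<and> A \<in> e i}. B (E i) \<omega>)"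
        using fmE disjoint_family_on_mono[OF _ disE] by (intro AE_B_UN) auto
      ultimately show ?thesis by simp
    qed
    then have "AE \<omega> in M. \<forall>A\<in>\<A>. B A \<omega> = (\<Sum>i | i < m \<and> A \<in> e i. B (E i) \<omega>)"
      using fin by (subst AE_ball_countable) (auto intro: countable_finite)
    with AE_space show ?thesis
    proof eventually_elim
      fix \<omega> assume \<omega>: "\<omega> \<in> space M" and eq: "\<forall>A\<in>\<A>. B A \<omega> = (\<Sum>i | i < m \<and> A \<in> e i. B (E i) \<omega>)"
      have "(\<forall>(A, S)\<in>R. (\<Sum>i | i < m \<and> A \<in> e i. restrict (\<lambda>i. B (E i) \<omega>) ?J i) \<in> S) \<longleftrightarrow> (\<forall>(A, S)\<in>R. B A \<omega> \<in> S)"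
      proof (intro ball_cong refl)
        fix p assume "p \<in> R"
        then have "fst p \<in> \<A>" by (simp add: \<A>_def)
        then have "(\<Sum>i | i < m \<and> fst p \<in> e i. restrict (\<lambda>i. B (E i) \<omega>) ?J i) = B (fst p) \<omega>"
          using eq by (auto intro!: sum.cong)
        then show "(case p of (A, S) \<Rightarrow> (\<Sum>i | i < m \<and> A \<in> e i. restrict (\<lambda>i. B (E i) \<omega>) ?J i) \<in> S)
            = (case p of (A, S) \<Rightarrow> B A \<omega> \<in> S)" by (simp add: case_prod_beta)
      qed
      then show "(\<phi> \<circ> (\<lambda>\<omega>. restrict (\<lambda>i. B (E i) \<omega>) ?J)) \<omega> = indicator {\<omega>\<in>space M. \<forall>(A, S)\<in>R. B A \<omega> \<in> S} \<omega>"
        using \<omega> by (simp add: \<phi>_def indicator_def space_PiM)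
    qed
  qed
  moreover have "{\<omega>\<in>space M. \<forall>(A, S)\<in>R. B A \<omega> \<in> S} \<in> sets M"
  proof -
    have "{\<omega>\<in>space M. B (fst p) \<omega> \<in> snd p} \<in> sets M" if "p \<in> R" for p
    proof -
      have "B (fst p) -` snd p \<inter> space M \<in> sets M"
        using that R(2) by (intro measurable_sets[OF random_variable_B]) auto
      then show ?thesis by (simp add: vimage_def Int_def conj_commute)
    qed
    then have "{\<omega>\<in>space M. \<forall>p\<in>R. B (fst p) \<omega> \<in> snd p} \<in> sets M"
      by (intro sets.sets_Collect_finite_All R(1))
    then show ?thesis by (simp add: case_prod_beta)
  qed
  ultimately have "expectation (\<lambda>\<omega>. (\<phi> \<circ> (\<lambda>\<omega>. restrict (\<lambda>i. B (E i) \<omega>) ?J)) \<omega> * swi g \<omega>)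
    = expectation (\<lambda>\<omega>. indicator {\<omega>\<in>space M. \<forall>(A, S)\<in>R. B A \<omega> \<in> S} \<omega> * swi g \<omega>)"
    using indep_var_rv1[OF ind2] measurable_swi[OF g]
    by (intro integral_cong_AE borel_measurable_times borel_measurable_indicator) (auto simp: comp_def elim: eventually_mono)
  with zero show ?thesis by simp
qed

text \<open>Dynkin's argument. The finite intersections of generating events, together with all null
  sets, form a generator stable under intersection, and the identity passes to complements because
  \<open>swi g\<close> is centered.\<close>

lemma expectation_swi_past:
  assumes g: "simple_integrable g" and g0: "\<And>u. u \<le> s \<Longrightarrow> g u = 0" and G: "G \<in> sets (filt s)"
  shows "expectation (\<lambda>\<omega>. indicator G \<omega> * swi g \<omega>) = 0"
proof -
  define Q where "Q = {(A, S). A \<in> fmeasurable lborel \<and> A \<subseteq> {..s} \<and> S \<in> sets (borel :: real measure)}"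
  define ev where "ev R = {\<omega>\<in>space M. \<forall>(A, S)\<in>R. B A \<omega> \<in> S}" for R :: "(real set \<times> real set) set"
  define P where "P = ev ` {R. finite R \<and> R \<subseteq> Q} \<union> null_sets M"
  note gm = gaussian_rv_moment[OF gaussian_rv_swi[OF g]]
  note [measurable] = measurable_swi[OF g]
  have null: "expectation (\<lambda>\<omega>. indicator N \<omega> * swi g \<omega>) = 0" if "N \<in> null_sets M" for N
  proof -
    have "AE \<omega> in M. indicator N \<omega> * swi g \<omega> = 0"
      using AE_not_in[OF that] by eventually_elim simp
    from integral_eq_zero_AE[OF this] show ?thesis .
  qed
  have evs: "ev R \<in> sets M" if "finite R" "R \<subseteq> Q" for R
  proof -
    have "{\<omega>\<in>space M. B (fst p) \<omega> \<in> snd p} \<in> sets M" if "p \<in> R" for p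
    proof -
      have "B (fst p) -` snd p \<inter> space M \<in> sets M"
        using that \<open>R \<subseteq> Q\<close> unfolding Q_def by (intro measurable_sets[OF random_variable_B]) auto
      then show ?thesis by (simp add: vimage_def Int_def conj_commute)
    qed
    then have "{\<omega>\<in>space M. \<forall>p\<in>R. B (fst p) \<omega> \<in> snd p} \<in> sets M"
      by (intro sets.sets_Collect_finite_All that(1))
    then show ?thesis by (simp add: case_prod_beta ev_def)
  qed
  have PM: "P \<subseteq> sets M" using evs by (auto simp: P_def)
  have PP: "P \<subseteq> Pow (space M)" using PM sets.sets_into_space by blast
  have stable: "Int_stable P"
  proof (rule Int_stableI)
    fix a b assume ab: "a \<in> P" "b \<in> P"
    show "a \<inter> b \<in> P"
    proof (cases "a \<in> null_sets M \<or> b \<in> null_sets M")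
      case True
      then have "a \<inter> b \<in> null_sets M"
        using ab PM null_set_Int1[of a M b] null_set_Int1[of b M a] by (auto simp: Int_commute subset_eq)
      then show ?thesis by (simp add: P_def)
    next
      case False
      then obtain R R' where R: "finite R" "R \<subseteq> Q" "finite R'" "R' \<subseteq> Q" "a = ev R" "b = ev R'"
        using ab by (auto simp: P_def)
      have "a \<inter> b = ev (R \<union> R')" unfolding R(5,6) ev_def by blast
      then show ?thesis using R by (auto simp: P_def)
    qed
  qed
  have "G \<in> sigma_sets (space M) P"
  proof (rule subsetD[OF sigma_sets_mono' G[unfolded sets_filt]], rule subsetI)
    fix a assume "a \<in> {B A -` S \<inter> space M |A S. A \<in> fmeasurable lborel \<and> A \<subseteq> {..s} \<and> S \<in> sets borel} \<union> null_sets M"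
    then consider A S where "a = B A -` S \<inter> space M" "(A, S) \<in> Q" | "a \<in> null_sets M"
      by (auto simp: Q_def)
    then show "a \<in> P"
    proof cases
      case 1
      then have "a = ev {(A, S)}" by (auto simp: ev_def)
      then show ?thesis using 1(2) by (auto simp: P_def)
    qed (simp add: P_def)
  qed
  from stable PP this show ?thesis
  proof (induction G rule: sigma_sets_induct_disjoint)
    case (basic G)
    then consider R where "G = ev R" "finite R" "R \<subseteq> Q" | "G \<in> null_sets M"
      by (auto simp: P_def)
    then show ?case
    proof cases
      case 1
      then show ?thesis using expectation_swi_past_finite[OF g g0, where R = R] by (simp add: ev_def Q_def)
    qed (rule null)
  next
    case empty
    then show ?case by simp
  next
    case (compl G)
    have [measurable]: "G \<in> sets M" using compl(1) PM sets.sigma_sets_subset by blast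
    have i: "integrable M (\<lambda>\<omega>. indicator G \<omega> * swi g \<omega>)"
      by (rule Bochner_Integration.integrable_bound[OF gm(3)]) (auto simp: indicator_def)
    have "expectation (\<lambda>\<omega>. indicator (space M - G) \<omega> * swi g \<omega>) = expectation (\<lambda>\<omega>. swi g \<omega> - indicator G \<omega> * swi g \<omega>)"
      by (intro Bochner_Integration.integral_cong) (auto simp: indicator_def)
    then show ?case using compl(2) gm(3,4) i by simp
  next
    case (union G)
    have [measurable]: "G i \<in> sets M" for i using union(2) PM sets.sigma_sets_subset by blast
    \<comment> \<open>For disjoint events the partial sums of indicators are at most 1, so
      \<open>\<bar>swi g \<omega>\<bar>\<close> dominates.\<close>
    have "(\<lambda>n. expectation (\<lambda>\<omega>. (\<Sum>i<n. indicator (G i) \<omega>) * swi g \<omega>))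
        \<longlonglongrightarrow> expectation (\<lambda>\<omega>. indicator (\<Union>i. G i) \<omega> * swi g \<omega>)"
    proof (rule integral_dominated_convergence[where w = "\<lambda>\<omega>. \<bar>swi g \<omega>\<bar>"])
      have sums: "(\<lambda>i. indicator (G i) \<omega> :: real) sums indicator (\<Union>i. G i) \<omega>" for \<omega>
        by (rule indicator_sums) (use union(1) in \<open>auto simp: disjoint_family_on_def\<close>)
      then show "AE \<omega> in M. (\<lambda>n. (\<Sum>i<n. indicator (G i) \<omega>) * swi g \<omega>) \<longlonglongrightarrow> indicator (\<Union>i. G i) \<omega> * swi g \<omega>"
        unfolding sums_def by (intro AE_I2 tendsto_mult tendsto_const)
      fix n
      have "(\<Sum>i<n. indicator (G i) \<omega>) \<le> (1 :: real)" for \<omega>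
      proof -
        have "(\<Sum>i<n. indicator (G i) \<omega>) \<le> (\<Sum>i. indicator (G i) \<omega> :: real)"
          by (rule sum_le_suminf[OF sums_summable[OF sums]]) auto
        also have "\<dots> = indicator (\<Union>i. G i) \<omega>" by (rule sums_unique[OF sums, symmetric])
        also have "\<dots> \<le> 1" by (rule indicator_le_1)
        finally show ?thesis .
      qed
      then show "AE \<omega> in M. norm ((\<Sum>i<n. indicator (G i) \<omega>) * swi g \<omega>) \<le> \<bar>swi g \<omega>\<bar>"
        by (auto simp: abs_mult sum_nonneg intro!: mult_left_le_one_le)
    qed (use gm(3) in auto)
    moreover have "expectation (\<lambda>\<omega>. (\<Sum>i<n. indicator (G i) \<omega>) * swi g \<omega>) = 0" for n
    proof -
      have i: "integrable M (\<lambda>\<omega>. indicator (G i) \<omega> * swi g \<omega>)" for i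
        by (rule Bochner_Integration.integrable_bound[OF gm(3)]) (auto simp: indicator_def)
      have "expectation (\<lambda>\<omega>. (\<Sum>i<n. indicator (G i) \<omega>) * swi g \<omega>) = (\<Sum>i<n. expectation (\<lambda>\<omega>. indicator (G i) \<omega> * swi g \<omega>))"
        unfolding sum_distrib_right by (rule Bochner_Integration.integral_sum[OF i])
      then show ?thesis using union(3) by simp
    qed
    ultimately show ?case using LIMSEQ_unique[OF _ tendsto_const] by simp
  qed
qed

text \<open>Replacing Z by a simple integral over the future changes the left side by at most the L2
  distance, as indicators are bounded by 1.\<close>

lemma hwi_past:
  assumes f: "hwi f Z" and 0: "\<And>u. u \<le> s \<Longrightarrow> f u = 0" and G: "G \<in> sets (filt s)"
  shows "expectation (\<lambda>\<omega>. indicator G \<omega> * Z \<omega>) = 0"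
proof -
  note Z = gaussian_rv_moment[OF hwi_gaussian(2)[OF f]]
  note [measurable] = hwi_measurable[OF f]
  have [measurable]: "G \<in> sets M" using G subalgebra_filt by (auto simp: subalgebra_def)
  have "\<bar>expectation (\<lambda>\<omega>. indicator G \<omega> * Z \<omega>)\<bar> \<le> e" if e: "0 < e" for e
  proof (rule hwi_supported_approx[OF f, of "{s<..}" "ennreal (e\<^sup>2)"])
    fix r assume r: "simple_integrable r" "\<And>u. u \<notin> {s<..} \<Longrightarrow> r u = 0" and d: "l2dist M Z (swi r) < ennreal (e\<^sup>2)"
    note W = gaussian_rv_moment[OF gaussian_rv_swi[OF r(1)]]
    note [measurable] = measurable_swi[OF r(1)]
    have i2: "integrable M (\<lambda>\<omega>. (Z \<omega> - swi r \<omega>)\<^sup>2)"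
      using square_integrable_lin(1)[of Z M "swi r" 1 "- 1"] Z(5) W(5) by simp
    have d': "expectation (\<lambda>\<omega>. (Z \<omega> - swi r \<omega>)\<^sup>2) \<le> e\<^sup>2"
      using d e by (simp add: l2dist_integral[OF i2] ennreal_less_iff)
    have iZ: "integrable M (\<lambda>\<omega>. indicator G \<omega> * Z \<omega>)"
      by (rule Bochner_Integration.integrable_bound[OF Z(3)]) (auto simp: indicator_def)
    have iW: "integrable M (\<lambda>\<omega>. indicator G \<omega> * swi r \<omega>)"
      by (rule Bochner_Integration.integrable_bound[OF W(3)]) (auto simp: indicator_def)
    have "expectation (\<lambda>\<omega>. indicator G \<omega> * Z \<omega>) = expectation (\<lambda>\<omega>. indicator G \<omega> * Z \<omega> - indicator G \<omega> * swi r \<omega>)"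
      using expectation_swi_past[OF r(1) _ G] r(2) iZ iW by simp
    also have "\<bar>\<dots>\<bar> \<le> expectation (\<lambda>\<omega>. \<bar>indicator G \<omega> * Z \<omega> - indicator G \<omega> * swi r \<omega>\<bar>)"
      by (rule integral_abs_bound)
    also have "\<dots> \<le> expectation (\<lambda>\<omega>. \<bar>Z \<omega> - swi r \<omega>\<bar>)"
      using Z(3) W(3) by (intro integral_mono_AE') (auto simp: indicator_def)
    also have "\<dots> \<le> sqrt (expectation (\<lambda>\<omega>. (Z \<omega> - swi r \<omega>)\<^sup>2))"
      by (rule expectation_abs_le_sqrt[OF _ i2]) simp
    also have "\<dots> \<le> e" using d' e by (intro real_le_lsqrt) auto
    finally show ?thesis .
  qed (use 0 e in auto)
  then have "\<bar>expectation (\<lambda>\<omega>. indicator G \<omega> * Z \<omega>)\<bar> \<le> 0" by (rule field_le_epsilon[rotated, of _ 0, simplified])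
  then show ?thesis by simp
qed

end

subsection \<open>Semimartingales as integrators of step processes\<close>

text \<open>Burkholder's special function for the weak type inequality. It majorizes
  \<open>indicator {\<bar>y\<bar> \<ge> 1} - 2 * \<bar>x\<bar>\<close> and is concave along the lines of slope at most 1.\<close>

definition burkholder :: "real \<Rightarrow> real \<Rightarrow> real" where
  "burkholder x y = (if \<bar>x\<bar> + \<bar>y\<bar> \<le> 1 then y\<^sup>2 - x\<^sup>2 else 1 - 2 * \<bar>x\<bar>)"

text \<open>Outside the square \<open>\<bar>x\<bar> + \<bar>y\<bar> \<le> 1\<close> this and
  \<open>burkholder_dy\<close> form a supergradient of the concave function
  \<open>1 - 2 * \<bar>x\<bar>\<close>; at its kink \<open>sgn 0 = 0\<close> picks one of the
  possible slopes.\<close>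

definition burkholder_dx :: "real \<Rightarrow> real \<Rightarrow> real" where
  "burkholder_dx x y = (if \<bar>x\<bar> + \<bar>y\<bar> \<le> 1 then - 2 * x else - 2 * sgn x)"

definition burkholder_dy :: "real \<Rightarrow> real \<Rightarrow> real" where
  "burkholder_dy x y = (if \<bar>x\<bar> + \<bar>y\<bar> \<le> 1 then 2 * y else 0)"

lemma square_le_abs_le:
  fixes a b :: real
  shows "\<bar>a\<bar> \<le> b \<Longrightarrow> a\<^sup>2 \<le> b\<^sup>2"
  by (metis abs_ge_zero power2_abs power_mono)

text \<open>Everywhere \<open>burkholder\<close> is at most \<open>1 - 2 * \<bar>x\<bar>\<close>,
  which settles starting points outside the square. From a point inside, the tangent plane exceeds
  the quadratic branch at the new point by \<open>h\<^sup>2 - k\<^sup>2\<close>, which is where the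
  slope condition enters; if the new point is outside, it remains to compare this with
  \<open>1 - 2 * \<bar>x'\<bar>\<close>.\<close>

lemma burkholder_step:
  assumes hk: "\<bar>k\<bar> \<le> \<bar>h\<bar>"
  shows "burkholder (x + h) (y + k) \<le> burkholder x y + burkholder_dx x y * h + burkholder_dy x y * k"
proof -
  define x' y' where "x' = x + h" and "y' = y + k"
  have k2: "k\<^sup>2 \<le> h\<^sup>2" using hk square_le_abs_le[of k "\<bar>h\<bar>"] by simp
  have upper: "burkholder x' y' \<le> 1 - 2 * \<bar>x'\<bar>"
  proof (cases "\<bar>x'\<bar> + \<bar>y'\<bar> \<le> 1")
    case True
    then have "y'\<^sup>2 \<le> (1 - \<bar>x'\<bar>)\<^sup>2" by (intro square_le_abs_le) auto
    then show ?thesis using True by (simp add: burkholder_def power2_diff)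
  qed (simp add: burkholder_def)
  show ?thesis
  proof (cases "\<bar>x\<bar> + \<bar>y\<bar> \<le> 1")
    case True
    have rhs: "burkholder x y + burkholder_dx x y * h + burkholder_dy x y * k = y'\<^sup>2 - x'\<^sup>2 + h\<^sup>2 - k\<^sup>2"
      using True by (simp add: burkholder_def burkholder_dx_def burkholder_dy_def x'_def y'_def power2_eq_square algebra_simps)
    show ?thesis
    proof (cases "\<bar>x'\<bar> + \<bar>y'\<bar> \<le> 1")
      case True
      then have "burkholder x' y' = y'\<^sup>2 - x'\<^sup>2" by (simp add: burkholder_def)
      then show ?thesis unfolding x'_def[symmetric] y'_def[symmetric] rhs using k2 by simp
    next
      case out: False
      have "(1 - \<bar>x'\<bar>)\<^sup>2 \<le> y'\<^sup>2 + h\<^sup>2 - k\<^sup>2"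
      proof (cases "\<bar>x'\<bar> \<le> 1")
        case True
        then have "(1 - \<bar>x'\<bar>)\<^sup>2 \<le> \<bar>y'\<bar>\<^sup>2" using out by (intro square_le_abs_le) auto
        then show ?thesis using k2 by simp
      next
        case False
        \<comment> \<open>The starting point satisfies
          \<open>\<bar>x\<bar> \<le> 1 - \<bar>y\<bar>\<close>, so overshooting 1 by
          \<open>\<bar>x'\<bar> - 1\<close> takes a step with \<open>\<bar>h\<bar>\<close> larger
          than this by at least \<open>\<bar>y\<bar>\<close>.\<close>
        have "\<bar>x'\<bar> \<le> \<bar>x\<bar> + \<bar>h\<bar>" unfolding x'_def by (rule abs_triangle_ineq)
        then have "\<bar>x'\<bar> - 1 \<le> \<bar>h\<bar> - \<bar>y\<bar>" using \<open>\<bar>x\<bar> + \<bar>y\<bar> \<le> 1\<close> by linarith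
        then have "(1 - \<bar>x'\<bar>)\<^sup>2 \<le> (\<bar>h\<bar> - \<bar>y\<bar>)\<^sup>2" using False by (intro square_le_abs_le) auto
        also have "\<dots> = h\<^sup>2 - 2 * (\<bar>y\<bar> * \<bar>h\<bar>) + y\<^sup>2" by (simp add: power2_diff)
        also have "\<dots> \<le> h\<^sup>2 - 2 * (\<bar>y\<bar> * \<bar>k\<bar>) + y\<^sup>2" using mult_left_mono[OF hk, of "\<bar>y\<bar>"] by simp
        also have "\<dots> \<le> h\<^sup>2 + 2 * (y * k) + y\<^sup>2"
          using abs_ge_minus_self[of "y * k"] unfolding abs_mult by linarith
        also have "\<dots> = y'\<^sup>2 + h\<^sup>2 - k\<^sup>2" by (simp add: y'_def power2_sum)
        finally show ?thesis .
      qed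
      then have "1 - 2 * \<bar>x'\<bar> \<le> y'\<^sup>2 - x'\<^sup>2 + h\<^sup>2 - k\<^sup>2" by (simp add: power2_diff)
      then show ?thesis unfolding x'_def[symmetric] y'_def[symmetric] rhs using upper by simp
    qed
  next
    case False
    then have "burkholder x y + burkholder_dx x y * h + burkholder_dy x y * k = 1 - 2 * (sgn x * x')"
      by (simp add: burkholder_def burkholder_dx_def burkholder_dy_def x'_def algebra_simps abs_sgn)
    moreover have "sgn x * x' \<le> \<bar>x'\<bar>" by (auto simp: sgn_if)
    ultimately show ?thesis unfolding x'_def[symmetric] y'_def[symmetric] using upper by linarith
  qed
qed

lemma burkholder_ge: "(if 1 \<le> \<bar>y\<bar> then 1 else 0) - 2 * \<bar>x\<bar> \<le> burkholder x y"
proof -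
  have 1: "x\<^sup>2 \<le> y\<^sup>2 + 2 * \<bar>x\<bar>" if "\<bar>x\<bar> + \<bar>y\<bar> \<le> 1"
  proof -
    have "\<bar>x\<bar> * \<bar>x\<bar> \<le> \<bar>x\<bar> * 1" using that by (intro mult_left_mono) auto
    then have "x\<^sup>2 \<le> \<bar>x\<bar>" by (simp add: power2_eq_square)
    then show ?thesis using zero_le_power2[of y] abs_ge_zero[of x] by linarith
  qed
  have 2: "x = 0 \<and> y\<^sup>2 = 1" if "\<bar>x\<bar> + \<bar>y\<bar> \<le> 1" "1 \<le> \<bar>y\<bar>"
  proof -
    have "x = 0" "\<bar>y\<bar> = 1" using that by auto
    then show ?thesis by (simp add: power2_eq_1_iff abs_if split: if_splits)
  qed
  show ?thesis
  proof (cases "\<bar>x\<bar> + \<bar>y\<bar> \<le> 1")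
    case True
    show ?thesis
    proof (cases "1 \<le> \<bar>y\<bar>")
      case y: True
      then show ?thesis using 2[OF True y] True by (simp add: burkholder_def)
    next
      case False
      then show ?thesis using 1[OF True] True by (simp add: burkholder_def)
    qed
  next
    case False
    then show ?thesis by (simp add: burkholder_def)
  qed
qed

lemma burkholder_bounds:
  "\<bar>burkholder x y\<bar> \<le> 1 + 2 * \<bar>x\<bar>" "\<bar>burkholder_dx x y\<bar> \<le> 2" "\<bar>burkholder_dy x y\<bar> \<le> 2"
proof -
  have "x\<^sup>2 \<le> 1" "y\<^sup>2 \<le> 1" if "\<bar>x\<bar> + \<bar>y\<bar> \<le> 1"
    using that square_le_abs_le[of x 1] square_le_abs_le[of y 1] by auto
  then show "\<bar>burkholder x y\<bar> \<le> 1 + 2 * \<bar>x\<bar>"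
    using zero_le_power2[of x] zero_le_power2[of y] abs_ge_zero[of x] unfolding burkholder_def by (smt (verit))
  show "\<bar>burkholder_dx x y\<bar> \<le> 2" "\<bar>burkholder_dy x y\<bar> \<le> 2"
    by (auto simp: burkholder_dx_def burkholder_dy_def sgn_if)
qed

lemma measurable_burkholder [measurable (raw)]:
  assumes [measurable]: "f \<in> borel_measurable N" "g \<in> borel_measurable N"
  shows "(\<lambda>w. burkholder (f w) (g w)) \<in> borel_measurable N"
    "(\<lambda>w. burkholder_dx (f w) (g w)) \<in> borel_measurable N"
    "(\<lambda>w. burkholder_dy (f w) (g w)) \<in> borel_measurable N"
  unfolding burkholder_def burkholder_dx_def burkholder_dy_def by measurable

context prob_space begin

lemma integrable_bounded_mult:
  fixes f g :: "'a \<Rightarrow> real"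
  assumes g: "integrable M g" and f: "f \<in> borel_measurable M" "\<And>\<omega>. \<omega> \<in> space M \<Longrightarrow> \<bar>f \<omega>\<bar> \<le> c"
  shows "integrable M (\<lambda>\<omega>. f \<omega> * g \<omega>)"
proof (rule Bochner_Integration.integrable_bound)
  show "integrable M (\<lambda>\<omega>. c * \<bar>g \<omega>\<bar>)" using g by simp
  show "AE \<omega> in M. norm (f \<omega> * g \<omega>) \<le> norm (c * \<bar>g \<omega>\<bar>)"
  proof (rule AE_I2)
    fix \<omega> assume "\<omega> \<in> space M"
    then have "\<bar>f \<omega>\<bar> \<le> c" "0 \<le> c" using f(2)[of \<omega>] by auto
    then show "norm (f \<omega> * g \<omega>) \<le> norm (c * \<bar>g \<omega>\<bar>)" by (simp add: abs_mult mult_right_mono)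
  qed
qed (use f g in auto)

text \<open>The expectation of \<open>burkholder\<close> at the pair of rescaled sums starts at 0
  and never increases: the linear term of \<open>burkholder_step\<close> is a bounded variable of
  the past times \<open>D i\<close>, and \<open>orth\<close> annihilates it. The final value, at
  most 0, bounds the probability through \<open>burkholder_ge\<close>. Division by l normalizes the
  level to 1.\<close>

lemma martingale_transform_weak_type:
  fixes D H :: "nat \<Rightarrow> 'a \<Rightarrow> real" and F :: "nat \<Rightarrow> 'a measure"
  assumes sub: "\<And>i. i \<le> n \<Longrightarrow> subalgebra M (F i)"
    and x: "\<And>i. i \<le> n \<Longrightarrow> (\<lambda>\<omega>. \<Sum>j<i. D j \<omega>) \<in> borel_measurable (F i)"
    and y: "\<And>i. i \<le> n \<Longrightarrow> (\<lambda>\<omega>. \<Sum>j<i. H j \<omega> * D j \<omega>) \<in> borel_measurable (F i)"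
    and H: "\<And>i. i < n \<Longrightarrow> H i \<in> borel_measurable (F i)" "\<And>i \<omega>. i < n \<Longrightarrow> \<omega> \<in> space M \<Longrightarrow> \<bar>H i \<omega>\<bar> \<le> 1"
    and D: "\<And>i. i < n \<Longrightarrow> integrable M (D i)"
    and orth: "\<And>i \<phi> c. i < n \<Longrightarrow> \<phi> \<in> borel_measurable (F i) \<Longrightarrow> (\<And>\<omega>. \<omega> \<in> space M \<Longrightarrow> \<bar>\<phi> \<omega>\<bar> \<le> c) \<Longrightarrow>
        expectation (\<lambda>\<omega>. \<phi> \<omega> * D i \<omega>) = 0"
    and l: "0 < l"
  shows "prob {\<omega>\<in>space M. l \<le> \<bar>\<Sum>i<n. H i \<omega> * D i \<omega>\<bar>} \<le> 2 * expectation (\<lambda>\<omega>. \<bar>\<Sum>i<n. D i \<omega>\<bar>) / l"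
proof -
  define X where "X i \<omega> = (\<Sum>j<i. D j \<omega>) / l" for i \<omega>
  define Y where "Y i \<omega> = (\<Sum>j<i. H j \<omega> * D j \<omega>) / l" for i \<omega>
  define U where "U i = expectation (\<lambda>\<omega>. burkholder (X i \<omega>) (Y i \<omega>))" for i
  have XF: "X i \<in> borel_measurable (F i)" and YF: "Y i \<in> borel_measurable (F i)" if "i \<le> n" for i
    using x[OF that] y[OF that] unfolding X_def Y_def by measurable
  have XM: "X i \<in> borel_measurable M" and YM: "Y i \<in> borel_measurable M" if "i \<le> n" for i
    using XF[OF that] YF[OF that] measurable_from_subalg[OF sub[OF that]] by auto
  have Xi: "integrable M (X i)" if "i \<le> n" for i
    using that unfolding X_def by (intro integrable_divide Bochner_Integration.integrable_sum D) auto
  have Ui: "integrable M (\<lambda>\<omega>. burkholder (X i \<omega>) (Y i \<omega>))" if "i \<le> n" for i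
  proof (rule Bochner_Integration.integrable_bound)
    show "integrable M (\<lambda>\<omega>. 1 + 2 * \<bar>X i \<omega>\<bar>)" using Xi[OF that] by simp
    show "AE \<omega> in M. norm (burkholder (X i \<omega>) (Y i \<omega>)) \<le> norm (1 + 2 * \<bar>X i \<omega>\<bar>)"
      using burkholder_bounds(1) by (auto simp: abs_if[of "1 + _"])
  qed (use XM[OF that] YM[OF that] in measurable)
  have step: "U (Suc i) \<le> U i" if i: "i < n" for i
  proof -
    \<comment> \<open>The coefficient of \<open>D i\<close> when the increments
      \<open>D i / l\<close> and \<open>H i * D i / l\<close> are inserted into the linear
      term.\<close>
    define \<phi> where "\<phi> \<omega> = (burkholder_dx (X i \<omega>) (Y i \<omega>) + burkholder_dy (X i \<omega>) (Y i \<omega>) * H i \<omega>) / l" for \<omega>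
    have \<phi>F: "\<phi> \<in> borel_measurable (F i)"
      using XF[of i] YF[of i] H(1)[OF i] i unfolding \<phi>_def by simp
    have \<phi>b: "\<bar>\<phi> \<omega>\<bar> \<le> 4 / l" if "\<omega> \<in> space M" for \<omega>
    proof -
      have "\<bar>burkholder_dy (X i \<omega>) (Y i \<omega>) * H i \<omega>\<bar> \<le> 2 * 1"
        unfolding abs_mult by (intro mult_mono burkholder_bounds H(2) i that) auto
      then have "\<bar>burkholder_dx (X i \<omega>) (Y i \<omega>) + burkholder_dy (X i \<omega>) (Y i \<omega>) * H i \<omega>\<bar> \<le> 4"
        using burkholder_bounds(2)[of "X i \<omega>" "Y i \<omega>"] by linarith
      then show ?thesis using l by (simp add: \<phi>_def abs_divide divide_right_mono)
    qed
    have \<phi>M: "\<phi> \<in> borel_measurable M" using measurable_from_subalg[OF sub \<phi>F] i by simp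
    have \<phi>D: "integrable M (\<lambda>\<omega>. \<phi> \<omega> * D i \<omega>)"
      by (rule integrable_bounded_mult[OF D[OF i] \<phi>M \<phi>b])
    have "U (Suc i) \<le> expectation (\<lambda>\<omega>. burkholder (X i \<omega>) (Y i \<omega>) + \<phi> \<omega> * D i \<omega>)"
      unfolding U_def
    proof (rule integral_mono)
      fix \<omega> assume \<omega>: "\<omega> \<in> space M"
      have e: "X (Suc i) \<omega> = X i \<omega> + D i \<omega> / l" "Y (Suc i) \<omega> = Y i \<omega> + H i \<omega> * D i \<omega> / l"
        by (simp_all add: X_def Y_def add_divide_distrib)
      have "\<bar>H i \<omega> * D i \<omega> / l\<bar> \<le> \<bar>D i \<omega> / l\<bar>"
        using H(2)[OF i \<omega>] l by (simp add: abs_mult mult_left_le_one_le divide_right_mono)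
      from burkholder_step[OF this, of "X i \<omega>" "Y i \<omega>"]
      show "burkholder (X (Suc i) \<omega>) (Y (Suc i) \<omega>) \<le> burkholder (X i \<omega>) (Y i \<omega>) + \<phi> \<omega> * D i \<omega>"
        using l by (simp add: e \<phi>_def field_simps)
    qed (use Ui[of "Suc i"] Ui[of i] \<phi>D i in auto)
    also have "\<dots> = U i"
      using Ui[of i] \<phi>D orth[OF i \<phi>F \<phi>b] i by (simp add: U_def)
    finally show ?thesis .
  qed
  have "U i \<le> 0" if "i \<le> n" for i
    using that
  proof (induction i)
    case 0
    then show ?case by (simp add: U_def X_def Y_def burkholder_def)
  next
    case (Suc i)
    then show ?case using step[of i] by simp
  qed
  then have U: "U n \<le> 0" by simp
  define E where "E = {\<omega>\<in>space M. 1 \<le> \<bar>Y n \<omega>\<bar>}"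
  have E [measurable]: "E \<in> sets M" unfolding E_def using YM[of n] by measurable
  have Ei: "integrable M (indicator E :: 'a \<Rightarrow> real)"
    by (rule integrable_real_indicator[OF E]) (simp add: emeasure_eq_measure)
  have "expectation (\<lambda>\<omega>. indicator E \<omega> - 2 * \<bar>X n \<omega>\<bar>) \<le> U n"
    unfolding U_def
  proof (rule integral_mono)
    fix \<omega> assume "\<omega> \<in> space M"
    then show "indicator E \<omega> - 2 * \<bar>X n \<omega>\<bar> \<le> burkholder (X n \<omega>) (Y n \<omega>)"
      using burkholder_ge[of "Y n \<omega>" "X n \<omega>"] by (cases "1 \<le> \<bar>Y n \<omega>\<bar>") (simp_all add: E_def)
  qed (use Xi[of n] Ui[of n] Ei in auto)
  then have "prob E \<le> 2 * expectation (\<lambda>\<omega>. \<bar>X n \<omega>\<bar>)" using U Xi[of n] Ei by simp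
  also have "expectation (\<lambda>\<omega>. \<bar>X n \<omega>\<bar>) = expectation (\<lambda>\<omega>. \<bar>\<Sum>i<n. D i \<omega>\<bar>) / l"
    using l by (simp add: X_def abs_divide)
  also have "E = {\<omega>\<in>space M. l \<le> \<bar>\<Sum>i<n. H i \<omega> * D i \<omega>\<bar>}"
    using l by (simp add: E_def Y_def abs_divide pos_le_divide_eq)
  finally show ?thesis by simp
qed

lemma prob_eventually_not_tendsto_0:
  assumes [measurable]: "\<And>k::nat. E k \<in> sets M" and ae: "AE \<omega> in M. \<forall>\<^sub>F k in sequentially. \<omega> \<notin> E k"
  shows "(\<lambda>k. prob (E k)) \<longlonglongrightarrow> 0"
proof -
  have "(\<lambda>k. expectation (\<lambda>\<omega>. indicator (E k) \<omega>)) \<longlonglongrightarrow> expectation (\<lambda>\<omega>. 0 :: real)"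
  proof (rule integral_dominated_convergence[where w = "\<lambda>_. 1"])
    show "AE \<omega> in M. (\<lambda>k. indicator (E k) \<omega> :: real) \<longlonglongrightarrow> 0"
      using ae by eventually_elim (auto intro!: tendsto_eventually elim: eventually_mono)
  qed auto
  then show ?thesis by simp
qed

text \<open>For almost every \<omega> only finitely many of the events
  \<open>\<exists>n. real (Suc k) < W n \<omega>\<close> occur, so their probabilities tend to
  0.\<close>

lemma prob_sup_gt_small:
  fixes W :: "nat \<Rightarrow> 'a \<Rightarrow> real"
  assumes [measurable]: "\<And>n. W n \<in> borel_measurable M" and ae: "AE \<omega> in M. \<exists>K. \<forall>n. W n \<omega> \<le> K" and e: "0 < e"
  obtains K where "0 < K" "prob {\<omega>\<in>space M. \<exists>n. K < W n \<omega>} < e"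
proof -
  have "(\<lambda>k::nat. prob {\<omega>\<in>space M. \<exists>n. real (Suc k) < W n \<omega>}) \<longlonglongrightarrow> 0"
  proof (rule prob_eventually_not_tendsto_0)
    show "AE \<omega> in M. \<forall>\<^sub>F k in sequentially. \<omega> \<notin> {\<omega>\<in>space M. \<exists>n. real (Suc k) < W n \<omega>}"
      using ae
    proof eventually_elim
      fix \<omega> assume "\<exists>K. \<forall>n. W n \<omega> \<le> K"
      then obtain K where K: "\<And>n. W n \<omega> \<le> K" by auto
      obtain k0 :: nat where "K \<le> real k0" using real_arch_simple by blast
      then have "W n \<omega> \<le> real (Suc k)" if "k0 \<le> k" for n k using K[of n] that by linarith
      then show "\<forall>\<^sub>F k in sequentially. \<omega> \<notin> {\<omega>\<in>space M. \<exists>n. real (Suc k) < W n \<omega>}"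
        unfolding eventually_sequentially by (intro exI[of _ k0]) (auto simp: not_less)
    qed
  qed simp
  from order_tendstoD(2)[OF this e] obtain k where "prob {\<omega>\<in>space M. \<exists>n. real (Suc k) < W n \<omega>} < e"
    by (auto simp: eventually_sequentially)
  then show thesis by (intro that[of "real (Suc k)"]) auto
qed

lemma martingale_orthogonal:
  assumes F: "subalgebra M (F s)" and m: "martingale M F N" and s: "0 \<le> s" "s \<le> t"
    and \<phi>: "\<phi> \<in> borel_measurable (F s)" "\<And>\<omega>. \<omega> \<in> space M \<Longrightarrow> \<bar>\<phi> \<omega>\<bar> \<le> c"
  shows "expectation (\<lambda>\<omega>. \<phi> \<omega> * (N t \<omega> - N s \<omega>)) = 0"
proof -
  interpret S: finite_measure_subalgebra M "F s" using F by unfold_locales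
  have \<phi>M: "\<phi> \<in> borel_measurable M" using measurable_from_subalg[OF F \<phi>(1)] .
  have Ni: "integrable M (N t)" "integrable M (N s)" using m s by (auto simp: martingale_def)
  have i: "integrable M (\<lambda>\<omega>. \<phi> \<omega> * N t \<omega>)" "integrable M (\<lambda>\<omega>. \<phi> \<omega> * N s \<omega>)"
    by (intro integrable_bounded_mult[OF _ \<phi>M \<phi>(2)] Ni; assumption)+
  have ce: "AE \<omega> in M. real_cond_exp M (F s) (N t) \<omega> = N s \<omega>" using m s by (auto simp: martingale_def)
  have "expectation (\<lambda>\<omega>. \<phi> \<omega> * N t \<omega>) = expectation (\<lambda>\<omega>. \<phi> \<omega> * real_cond_exp M (F s) (N t) \<omega>)"
    using S.real_cond_exp_intg(2)[OF i(1) \<phi>(1)] Ni(1) by auto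
  also have "\<dots> = expectation (\<lambda>\<omega>. \<phi> \<omega> * N s \<omega>)"
    using ce \<phi>M Ni(2) measurable_from_subalg[OF F borel_measurable_cond_exp]
    by (intro integral_cong_AE) (auto elim: eventually_mono)
  finally show ?thesis using i by (simp add: right_diff_distrib)
qed

text \<open>Three exceptional events get probability at most \<open>e / 3\<close> each: the
  localizing time \<open>\<tau> k\<close> is at most 2, a variation sum of A on [1,2] exceeds K, the
  transform of the stopped martingale L reaches l. None of k, K, l depends on n or H. For l this is
  because the weak type bound involves only the plain sum of the increments, which telescopes to
  \<open>L 2 - L 1\<close>.\<close>

lemma semimartingale_good_integrator:
  assumes filt: "filtration (space M) F" and sub: "\<And>t. subalgebra M (F t)"
    and semi: "semimartingale M F X" and e: "0 < e"
  obtains l where "0 < l"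
    "\<And>(n::nat) H. 0 < n \<Longrightarrow> (\<And>i. i < n \<Longrightarrow> H i \<in> borel_measurable (F (1 + real i / n))) \<Longrightarrow>
       (\<And>i \<omega>. i < n \<Longrightarrow> \<omega> \<in> space M \<Longrightarrow> \<bar>H i \<omega>\<bar> \<le> 1) \<Longrightarrow>
       prob {\<omega>\<in>space M. l \<le> \<bar>\<Sum>i<n. H i \<omega> * (X (1 + real (Suc i) / n) \<omega> - X (1 + real i / n) \<omega>)\<bar>} \<le> e"
proof -
  interpret F: filtration "space M" F by fact
  from semi obtain N A where ad: "adapted_process F X" and N: "local_martingale M F N"
    and A: "finite_variation_process M F A"
    and eq: "AE \<omega> in M. N 0 \<omega> = 0 \<and> A 0 \<omega> = 0 \<and> (\<forall>t\<ge>0. X t \<omega> = X 0 \<omega> + N t \<omega> + A t \<omega>)"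
    unfolding semimartingale_def by blast
  have meas: "Z t \<in> borel_measurable M" if "adapted_process F Z" "0 \<le> t" for Z t
    using that measurable_from_subalg[OF sub] by (auto simp: adapted_process_def)
  have XM: "X t \<in> borel_measurable M" and AM: "A t \<in> borel_measurable M" if "0 \<le> t" for t
    using meas[of X t] meas[of A t] ad A that by (auto simp: finite_variation_process_def)
  from N obtain \<tau> :: "nat \<Rightarrow> 'a \<Rightarrow> real" where st: "\<And>k. stopping_time F (\<tau> k)"
    and \<tau>lim': "AE \<omega> in M. incseq (\<lambda>k. \<tau> k \<omega>) \<and> filterlim (\<lambda>k. \<tau> k \<omega>) at_top sequentially"
    and mart: "\<And>k. martingale M F (\<lambda>t \<omega>. N (min t (\<tau> k \<omega>)) \<omega> - N 0 \<omega>)"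
    unfolding local_martingale_def by blast
  from \<tau>lim' have \<tau>lim: "AE \<omega> in M. filterlim (\<lambda>k. \<tau> k \<omega>) at_top sequentially"
    by eventually_elim simp
  have \<tau>M: "{\<omega>\<in>space M. \<tau> k \<omega> \<le> 2} \<in> sets M" for k
  proof -
    have "{\<omega>\<in>space (F 2). \<tau> k \<omega> \<le> 2} \<in> sets (F 2)"
      using stopping_timeD[OF st] by (simp add: pred_def)
    then show ?thesis using sub[of 2] by (auto simp: subalgebra_def)
  qed
  have "(\<lambda>k. prob {\<omega>\<in>space M. \<tau> k \<omega> \<le> 2}) \<longlonglongrightarrow> 0"
  proof (rule prob_eventually_not_tendsto_0[OF \<tau>M])
    show "AE \<omega> in M. \<forall>\<^sub>F k in sequentially. \<omega> \<notin> {\<omega>\<in>space M. \<tau> k \<omega> \<le> 2}"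
      using \<tau>lim
    proof eventually_elim
      fix \<omega> assume "filterlim (\<lambda>k. \<tau> k \<omega>) at_top sequentially"
      then have "\<forall>\<^sub>F k in sequentially. 2 < \<tau> k \<omega>" by (simp add: filterlim_at_top_dense)
      then show "\<forall>\<^sub>F k in sequentially. \<omega> \<notin> {\<omega>\<in>space M. \<tau> k \<omega> \<le> 2}"
        by eventually_elim simp
    qed
  qed
  from order_tendstoD(2)[OF this, of "e / 3"] e obtain k where k: "prob {\<omega>\<in>space M. \<tau> k \<omega> \<le> 2} < e / 3"
    by (auto simp: eventually_sequentially)
  define L where "L t \<omega> = N (min t (\<tau> k \<omega>)) \<omega> - N 0 \<omega>" for t \<omega>
  have L: "martingale M F L" unfolding L_def[abs_def] by (rule mart)
  \<comment> \<open>Division by zero gives \<open>tt 0 i = 1\<close>, so the bounds on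
    \<open>tt\<close> hold for every n.\<close>
  define tt where "tt n i = 1 + real i / real n" for n i :: nat
  have tt: "0 \<le> tt n i" "1 \<le> tt n i" for n i by (auto simp: tt_def)
  have tt_mono: "i \<le> j \<Longrightarrow> tt n i \<le> tt n j" for n i j by (auto simp: tt_def divide_right_mono)
  have tt_le2: "tt n i \<le> 2" if "i \<le> n" for n i using that by (cases "n = 0") (auto simp: tt_def divide_le_eq)
  define V where "V n \<omega> = (\<Sum>i<n. \<bar>A (tt n (Suc i)) \<omega> - A (tt n i) \<omega>\<bar>)" for n \<omega>
  have VM: "V n \<in> borel_measurable M" for n
    unfolding V_def using AM tt by (intro borel_measurable_sum borel_measurable_abs borel_measurable_diff) auto
  have "AE \<omega> in M. finite_variation_path (\<lambda>t. A t \<omega>)" using A by (auto simp: finite_variation_process_def)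
  then have "AE \<omega> in M. \<exists>K. \<forall>n. V n \<omega> \<le> K"
  proof eventually_elim
    fix \<omega> assume "finite_variation_path (\<lambda>t. A t \<omega>)"
    then obtain K where K: "\<And>(n::nat) p. 0 \<le> p 0 \<and> (\<forall>i<n. p i \<le> p (Suc i)) \<and> p n \<le> 2 \<Longrightarrow>
        (\<Sum>i<n. \<bar>A (p (Suc i)) \<omega> - A (p i) \<omega>\<bar>) \<le> K"
      unfolding finite_variation_path_def using zero_le_numeral[of "num.Bit0 num.One"] by blast
    have "V n \<omega> \<le> K" for n
      unfolding V_def using tt tt_mono tt_le2 by (intro K[of "tt n" n]) auto
    then show "\<exists>K. \<forall>n. V n \<omega> \<le> K" by blast
  qed
  then have "\<exists>K>0. prob {\<omega>\<in>space M. \<exists>n. K < V n \<omega>} < e / 3"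
    by (rule prob_sup_gt_small[OF VM, where e = "e / 3"]) (use e in auto)
  then obtain K where K: "0 < K" "prob {\<omega>\<in>space M. \<exists>n. K < V n \<omega>} < e / 3" by blast
  define c where "c = expectation (\<lambda>\<omega>. \<bar>L 2 \<omega> - L 1 \<omega>\<bar>)"
  have c: "0 \<le> c" by (simp add: c_def)
  \<comment> \<open>Chosen for \<open>2 * c / l \<le> e / 3\<close>; the summand 1 keeps l positive
    if c is 0.\<close>
  define l where "l = 6 * c / e + 1"
  have l: "0 < l" "2 * c / l \<le> e / 3" using c e by (auto simp: l_def field_simps add_pos_nonneg)
  show thesis
  proof (rule that[of "l + K"])
    show "0 < l + K" using l K by simp
    fix n :: nat and H :: "nat \<Rightarrow> 'a \<Rightarrow> real"
    assume n: "0 < n" and HF: "\<And>i. i < n \<Longrightarrow> H i \<in> borel_measurable (F (1 + real i / n))"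
      and H1: "\<And>i \<omega>. i < n \<Longrightarrow> \<omega> \<in> space M \<Longrightarrow> \<bar>H i \<omega>\<bar> \<le> 1"
    define D where "D i \<omega> = L (tt n (Suc i)) \<omega> - L (tt n i) \<omega>" for i \<omega>
    have subF: "subalgebra (F t) (F s)" if "s \<le> t" for s t
      using F.sets_F_mono[OF that] by (simp add: subalgebra_def F.space_F)
    have LF: "L s \<in> borel_measurable (F t)" if "0 \<le> s" "s \<le> t" for s t
      using L that(1) by (intro measurable_from_subalg[OF subF[OF that(2)]]) (simp add: martingale_def adapted_process_def)
    have Li: "integrable M (L s)" if "0 \<le> s" for s using L that by (simp add: martingale_def)
    have HFm: "H j \<in> borel_measurable (F (tt n i))" if "j < n" "j \<le> i" for i j
      using HF[OF that(1)] by (intro measurable_from_subalg[OF subF[OF tt_mono[OF that(2)]]]) (simp only: tt_def)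
    have DF: "D j \<in> borel_measurable (F (tt n i))" if "j < i" for i j
      unfolding D_def using that tt tt_mono[of j i n] tt_mono[of "Suc j" i n]
      by (intro borel_measurable_diff LF) auto
    have weak: "prob {\<omega>\<in>space M. l \<le> \<bar>\<Sum>i<n. H i \<omega> * D i \<omega>\<bar>} \<le> 2 * expectation (\<lambda>\<omega>. \<bar>\<Sum>i<n. D i \<omega>\<bar>) / l"
    proof (rule martingale_transform_weak_type[where F = "\<lambda>i. F (tt n i)"])
      fix i and \<phi> :: "'a \<Rightarrow> real" and c assume i: "i < n" and \<phi>: "\<phi> \<in> borel_measurable (F (tt n i))" "\<And>\<omega>. \<omega> \<in> space M \<Longrightarrow> \<bar>\<phi> \<omega>\<bar> \<le> c"
      show "expectation (\<lambda>\<omega>. \<phi> \<omega> * D i \<omega>) = 0"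
        unfolding D_def by (rule martingale_orthogonal[OF sub L tt(1) tt_mono \<phi>]) auto
    next
      fix i assume "i \<le> n"
      then show "(\<lambda>\<omega>. \<Sum>j<i. H j \<omega> * D j \<omega>) \<in> borel_measurable (F (tt n i))"
        by (intro borel_measurable_sum borel_measurable_times HFm DF) auto
      show "(\<lambda>\<omega>. \<Sum>j<i. D j \<omega>) \<in> borel_measurable (F (tt n i))"
        by (intro borel_measurable_sum DF) auto
    next
      fix i assume "i < n"
      then show "H i \<in> borel_measurable (F (tt n i))" by (rule HFm) simp
      show "integrable M (D i)" unfolding D_def using tt by (intro Bochner_Integration.integrable_diff Li) auto
    qed (use sub H1 l in auto)
    have "(\<Sum>i<n. D i \<omega>) = L 2 \<omega> - L 1 \<omega>" for \<omega>
      unfolding D_def by (subst sum_lessThan_telescope) (use n in \<open>simp add: tt_def\<close>)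
    then have weak': "prob {\<omega>\<in>space M. l \<le> \<bar>\<Sum>i<n. H i \<omega> * D i \<omega>\<bar>} \<le> e / 3"
      using weak l(2) by (simp add: c_def)
    define S where "S = {\<omega>\<in>space M. l + K \<le> \<bar>\<Sum>i<n. H i \<omega> * (X (tt n (Suc i)) \<omega> - X (tt n i) \<omega>)\<bar>}"
    have HM: "H i \<in> borel_measurable M" if "i < n" for i
      using measurable_from_subalg[OF sub HF[OF that]] .
    have DM: "D i \<in> borel_measurable M" for i
      using measurable_from_subalg[OF sub DF[of i "Suc i"]] by simp
    let ?S1 = "{\<omega>\<in>space M. l \<le> \<bar>\<Sum>i<n. H i \<omega> * D i \<omega>\<bar>}"
    let ?S2 = "{\<omega>\<in>space M. \<tau> k \<omega> \<le> 2}" and ?S3 = "{\<omega>\<in>space M. \<exists>n. K < V n \<omega>}"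
    have S1: "?S1 \<in> sets M"
    proof -
      have "(\<lambda>\<omega>. \<bar>\<Sum>i<n. H i \<omega> * D i \<omega>\<bar>) \<in> borel_measurable M"
        by (intro borel_measurable_abs borel_measurable_sum borel_measurable_times HM DM) auto
      then show ?thesis by measurable
    qed
    have S3: "?S3 \<in> sets M" using VM by measurable
    have "prob S \<le> prob (?S1 \<union> (?S2 \<union> ?S3))"
    proof (rule finite_measure_mono_AE)
      show "?S1 \<union> (?S2 \<union> ?S3) \<in> sets M" using S1 \<tau>M S3 by auto
      show "AE \<omega> in M. \<omega> \<in> S \<longrightarrow> \<omega> \<in> ?S1 \<union> (?S2 \<union> ?S3)"
        using eq
      proof (eventually_elim, intro impI)
        fix \<omega> assume eq: "N 0 \<omega> = 0 \<and> A 0 \<omega> = 0 \<and> (\<forall>t\<ge>0. X t \<omega> = X 0 \<omega> + N t \<omega> + A t \<omega>)" and S: "\<omega> \<in> S"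
        then have \<omega>: "\<omega> \<in> space M" by (simp add: S_def)
        show "\<omega> \<in> ?S1 \<union> (?S2 \<union> ?S3)"
        proof (rule ccontr)
          assume "\<not> ?thesis"
          with \<omega> have small: "\<bar>\<Sum>i<n. H i \<omega> * D i \<omega>\<bar> < l" "2 < \<tau> k \<omega>" "V n \<omega> \<le> K" by (auto simp: not_le not_less)
          let ?A = "\<lambda>i. A (tt n (Suc i)) \<omega> - A (tt n i) \<omega>"
          have inc: "X (tt n (Suc i)) \<omega> - X (tt n i) \<omega> = D i \<omega> + ?A i" if "i < n" for i
          proof -
            have "tt n i \<le> 2" "tt n (Suc i) \<le> 2" using that by (auto intro!: tt_le2)
            then have "L (tt n i) \<omega> = N (tt n i) \<omega> - N 0 \<omega>" "L (tt n (Suc i)) \<omega> = N (tt n (Suc i)) \<omega> - N 0 \<omega>"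
              using small(2) by (simp_all add: L_def min_absorb1)
            moreover have "X (tt n j) \<omega> = X 0 \<omega> + N (tt n j) \<omega> + A (tt n j) \<omega>" for j
              using eq tt(1) by blast
            ultimately show ?thesis by (simp add: D_def)
          qed
          have "\<bar>\<Sum>i<n. H i \<omega> * ?A i\<bar> \<le> (\<Sum>i<n. \<bar>H i \<omega> * ?A i\<bar>)" by (rule sum_abs)
          also have "\<dots> \<le> V n \<omega>"
            unfolding V_def using H1 \<omega> by (intro sum_mono) (auto simp: abs_mult intro!: mult_left_le_one_le)
          finally have *: "\<bar>\<Sum>i<n. H i \<omega> * ?A i\<bar> \<le> K" using small(3) by simp
          have "(\<Sum>i<n. H i \<omega> * (X (tt n (Suc i)) \<omega> - X (tt n i) \<omega>)) = (\<Sum>i<n. H i \<omega> * (D i \<omega> + ?A i))"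
            using inc by (intro sum.cong) auto
          also have "\<dots> = (\<Sum>i<n. H i \<omega> * D i \<omega>) + (\<Sum>i<n. H i \<omega> * ?A i)"
            by (simp only: distrib_left sum.distrib)
          finally show False using S * small(1) by (auto simp: S_def)
        qed
      qed
    qed
    also have "\<dots> \<le> prob ?S1 + prob (?S2 \<union> ?S3)"
      using S1 \<tau>M S3 by (intro measure_Un_le) auto
    also have "prob (?S2 \<union> ?S3) \<le> prob ?S2 + prob ?S3"
      using \<tau>M S3 by (intro measure_Un_le) auto
    finally have "prob S \<le> e" using weak' k K(2) by linarith
    then show "prob {\<omega>\<in>space M. l + K \<le> \<bar>\<Sum>i<n. H i \<omega> * (X (1 + real (Suc i) / n) \<omega> - X (1 + real i / n) \<omega>)\<bar>} \<le> e"
      by (simp only: S_def tt_def)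
  qed
qed

end

subsection \<open>Two criteria for not being a semimartingale\<close>

context prob_space begin

text \<open>Integration of a pointwise inequality: S is at most \<open>m / 2\<close> off the event,
  and on the event at most \<open>l * S\<^sup>2 / 2 + 1 / (2 * l)\<close>.\<close>

lemma Paley_Zygmund:
  fixes S :: "'a \<Rightarrow> real"
  assumes [measurable]: "S \<in> borel_measurable M" and i: "integrable M S" "integrable M (\<lambda>\<omega>. (S \<omega>)\<^sup>2)"
    and m: "0 < expectation S"
  shows "(expectation S)\<^sup>2 \<le> 4 * prob {\<omega>\<in>space M. expectation S / 2 \<le> S \<omega>} * expectation (\<lambda>\<omega>. (S \<omega>)\<^sup>2)"
proof -
  define m where "m = expectation S"
  define E where "E = expectation (\<lambda>\<omega>. (S \<omega>)\<^sup>2)"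
  define A where "A = {\<omega>\<in>space M. m / 2 \<le> S \<omega>}"
  have [measurable]: "A \<in> sets M" unfolding A_def by measurable
  have m0: "0 < m" using m by (simp add: m_def)
  have "m\<^sup>2 \<le> E"
    using variance_eq[OF i] variance_positive[of S] by (simp add: m_def E_def)
  then have E0: "0 < E" using m0 by (smt (verit) zero_less_power2)
  \<comment> \<open>With this l the quadratic term contributes \<open>m / 4\<close>, so that
    \<open>m / 4\<close> is left for the event.\<close>
  define l where "l = m / (2 * E)"
  have l: "0 < l" using m0 E0 by (simp add: l_def)
  have Ai: "integrable M (indicator A :: 'a \<Rightarrow> real)"
    by (rule integrable_real_indicator) (simp_all add: emeasure_eq_measure)
  have "m \<le> expectation (\<lambda>\<omega>. m / 2 + (l * (S \<omega>)\<^sup>2 / 2 + indicator A \<omega> / (2 * l)))"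
    unfolding m_def
  proof (rule integral_mono)
    fix \<omega> assume \<omega>: "\<omega> \<in> space M"
    show "S \<omega> \<le> expectation S / 2 + (l * (S \<omega>)\<^sup>2 / 2 + indicator A \<omega> / (2 * l))"
    proof (cases "\<omega> \<in> A")
      case True
      have "0 \<le> (l * S \<omega> - 1)\<^sup>2" by simp
      then have "2 * (l * S \<omega>) \<le> l * (l * (S \<omega>)\<^sup>2) + 1" by (simp add: power2_eq_square algebra_simps)
      then have "S \<omega> \<le> l * (S \<omega>)\<^sup>2 / 2 + 1 / (2 * l)" using l by (simp add: field_simps)
      then show ?thesis using True m by simp
    next
      case False
      have "0 \<le> l * (S \<omega>)\<^sup>2 / 2" using l by simp
      then show ?thesis using False \<omega> by (simp add: A_def m_def)
    qed
  qed (use i Ai in auto)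
  also have "\<dots> = m / 2 + (l * E / 2 + prob A / (2 * l))"
    using i Ai by (simp add: E_def prob_space)
  also have "\<dots> = m / 2 + (m / 4 + prob A * E / m)"
    using m0 E0 by (simp add: l_def field_simps)
  finally have "m * m \<le> 4 * (prob A * E)" using m0 by (simp add: field_simps)
  then show ?thesis by (simp add: m_def E_def A_def power2_eq_square mult.assoc)
qed

text \<open>The sum Q of the squared increments is the increment of the square of X over [1,2] minus
  twice the sum of \<open>X (tt n i) * D i\<close>. Path continuity bounds the first part and the
  good integrator property the second, both uniformly in n. But Q is at least half of its mean with
  probability at least 1/12, and this mean is unbounded.\<close>

lemma not_semimartingale_quadratic_variation:
  assumes filt: "filtration (space M) F" and sub: "\<And>t. subalgebra M (F t)"
    and cont: "continuous_process M X"
    and gauss: "\<And>n i. i < n \<Longrightarrow> gaussian_rv (\<sigma> n i) (\<lambda>\<omega>. X (1 + real (Suc i) / real n) \<omega> - X (1 + real i / real n) \<omega>)"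
    and unb: "\<And>C. \<exists>n>0. C < (\<Sum>i<n. \<sigma> n i)"
  shows "\<not> semimartingale M F X"
proof
  assume semi: "semimartingale M F X"
  have XF: "X t \<in> borel_measurable (F t)" if "0 \<le> t" for t
    using semi that by (simp add: semimartingale_def adapted_process_def)
  have XM: "X t \<in> borel_measurable M" if "0 \<le> t" for t
    using measurable_from_subalg[OF sub XF[OF that]] .
  define tt where "tt n i = 1 + real i / real n" for n i :: nat
  have tt: "0 \<le> tt n i" "1 \<le> tt n i" for n i by (auto simp: tt_def)
  have tt_le2: "tt n i \<le> 2" if "i \<le> n" for n i using that by (cases "n = 0") (auto simp: tt_def divide_le_eq)
  \<comment> \<open>One sequence running through the points of all partitions, as required by
    \<open>prob_sup_gt_small\<close>; \<open>min i n\<close> sends surplus indices to the last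
    point.\<close>
  define W where "W m = (case prod_decode m of (n, i) \<Rightarrow> \<lambda>\<omega>. \<bar>X (tt n (min i n)) \<omega>\<bar>)" for m
  have WM: "W m \<in> borel_measurable M" for m
    unfolding W_def using XM tt(1) by (cases "prod_decode m") simp
  have "AE \<omega> in M. continuous_on {0..} (\<lambda>t. X t \<omega>)" using cont by (simp add: continuous_process_def)
  then have Wb: "AE \<omega> in M. \<exists>K. \<forall>m. W m \<omega> \<le> K"
  proof eventually_elim
    fix \<omega> assume "continuous_on {0..} (\<lambda>t. X t \<omega>)"
    then have "continuous_on {1..2} (\<lambda>t. X t \<omega>)" by (rule continuous_on_subset) auto
    then have "bounded ((\<lambda>t. X t \<omega>) ` {1..2})"
      by (intro compact_imp_bounded compact_continuous_image) auto
    then have "\<exists>K. \<forall>t\<in>{1..2}. \<bar>X t \<omega>\<bar> \<le> K" by (simp add: bounded_iff)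
    then obtain K where K: "\<And>t. t \<in> {1..2} \<Longrightarrow> \<bar>X t \<omega>\<bar> \<le> K" by blast
    have "W m \<omega> \<le> K" for m
      unfolding W_def using tt(2) tt_le2 by (cases "prod_decode m") (auto intro!: K)
    then show "\<exists>K. \<forall>m. W m \<omega> \<le> K" by blast
  qed
  obtain K where K: "0 < K" "prob {\<omega>\<in>space M. \<exists>m. K < W m \<omega>} < 1 / 100"
    by (rule prob_sup_gt_small[OF WM Wb, where e = "1 / 100"]) auto
  let ?D = "\<lambda>n i \<omega>. X (1 + real (Suc i) / real n) \<omega> - X (1 + real i / real n) \<omega>"
  obtain l where l: "0 < l"
    "\<And>(n::nat) H. 0 < n \<Longrightarrow> (\<And>i. i < n \<Longrightarrow> H i \<in> borel_measurable (F (1 + real i / n))) \<Longrightarrow>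
       (\<And>i \<omega>. i < n \<Longrightarrow> \<omega> \<in> space M \<Longrightarrow> \<bar>H i \<omega>\<bar> \<le> 1) \<Longrightarrow>
       prob {\<omega>\<in>space M. l \<le> \<bar>\<Sum>i<n. H i \<omega> * ?D n i \<omega>\<bar>} \<le> 1 / 100"
    by (rule semimartingale_good_integrator[OF filt sub semi, where e = "1 / 100"]) (use that in auto)
  \<comment> \<open>The bound for Q off the two exceptional events. A mean above
    \<open>2 * C\<close> contradicts it as soon as Q is at least half of its mean.\<close>
  define C where "C = K\<^sup>2 + 2 * K * l"
  have C: "0 < C" using K l by (simp add: C_def add_nonneg_pos)
  from unb[of "2 * C"] obtain n where n: "0 < n" "2 * C < (\<Sum>i<n. \<sigma> n i)" by auto
  define D where "D i \<omega> = X (tt n (Suc i)) \<omega> - X (tt n i) \<omega>" for i \<omega>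
  define Q where "Q \<omega> = (\<Sum>i<n. (D i \<omega>)\<^sup>2)" for \<omega>
  have DM [measurable]: "D i \<in> borel_measurable M" for i unfolding D_def using XM tt(1) by simp
  have QM [measurable]: "Q \<in> borel_measurable M" unfolding Q_def by measurable
  have g: "gaussian_rv (\<sigma> n i) (D i)" if "i < n" for i
    using gauss[OF that] by (simp only: D_def[abs_def] tt_def)
  have sg: "0 \<le> \<sigma> n i" if "i < n" for i using g[OF that] by (simp add: gaussian_rv_def)
  note gm = gaussian_rv_moment[OF g]
  have EQ: "expectation Q = (\<Sum>i<n. \<sigma> n i)"
    unfolding Q_def using gm(5,6) by (simp add: Bochner_Integration.integral_sum)
  have iQ: "integrable M Q" unfolding Q_def using gm(5) by (intro Bochner_Integration.integrable_sum) auto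
  have sq4: "((D i \<omega>)\<^sup>2)\<^sup>2 = D i \<omega> ^ 4" for i \<omega> by simp
  have i4: "integrable M (\<lambda>\<omega>. ((D i \<omega>)\<^sup>2)\<^sup>2)" if "i < n" for i
    using gm(1)[OF that, of 4] by simp
  \<comment> \<open>Cauchy-Schwarz and the Gaussian fourth moment treat the mixed terms, whatever
    the dependence between the increments.\<close>
  have cs: "integrable M (\<lambda>\<omega>. (D i \<omega>)\<^sup>2 * (D j \<omega>)\<^sup>2)"
    "expectation (\<lambda>\<omega>. (D i \<omega>)\<^sup>2 * (D j \<omega>)\<^sup>2) \<le> 3 * (\<sigma> n i * \<sigma> n j)" if "i < n" "j < n" for i j
  proof -
    note CS = Cauchy_Schwarz_integral[OF _ _ i4[OF that(1)] i4[OF that(2)]]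
    show "integrable M (\<lambda>\<omega>. (D i \<omega>)\<^sup>2 * (D j \<omega>)\<^sup>2)" using CS(1) by simp
    have "(expectation (\<lambda>\<omega>. (D i \<omega>)\<^sup>2 * (D j \<omega>)\<^sup>2))\<^sup>2 \<le> (3 * (\<sigma> n i)\<^sup>2) * (3 * (\<sigma> n j)\<^sup>2)"
      using CS(2) gm(7)[OF that(1)] gm(7)[OF that(2)] by simp
    also have "\<dots> = (3 * (\<sigma> n i * \<sigma> n j))\<^sup>2" by (simp add: power2_eq_square)
    finally show "expectation (\<lambda>\<omega>. (D i \<omega>)\<^sup>2 * (D j \<omega>)\<^sup>2) \<le> 3 * (\<sigma> n i * \<sigma> n j)"
      by (rule power2_le_imp_le) (use sg that in simp)
  qed
  have Q2: "(\<lambda>\<omega>. (Q \<omega>)\<^sup>2) = (\<lambda>\<omega>. \<Sum>i<n. \<Sum>j<n. (D i \<omega>)\<^sup>2 * (D j \<omega>)\<^sup>2)"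
    by (simp add: Q_def power2_eq_square sum_product)
  have iQ2: "integrable M (\<lambda>\<omega>. (Q \<omega>)\<^sup>2)"
    unfolding Q2 by (intro Bochner_Integration.integrable_sum cs(1)) auto
  have "expectation (\<lambda>\<omega>. (Q \<omega>)\<^sup>2) = (\<Sum>i<n. \<Sum>j<n. expectation (\<lambda>\<omega>. (D i \<omega>)\<^sup>2 * (D j \<omega>)\<^sup>2))"
  proof -
    have "expectation (\<lambda>\<omega>. (Q \<omega>)\<^sup>2) = (\<Sum>i<n. expectation (\<lambda>\<omega>. \<Sum>j<n. (D i \<omega>)\<^sup>2 * (D j \<omega>)\<^sup>2))"
      unfolding Q2 by (intro Bochner_Integration.integral_sum Bochner_Integration.integrable_sum cs(1)) auto
    also have "\<dots> = (\<Sum>i<n. \<Sum>j<n. expectation (\<lambda>\<omega>. (D i \<omega>)\<^sup>2 * (D j \<omega>)\<^sup>2))"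
      by (intro sum.cong refl Bochner_Integration.integral_sum cs(1)) auto
    finally show ?thesis .
  qed
  also have "\<dots> \<le> (\<Sum>i<n. \<Sum>j<n. 3 * (\<sigma> n i * \<sigma> n j))"
    by (intro sum_mono cs(2)) auto
  also have "\<dots> = 3 * (expectation Q)\<^sup>2"
    unfolding EQ power2_eq_square sum_product by (simp only: sum_distrib_left)
  finally have EQ2: "expectation (\<lambda>\<omega>. (Q \<omega>)\<^sup>2) \<le> 3 * (expectation Q)\<^sup>2" .
  have EQpos: "0 < expectation Q" using n(2) C by (simp add: EQ)
  \<comment> \<open>The resulting 1/12 has to beat 1/100 + 1/100, the total probability of the two
    exceptional events.\<close>
  let ?P = "prob {\<omega>\<in>space M. expectation Q / 2 \<le> Q \<omega>}"
  have "(expectation Q)\<^sup>2 \<le> 4 * ?P * expectation (\<lambda>\<omega>. (Q \<omega>)\<^sup>2)"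
    by (rule Paley_Zygmund[OF QM iQ iQ2 EQpos])
  also have "\<dots> \<le> 4 * ?P * (3 * (expectation Q)\<^sup>2)"
    using EQ2 by (intro mult_left_mono) auto
  finally have "1 * (expectation Q)\<^sup>2 \<le> (12 * ?P) * (expectation Q)\<^sup>2" by simp
  then have P12: "1 / 12 \<le> ?P"
    using EQpos by (subst (asm) mult_le_cancel_right_pos) auto
  define H where "H i \<omega> = (if \<bar>X (tt n i) \<omega>\<bar> \<le> K then X (tt n i) \<omega> / K else 0)" for i \<omega>
  have HF: "H i \<in> borel_measurable (F (1 + real i / n))" for i
  proof -
    have [measurable]: "X (tt n i) \<in> borel_measurable (F (1 + real i / n))"
      using XF[OF tt(1), of n i] by (simp only: tt_def)
    show ?thesis unfolding H_def by measurable
  qed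
  have H1: "\<bar>H i \<omega>\<bar> \<le> 1" for i \<omega> using K by (simp add: H_def)
  let ?S = "\<lambda>\<omega>. \<Sum>i<n. H i \<omega> * D i \<omega>"
  have S: "prob {\<omega>\<in>space M. l \<le> \<bar>?S \<omega>\<bar>} \<le> 1 / 100"
    using l(2)[OF n(1) HF H1] by (simp only: D_def tt_def)
  have HM [measurable]: "H i \<in> borel_measurable M" for i
    using measurable_from_subalg[OF sub HF] .
  have "{\<omega>\<in>space M. expectation Q / 2 \<le> Q \<omega>} \<subseteq> {\<omega>\<in>space M. l \<le> \<bar>?S \<omega>\<bar>} \<union> {\<omega>\<in>space M. \<exists>m. K < W m \<omega>}"
  proof (rule subsetI, rule ccontr)
    fix \<omega> assume \<omega>: "\<omega> \<in> {\<omega>\<in>space M. expectation Q / 2 \<le> Q \<omega>}"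
      and no: "\<omega> \<notin> {\<omega>\<in>space M. l \<le> \<bar>?S \<omega>\<bar>} \<union> {\<omega>\<in>space M. \<exists>m. K < W m \<omega>}"
    have Sl: "\<bar>?S \<omega>\<bar> < l" and Wm: "\<And>m. W m \<omega> \<le> K" using \<omega> no by (auto simp: not_le not_less)
    have XK: "\<bar>X (tt n i) \<omega>\<bar> \<le> K" if "i \<le> n" for i
      using Wm[of "prod_encode (n, i)"] that by (simp add: W_def min_absorb1)
    have "Q \<omega> = (\<Sum>i<n. ((X (tt n (Suc i)) \<omega>)\<^sup>2 - (X (tt n i) \<omega>)\<^sup>2) - 2 * K * (H i \<omega> * D i \<omega>))"
      unfolding Q_def
    proof (intro sum.cong refl)
      fix i assume "i \<in> {..<n}"
      then have "K * H i \<omega> = X (tt n i) \<omega>" using XK[of i] K by (simp add: H_def)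
      then have "2 * K * (H i \<omega> * D i \<omega>) = 2 * (X (tt n i) \<omega> * D i \<omega>)" by (metis mult.assoc)
      then show "(D i \<omega>)\<^sup>2 = ((X (tt n (Suc i)) \<omega>)\<^sup>2 - (X (tt n i) \<omega>)\<^sup>2) - 2 * K * (H i \<omega> * D i \<omega>)"
        by (simp add: D_def power2_eq_square algebra_simps)
    qed
    also have "\<dots> = (X (tt n n) \<omega>)\<^sup>2 - (X (tt n 0) \<omega>)\<^sup>2 - 2 * K * ?S \<omega>"
      by (subst sum_subtractf)
         (simp only: sum_distrib_left sum_lessThan_telescope[where f = "\<lambda>i. (X (tt n i) \<omega>)\<^sup>2"])
    also have "\<dots> \<le> K\<^sup>2 + 2 * K * l"
    proof -
      have "(X (tt n n) \<omega>)\<^sup>2 \<le> K\<^sup>2" using XK[of n] by (intro square_le_abs_le) auto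
      moreover have "2 * K * (- ?S \<omega>) \<le> 2 * K * l" using Sl K by (intro mult_left_mono) auto
      ultimately show ?thesis using zero_le_power2[of "X (tt n 0) \<omega>"] by linarith
    qed
    finally have "Q \<omega> \<le> C" by (simp add: C_def)
    then show False using \<omega> n(2) by (simp add: EQ)
  qed
  then have "?P \<le> prob ({\<omega>\<in>space M. l \<le> \<bar>?S \<omega>\<bar>} \<union> {\<omega>\<in>space M. \<exists>m. K < W m \<omega>})"
    using WM by (intro finite_measure_mono) measurable
  also have "\<dots> \<le> prob {\<omega>\<in>space M. l \<le> \<bar>?S \<omega>\<bar>} + prob {\<omega>\<in>space M. \<exists>m. K < W m \<omega>}"
    using WM by (intro measure_Un_le) measurable
  finally show False using P12 S K(2) by linarith
qed

text \<open>For \<open>\<bar>x\<bar>\<close> above L the lost product is at most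
  \<open>\<bar>x\<bar> ^ 3 * \<bar>y\<bar> / L\<^sup>2\<close>. Young's inequality with exponents
  4/3 and 4 turns this into fourth powers, whose Gaussian expectations are explicit.\<close>

lemma young_truncation:
  fixes x y L :: real
  assumes L: "0 < L"
  shows "x * y - (3 / 4 * x ^ 4 + 1 / 4 * y ^ 4) / L\<^sup>2 \<le> (if \<bar>x\<bar> \<le> L then x else 0) * y"
proof (cases "\<bar>x\<bar> \<le> L")
  case True
  then show ?thesis by (simp add: zero_le_even_power)
next
  case False
  have young: "\<bar>x\<bar> ^ 3 * \<bar>y\<bar> \<le> 3 / 4 * x ^ 4 + 1 / 4 * y ^ 4"
  proof -
    let ?a = "\<bar>x\<bar>" and ?b = "\<bar>y\<bar>"
    have "0 \<le> (?a - ?b)\<^sup>2 * (3 * ?a\<^sup>2 + 2 * ?a * ?b + ?b\<^sup>2)" by simp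
    also have "\<dots> = 3 * ?a ^ 4 - 4 * (?a ^ 3 * ?b) + ?b ^ 4"
      by (simp add: power2_eq_square power3_eq_cube power4_eq_xxxx algebra_simps)
    finally show ?thesis by simp
  qed
  have "x * y * L\<^sup>2 \<le> \<bar>x\<bar> * \<bar>y\<bar> * L\<^sup>2"
    using abs_ge_self[of "x * y"] by (intro mult_right_mono) (auto simp: abs_mult)
  also have "\<dots> \<le> \<bar>x\<bar> * \<bar>y\<bar> * \<bar>x\<bar>\<^sup>2"
    using False L by (intro mult_left_mono power_mono) auto
  also have "\<dots> = \<bar>x\<bar> ^ 3 * \<bar>y\<bar>" by (simp add: power2_eq_square power3_eq_cube del: abs_mult_self_eq)
  also note young
  finally show ?thesis using False L by (simp add: pos_le_divide_eq)
qed

text \<open>Here \<open>w n\<close> is the order of the variances and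
  \<open>real n * sqrt (w n)\<close> that of the transform. Each pair of neighbours contributes at
  least a fixed multiple of \<open>sqrt (w n)\<close> to the mean, and the second moment has the
  order of the squared mean, so the transform is large with a probability bounded below.\<close>

lemma not_semimartingale_correlated:
  assumes filt: "filtration (space M) F" and sub: "\<And>t. subalgebra M (F t)"
    and gauss: "\<And>n i. i < n \<Longrightarrow> gaussian_rv (\<sigma> n i) (\<lambda>\<omega>. X (1 + real (Suc i) / real n) \<omega> - X (1 + real i / real n) \<omega>)"
    and bound: "\<And>n i. i < n \<Longrightarrow> \<sigma> n i \<le> w n" and w: "\<And>n. 0 < n \<Longrightarrow> 0 < w n"
    and corr: "\<And>n i. Suc i < n \<Longrightarrow> \<rho> * w n \<le>
      expectation (\<lambda>\<omega>. (X (1 + real (Suc i) / real n) \<omega> - X (1 + real i / real n) \<omega>) *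
        (X (1 + real (Suc (Suc i)) / real n) \<omega> - X (1 + real (Suc i) / real n) \<omega>))" and \<rho>: "0 < \<rho>"
    and unb: "\<And>C. \<exists>n>1. C < real n * sqrt (w n)"
  shows "\<not> semimartingale M F X"
proof
  assume semi: "semimartingale M F X"
  have XF: "X t \<in> borel_measurable (F t)" if "0 \<le> t" for t
    using semi that by (simp add: semimartingale_def adapted_process_def)
  have XM: "X t \<in> borel_measurable M" if "0 \<le> t" for t
    using measurable_from_subalg[OF sub XF[OF that]] .
  define tt where "tt n i = 1 + real i / real n" for n i :: nat
  have tt: "0 \<le> tt n i" "1 \<le> tt n i" for n i by (auto simp: tt_def)
  have tt_mono: "i \<le> j \<Longrightarrow> tt n i \<le> tt n j" for n i j by (auto simp: tt_def divide_right_mono)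
  \<comment> \<open>Truncation at \<open>L = \<kappa> * s\<close> costs at most
    \<open>3 * s ^ 4 / L\<^sup>2\<close>; this \<kappa> makes it half of the covariance bound
    \<open>\<rho> * s\<^sup>2\<close>.\<close>
  define \<kappa> where "\<kappa> = sqrt (6 / \<rho>)"
  have \<kappa>: "0 < \<kappa>" "\<kappa>\<^sup>2 = 6 / \<rho>" using \<rho> by (auto simp: \<kappa>_def)
  \<comment> \<open>Half of the Paley-Zygmund bound for a mean of at least
    \<open>real n * s * \<rho> / (4 * \<kappa>)\<close> and a second moment of at most
    \<open>(real n * s)\<^sup>2\<close>.\<close>
  define e where "e = \<rho>\<^sup>2 / (128 * \<kappa>\<^sup>2)"
  have e: "0 < e" using \<rho> \<kappa>(1) by (simp add: e_def)
  let ?D = "\<lambda>n i \<omega>. X (1 + real (Suc i) / real n) \<omega> - X (1 + real i / real n) \<omega>"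
  obtain l where l: "0 < l"
    "\<And>(n::nat) H. 0 < n \<Longrightarrow> (\<And>i. i < n \<Longrightarrow> H i \<in> borel_measurable (F (1 + real i / n))) \<Longrightarrow>
       (\<And>i \<omega>. i < n \<Longrightarrow> \<omega> \<in> space M \<Longrightarrow> \<bar>H i \<omega>\<bar> \<le> 1) \<Longrightarrow>
       prob {\<omega>\<in>space M. l \<le> \<bar>\<Sum>i<n. H i \<omega> * ?D n i \<omega>\<bar>} \<le> e"
    by (rule semimartingale_good_integrator[OF filt sub semi e]) (use that in auto)
  from unb[of "8 * \<kappa> * l / \<rho>"] obtain n where n: "1 < n" "8 * \<kappa> * l / \<rho> < real n * sqrt (w n)" by auto
  define s where "s = sqrt (w n)"
  have s: "0 < s" "s\<^sup>2 = w n" using w[of n] n by (auto simp: s_def)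
  define L where "L = \<kappa> * s"
  have L: "0 < L" using \<kappa> s by (simp add: L_def)
  define D where "D i \<omega> = X (tt n (Suc i)) \<omega> - X (tt n i) \<omega>" for i \<omega>
  have DM [measurable]: "D i \<in> borel_measurable M" for i unfolding D_def using XM tt(1) by simp
  have g: "gaussian_rv (\<sigma> n i) (D i)" if "i < n" for i
    using gauss[OF that] by (simp only: D_def[abs_def] tt_def)
  have sg: "0 \<le> \<sigma> n i" if "i < n" for i using g[OF that] by (simp add: gaussian_rv_def)
  note gm = gaussian_rv_moment[OF g]
  \<comment> \<open>The preceding increment is known at the left end of the current interval. The
    first interval has no predecessor in the partition and gets weight 0.\<close>
  define H where "H i \<omega> = (case i of 0 \<Rightarrow> 0 | Suc j \<Rightarrow> if \<bar>D j \<omega>\<bar> \<le> L then D j \<omega> / L else 0)" for i \<omega>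
  have DF: "D j \<in> borel_measurable (F (tt n (Suc j)))" for j
  proof -
    have "subalgebra (F (tt n (Suc j))) (F (tt n j))"
      using filt tt_mono[of j "Suc j" n] by (auto simp: filtration_def subalgebra_def)
    from measurable_from_subalg[OF this XF[OF tt(1)]] XF[OF tt(1)]
    show ?thesis unfolding D_def by measurable
  qed
  have HF: "H i \<in> borel_measurable (F (1 + real i / n))" for i
  proof (cases i)
    case (Suc j)
    have [measurable]: "D j \<in> borel_measurable (F (1 + real i / n))"
      using DF[of j] by (simp only: Suc tt_def)
    show ?thesis unfolding H_def Suc nat.case by (simp only: Suc[symmetric]) measurable
  next
    case 0
    then have "H i = (\<lambda>_. 0)" by (simp add: H_def fun_eq_iff)
    then show ?thesis by simp
  qed
  have H1: "\<bar>H i \<omega>\<bar> \<le> 1" for i \<omega> using L by (simp add: H_def split: nat.split)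
  let ?S = "\<lambda>\<omega>. \<Sum>i<n. H i \<omega> * D i \<omega>"
  have S: "prob {\<omega>\<in>space M. l \<le> \<bar>?S \<omega>\<bar>} \<le> e"
    using l(2)[of n H, OF _ HF H1] n by (simp only: D_def tt_def)
  have HM [measurable]: "H i \<in> borel_measurable M" for i
    using measurable_from_subalg[OF sub HF] .
  have iHD: "integrable M (\<lambda>\<omega>. H i \<omega> * D i \<omega>)" if "i < n" for i
    by (rule integrable_bounded_mult[OF gm(3)[OF that] HM H1])
  have EHD: "\<rho> * s / (2 * \<kappa>) \<le> expectation (\<lambda>\<omega>. H (Suc j) \<omega> * D (Suc j) \<omega>)" if j: "Suc j < n" for j
  proof -
    have j': "j < n" using j by simp
    have 4: "expectation (\<lambda>\<omega>. (D i \<omega>) ^ 4) \<le> 3 * s ^ 4" if "i < n" for i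
    proof -
      have "(\<sigma> n i)\<^sup>2 \<le> (s\<^sup>2)\<^sup>2" using bound[OF that] sg[OF that] s(2) by (intro power_mono) auto
      then show ?thesis using gm(7)[OF that] by simp
    qed
    have iDD: "integrable M (\<lambda>\<omega>. D j \<omega> * D (Suc j) \<omega>)"
      by (rule Cauchy_Schwarz_integral(1)[OF DM DM gm(5)[OF j'] gm(5)[OF j]])
    let ?R = "\<lambda>\<omega>. (3 / 4 * D j \<omega> ^ 4 + 1 / 4 * D (Suc j) \<omega> ^ 4) / L\<^sup>2"
    have iR: "integrable M ?R" using gm(1)[OF j', of 4] gm(1)[OF j, of 4] by simp
    have "expectation ?R = (3 / 4 * expectation (\<lambda>\<omega>. D j \<omega> ^ 4) + 1 / 4 * expectation (\<lambda>\<omega>. D (Suc j) \<omega> ^ 4)) / L\<^sup>2"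
      using gm(1)[OF j', of 4] gm(1)[OF j, of 4] by simp
    also have "\<dots> \<le> (3 / 4 * (3 * s ^ 4) + 1 / 4 * (3 * s ^ 4)) / L\<^sup>2"
      by (intro divide_right_mono add_mono mult_left_mono 4 j j') auto
    also have "\<dots> = \<rho> * s\<^sup>2 / 2"
      using s \<kappa> \<rho> by (simp add: L_def power_mult_distrib power4_eq_xxxx power2_eq_square)
    finally have R: "expectation ?R \<le> \<rho> * s\<^sup>2 / 2" .
    have "\<rho> * s\<^sup>2 \<le> expectation (\<lambda>\<omega>. D j \<omega> * D (Suc j) \<omega>)"
      using corr[OF j] by (simp only: D_def tt_def s)
    then have "\<rho> * s\<^sup>2 / 2 \<le> expectation (\<lambda>\<omega>. D j \<omega> * D (Suc j) \<omega> - ?R \<omega>)"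
      using R iDD iR by simp
    also have "\<dots> \<le> expectation (\<lambda>\<omega>. L * (H (Suc j) \<omega> * D (Suc j) \<omega>))"
    proof (rule integral_mono)
      fix \<omega>
      show "D j \<omega> * D (Suc j) \<omega> - ?R \<omega> \<le> L * (H (Suc j) \<omega> * D (Suc j) \<omega>)"
        using young_truncation[OF L, of "D j \<omega>" "D (Suc j) \<omega>"] L by (simp add: H_def split: if_splits)
    qed (use iDD iR iHD[OF j] in auto)
    also have "\<dots> = L * expectation (\<lambda>\<omega>. H (Suc j) \<omega> * D (Suc j) \<omega>)" by simp
    finally have "\<rho> * s\<^sup>2 / 2 / L \<le> expectation (\<lambda>\<omega>. H (Suc j) \<omega> * D (Suc j) \<omega>)"
      using L by (simp add: pos_divide_le_eq mult.commute)
    also have "\<rho> * s\<^sup>2 / 2 / L = \<rho> * s / (2 * \<kappa>)" using s \<kappa> by (simp add: L_def power2_eq_square field_simps)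
    finally show ?thesis .
  qed
  have iS: "integrable M ?S" by (intro Bochner_Integration.integrable_sum iHD) simp
  have "expectation ?S = (\<Sum>i<n. expectation (\<lambda>\<omega>. H i \<omega> * D i \<omega>))"
    by (intro Bochner_Integration.integral_sum iHD) simp
  also have "\<dots> = (\<Sum>i<Suc (n - 1). expectation (\<lambda>\<omega>. H i \<omega> * D i \<omega>))" using n by simp
  also have "\<dots> = (\<Sum>j<n - 1. expectation (\<lambda>\<omega>. H (Suc j) \<omega> * D (Suc j) \<omega>))"
    by (subst sum.lessThan_Suc_shift) (simp add: H_def)
  also have "\<dots> \<ge> (\<Sum>j<n - 1. \<rho> * s / (2 * \<kappa>))" by (intro sum_mono EHD) auto
  finally have "real (n - 1) * (\<rho> * s / (2 * \<kappa>)) \<le> expectation ?S" by simp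
  moreover have "real n / 2 * (\<rho> * s / (2 * \<kappa>)) \<le> real (n - 1) * (\<rho> * s / (2 * \<kappa>))"
    using n \<rho> s \<kappa> by (intro mult_right_mono) auto
  ultimately have ES: "real n * s * \<rho> / (4 * \<kappa>) \<le> expectation ?S" by (simp add: field_simps)
  have big: "2 * l < real n * s * \<rho> / (4 * \<kappa>)"
    using n(2) \<rho> \<kappa> by (simp add: s_def field_simps)
  have ESpos: "0 < expectation ?S" using ES big l(1) by linarith
  \<comment> \<open>A crude bound is enough because the mean already has the full order
    \<open>real n * s\<close>.\<close>
  have S2: "(?S \<omega>)\<^sup>2 \<le> real n * (\<Sum>i<n. (D i \<omega>)\<^sup>2)" for \<omega>
  proof -
    have "(?S \<omega>)\<^sup>2 \<le> (\<Sum>i<n. 1\<^sup>2) * (\<Sum>i<n. (H i \<omega> * D i \<omega>)\<^sup>2)"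
      using Cauchy_Schwarz_ineq_sum[of "\<lambda>_. 1" "\<lambda>i. H i \<omega> * D i \<omega>" "{..<n}"] by simp
    also have "\<dots> \<le> real n * (\<Sum>i<n. (D i \<omega>)\<^sup>2)"
    proof -
      have "(H i \<omega> * D i \<omega>)\<^sup>2 \<le> (D i \<omega>)\<^sup>2" for i
        using square_le_abs_le[OF H1, of i \<omega>] by (simp add: power_mult_distrib mult_left_le_one_le)
      then have "(\<Sum>i<n. (H i \<omega> * D i \<omega>)\<^sup>2) \<le> (\<Sum>i<n. (D i \<omega>)\<^sup>2)" by (intro sum_mono)
      then show ?thesis by (simp add: mult_left_mono)
    qed
    finally show ?thesis .
  qed
  have iB: "integrable M (\<lambda>\<omega>. real n * (\<Sum>i<n. (D i \<omega>)\<^sup>2))"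
    using gm(5) by (intro integrable_mult_right Bochner_Integration.integrable_sum) auto
  have SM [measurable]: "?S \<in> borel_measurable M" by measurable
  have iS2: "integrable M (\<lambda>\<omega>. (?S \<omega>)\<^sup>2)"
  proof (rule Bochner_Integration.integrable_bound[OF iB])
    show "AE \<omega> in M. norm ((?S \<omega>)\<^sup>2) \<le> norm (real n * (\<Sum>i<n. (D i \<omega>)\<^sup>2))"
      by (intro AE_I2) (unfold real_norm_def abs_power2, rule order_trans[OF S2 abs_ge_self])
  qed measurable
  have "expectation (\<lambda>\<omega>. (?S \<omega>)\<^sup>2) \<le> expectation (\<lambda>\<omega>. real n * (\<Sum>i<n. (D i \<omega>)\<^sup>2))"
    by (intro integral_mono iS2 iB S2)
  also have "\<dots> = real n * (\<Sum>i<n. \<sigma> n i)"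
    using gm(5,6) by (simp add: Bochner_Integration.integral_sum)
  also have "\<dots> \<le> real n * (\<Sum>i<n. s\<^sup>2)"
    unfolding s(2) by (intro mult_left_mono sum_mono bound) auto
  also have "\<dots> = (real n * s)\<^sup>2" by (simp add: power2_eq_square)
  finally have ES2: "expectation (\<lambda>\<omega>. (?S \<omega>)\<^sup>2) \<le> (real n * s)\<^sup>2" .
  let ?P = "prob {\<omega>\<in>space M. expectation ?S / 2 \<le> ?S \<omega>}"
  have "(real n * s * \<rho> / (4 * \<kappa>))\<^sup>2 \<le> (expectation ?S)\<^sup>2"
    using ES big l(1) by (intro power_mono) auto
  also have "\<dots> \<le> 4 * ?P * expectation (\<lambda>\<omega>. (?S \<omega>)\<^sup>2)"
    by (rule Paley_Zygmund[OF SM iS iS2 ESpos])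
  also have "\<dots> \<le> 4 * ?P * (real n * s)\<^sup>2"
    using ES2 by (intro mult_left_mono) auto
  finally have "(\<rho>\<^sup>2 / (16 * \<kappa>\<^sup>2)) * (real n * s)\<^sup>2 \<le> 4 * ?P * (real n * s)\<^sup>2"
    by (simp add: power_mult_distrib power_divide mult_ac)
  then have "\<rho>\<^sup>2 / (16 * \<kappa>\<^sup>2) \<le> 4 * ?P"
    using n s by (subst (asm) mult_le_cancel_right_pos) auto
  then have P: "2 * e \<le> ?P" by (simp add: e_def)
  have "?P \<le> prob {\<omega>\<in>space M. l \<le> \<bar>?S \<omega>\<bar>}"
  proof (rule finite_measure_mono)
    show "{\<omega>\<in>space M. expectation ?S / 2 \<le> ?S \<omega>} \<subseteq> {\<omega>\<in>space M. l \<le> \<bar>?S \<omega>\<bar>}"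
      using ES big by auto
  qed measurable
  then show False using P S e by linarith
qed

end

subsection \<open>Estimates for the kernels\<close>

lemma power2_powr: "(x powr a)\<^sup>2 = (x :: real) powr (2 * a)"
  by (simp add: power2_eq_square flip: powr_add)

lemma powr_mean_value:
  fixes x y a :: real
  assumes "0 < x" "x < y"
  obtains \<xi> where "x < \<xi>" "\<xi> < y" "y powr a - x powr a = (y - x) * (a * \<xi> powr (a - 1))"
proof -
  have "\<exists>z>x. z < y \<and> y powr a - x powr a = (y - x) * (a * z powr (a - 1))"
  proof (rule MVT2[OF assms(2)])
    fix z assume "x \<le> z"
    then show "((\<lambda>z. z powr a) has_real_derivative a * z powr (a - 1)) (at z)"
      using assms(1) by (auto intro!: derivative_eq_intros)
  qed
  then show thesis using that by blast
qed

text \<open>The truncated power of the kernel. As \<open>0 powr a = 0\<close>, it vanishes on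
  \<open>x \<le> 0\<close> for every exponent, also for \<open>a \<le> 0\<close>, where it is
  discontinuous at 0.\<close>

definition ppow :: "real \<Rightarrow> real \<Rightarrow> real" where
  "ppow a x = max x 0 powr a"

text \<open>The exponent \<open>a - 1\<close> is that of the Riemann-Liouville integral of order a.
  For \<open>a = \<alpha>\<close> this is \<open>gfbm_Psi\<close> up to a factor; the order is a
  parameter because errors are measured by the kernel of a smaller order.\<close>

definition rl_kernel :: "real \<Rightarrow> real \<Rightarrow> real \<Rightarrow> real \<Rightarrow> real" where
  "rl_kernel a \<gamma> t u = ppow (a - 1) (t - u) * \<bar>u\<bar> powr (- \<gamma> / 2)"

lemma ppow_simps [simp]: "0 < x \<Longrightarrow> ppow a x = x powr a" "x \<le> 0 \<Longrightarrow> ppow a x = 0"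
  by (auto simp: ppow_def max_def)

lemma ppow_nonneg [simp]: "0 \<le> ppow a x"
  by (simp add: ppow_def)

lemma measurable_ppow [measurable]: "ppow a \<in> borel_measurable borel"
  unfolding ppow_def by measurable

lemma ppow_mono: "0 \<le> a \<Longrightarrow> x \<le> y \<Longrightarrow> ppow a x \<le> ppow a y"
  unfolding ppow_def by (intro powr_mono2) auto

lemma ppow_scale: "0 < h \<Longrightarrow> ppow a (h * x) = h powr a * ppow a x"
  by (cases "0 < x") (auto simp: powr_mult mult_le_0_iff not_less)

lemma gfbm_kernel_ppow:
  "gfbm_kernel \<alpha> \<gamma> t u = (ppow \<alpha> (t - u) - ppow \<alpha> (- u)) * \<bar>u\<bar> powr (- \<gamma> / 2)"
  by (simp add: gfbm_kernel_def ppow_def)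

lemma gfbm_kernel_diff:
  "gfbm_kernel \<alpha> \<gamma> t u - gfbm_kernel \<alpha> \<gamma> s u = (ppow \<alpha> (t - u) - ppow \<alpha> (s - u)) * \<bar>u\<bar> powr (- \<gamma> / 2)"
  by (simp add: gfbm_kernel_ppow algebra_simps)

lemma gfbm_Psi_rl_kernel: "gfbm_Psi \<alpha> \<gamma> t u = \<alpha> * rl_kernel \<alpha> \<gamma> t u"
  by (simp add: gfbm_Psi_def rl_kernel_def)

lemma measurable_kernels [measurable]:
  "gfbm_kernel \<alpha> \<gamma> t \<in> borel_measurable borel" "rl_kernel a \<gamma> t \<in> borel_measurable borel"
  unfolding gfbm_kernel_ppow[abs_def] rl_kernel_def[abs_def] by measurable

lemma nn_integral_reflect:
  fixes f :: "real \<Rightarrow> ennreal"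
  assumes "f \<in> borel_measurable borel"
  shows "(\<integral>\<^sup>+ u. f (t - u) \<partial>lborel) = (\<integral>\<^sup>+ u. f u \<partial>lborel)"
  using nn_integral_real_affine[OF assms, of "- 1" t] by simp

lemma nn_integral_powr_from_0:
  assumes "-1 < a" "0 \<le> c"
  shows "(\<integral>\<^sup>+ u. ennreal (u powr a) * indicator {0..c} u \<partial>lborel) = ennreal (c powr (a + 1) / (a + 1))"
  by (rule nn_integral_has_integral_lebesgue'[OF _ has_integral_powr_from_0[OF assms]]) simp

lemma nn_integral_powr_to_inf:
  assumes "a < -1" "0 < c"
  shows "(\<integral>\<^sup>+ u. ennreal (u powr a) * indicator {c..} u \<partial>lborel) = ennreal (- (c powr (a + 1)) / (a + 1))"
  by (rule nn_integral_has_integral_lebesgue'[OF _ has_integral_powr_to_inf[OF assms]]) simp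

lemma powr_neg_le_const:
  assumes "c \<le> x" "0 < c" "a \<le> 0"
  shows "x powr a \<le> c powr (a::real)"
  using assms by (intro powr_mono2') auto

lemma half_powr_le:
  assumes "- 1 \<le> a"
  shows "(1 / 2) powr a \<le> (2::real)"
proof -
  have "(1 / 2) powr a = 2 powr (- a)" by (simp add: powr_divide powr_minus_divide)
  also have "\<dots> \<le> 2 powr 1" using assms by (intro powr_mono) auto
  finally show ?thesis by simp
qed

lemma rl_kernel_square:
  "(rl_kernel a \<gamma> t u)\<^sup>2 = ppow (2 * a - 2) (t - u) * \<bar>u\<bar> powr (- \<gamma>)"
  by (simp add: rl_kernel_def power_mult_distrib power2_powr ppow_def algebra_simps)

text \<open>The square behaves like a power with exponent \<open>- \<gamma>\<close> at 0,
  \<open>2 * a - 2\<close> at 1, and \<open>2 * a - 2 - \<gamma>\<close> at minus infinity. The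
  hypotheses put the first two above -1 and the third below -1.\<close>

lemma rl_kernel_norm_finite:
  assumes \<gamma>: "0 < \<gamma>" "\<gamma> < 1" and a: "1 / 2 < a" "a < (1 + \<gamma>) / 2"
  shows "(\<integral>\<^sup>+ u. ennreal ((rl_kernel a \<gamma> 1 u)\<^sup>2) \<partial>lborel) < \<infinity>"
proof -
  define g0 where "g0 u = ennreal (u powr (- \<gamma>)) * indicator {0..1/2} u" for u :: real
  define g1 where "g1 u = ennreal (u powr (2 * a - 2)) * indicator {0..1/2} u" for u :: real
  define g2 where "g2 u = ennreal (u powr (2 * a - 2 - \<gamma>)) * indicator {1/2..} u" for u :: real
  have [measurable]: "g0 \<in> borel_measurable borel" "g1 \<in> borel_measurable borel" "g2 \<in> borel_measurable borel"
    unfolding g0_def g1_def g2_def by measurable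
  have fin: "(\<integral>\<^sup>+ u. g0 u \<partial>lborel) < \<infinity>" "(\<integral>\<^sup>+ u. g1 u \<partial>lborel) < \<infinity>" "(\<integral>\<^sup>+ u. g2 u \<partial>lborel) < \<infinity>"
    unfolding g0_def g1_def g2_def using \<gamma> a
    by (subst nn_integral_powr_from_0 nn_integral_powr_to_inf; simp)+
  have le: "ennreal ((rl_kernel a \<gamma> 1 u)\<^sup>2) \<le> 2 * g0 u + (2 * g0 (0 - u) + (2 * g1 (1 - u) + g2 (0 - u)))" for u
  proof -
    consider "1 \<le> u" | "1 / 2 < u" "u < 1" | "0 < u" "u \<le> 1 / 2" | "u = 0" | "- (1 / 2) \<le> u" "u < 0" | "u < - (1 / 2)"
      by linarith
    then show ?thesis
    proof cases
      case 1
      then show ?thesis by (simp add: rl_kernel_def)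
    next
      case 2
      have "u powr (- \<gamma>) \<le> (1 / 2) powr (- \<gamma>)" using 2 \<gamma> by (intro powr_neg_le_const) auto
      also have "\<dots> \<le> 2" using \<gamma> by (intro half_powr_le) auto
      finally have "(rl_kernel a \<gamma> 1 u)\<^sup>2 \<le> (1 - u) powr (2 * a - 2) * 2"
        using 2 unfolding rl_kernel_square by (simp add: mult_left_mono)
      then have "ennreal ((rl_kernel a \<gamma> 1 u)\<^sup>2) \<le> 2 * g1 (1 - u)"
        using 2 by (simp add: g1_def ennreal_leI mult.commute flip: ennreal_mult' ennreal_numeral)
      also have "\<dots> \<le> 2 * g0 u + (2 * g0 (0 - u) + (2 * g1 (1 - u) + g2 (0 - u)))"
        by (intro add_increasing add_increasing2) auto
      finally show ?thesis .
    next
      case 3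
      have "(1 - u) powr (2 * a - 2) \<le> (1 / 2) powr (2 * a - 2)" using 3 a \<gamma> by (intro powr_neg_le_const) auto
      also have "\<dots> \<le> 2" using a by (intro half_powr_le) auto
      finally have "(rl_kernel a \<gamma> 1 u)\<^sup>2 \<le> 2 * u powr (- \<gamma>)"
        using 3 unfolding rl_kernel_square by (simp add: mult_right_mono)
      then have "ennreal ((rl_kernel a \<gamma> 1 u)\<^sup>2) \<le> 2 * g0 u"
        using 3 by (simp add: g0_def ennreal_leI flip: ennreal_mult' ennreal_numeral)
      also have "\<dots> \<le> 2 * g0 u + (2 * g0 (0 - u) + (2 * g1 (1 - u) + g2 (0 - u)))"
        by (intro add_increasing2) auto
      finally show ?thesis .
    next
      case 4
      then show ?thesis by (simp add: rl_kernel_def)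
    next
      case 5
      have "(1 - u) powr (2 * a - 2) \<le> (1 / 2) powr (2 * a - 2)" using 5 a \<gamma> by (intro powr_neg_le_const) auto
      also have "\<dots> \<le> 2" using a by (intro half_powr_le) auto
      finally have "(rl_kernel a \<gamma> 1 u)\<^sup>2 \<le> 2 * (- u) powr (- \<gamma>)"
        using 5 unfolding rl_kernel_square by (simp add: mult_right_mono)
      then have "ennreal ((rl_kernel a \<gamma> 1 u)\<^sup>2) \<le> 2 * g0 (0 - u)"
        using 5 by (simp add: g0_def ennreal_leI flip: ennreal_mult' ennreal_numeral)
      also have "\<dots> \<le> 2 * g0 u + (2 * g0 (0 - u) + (2 * g1 (1 - u) + g2 (0 - u)))"
        by (intro add_increasing add_increasing2) auto
      finally show ?thesis .
    next
      case 6
      have "(1 - u) powr (2 * a - 2) \<le> (- u) powr (2 * a - 2)" using 6 a \<gamma> by (intro powr_mono2') auto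
      then have "(rl_kernel a \<gamma> 1 u)\<^sup>2 \<le> (- u) powr (2 * a - 2) * (- u) powr (- \<gamma>)"
        using 6 unfolding rl_kernel_square by (simp add: mult_right_mono)
      also have "\<dots> = (- u) powr (2 * a - 2 - \<gamma>)" by (simp flip: powr_add)
      finally have "ennreal ((rl_kernel a \<gamma> 1 u)\<^sup>2) \<le> g2 (0 - u)"
        using 6 by (simp add: g2_def ennreal_leI)
      also have "\<dots> \<le> 2 * g0 u + (2 * g0 (0 - u) + (2 * g1 (1 - u) + g2 (0 - u)))"
        by (intro add_increasing) auto
      finally show ?thesis .
    qed
  qed
  have "(\<integral>\<^sup>+ u. ennreal ((rl_kernel a \<gamma> 1 u)\<^sup>2) \<partial>lborel)
     \<le> (\<integral>\<^sup>+ u. 2 * g0 u + (2 * g0 (0 - u) + (2 * g1 (1 - u) + g2 (0 - u))) \<partial>lborel)"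
    by (intro nn_integral_mono le)
  also have "\<dots> = 2 * (\<integral>\<^sup>+ u. g0 u \<partial>lborel) + (2 * (\<integral>\<^sup>+ u. g0 (0 - u) \<partial>lborel) +
     (2 * (\<integral>\<^sup>+ u. g1 (1 - u) \<partial>lborel) + (\<integral>\<^sup>+ u. g2 (0 - u) \<partial>lborel)))"
    by (simp add: nn_integral_add nn_integral_cmult)
  also have "\<dots> < \<infinity>"
    using fin nn_integral_reflect[of g0 0] nn_integral_reflect[of g1 1] nn_integral_reflect[of g2 0]
    by (simp add: ennreal_mult_less_top)
  finally show ?thesis .
qed

text \<open>The substitution of \<open>t * u\<close> for u: the squared kernel is homogeneous of
  degree \<open>2 * a - 2 - \<gamma>\<close> in t and u together, and the measure adds 1.\<close>

lemma rl_kernel_norm: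
  assumes \<gamma>: "0 < \<gamma>" "\<gamma> < 1" and a: "1 / 2 < a" "a < (1 + \<gamma>) / 2"
  obtains K where "0 \<le> K"
    "\<And>t. 0 < t \<Longrightarrow> (\<integral>\<^sup>+ u. ennreal ((rl_kernel a \<gamma> t u)\<^sup>2) \<partial>lborel) = ennreal (K * t powr (2 * a - 1 - \<gamma>))"
proof -
  obtain K where K: "0 \<le> K" "(\<integral>\<^sup>+ u. ennreal ((rl_kernel a \<gamma> 1 u)\<^sup>2) \<partial>lborel) = ennreal K"
    using rl_kernel_norm_finite[OF assms] by (auto simp: less_top_ennreal)
  have "(\<integral>\<^sup>+ u. ennreal ((rl_kernel a \<gamma> t u)\<^sup>2) \<partial>lborel) = ennreal (K * t powr (2 * a - 1 - \<gamma>))" if t: "0 < t" for t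
  proof -
    have sc: "(rl_kernel a \<gamma> t (0 + t * u))\<^sup>2 = t powr (2 * a - 2 - \<gamma>) * (rl_kernel a \<gamma> 1 u)\<^sup>2" for u
    proof -
      have "ppow (2 * a - 2) (t - t * u) = t powr (2 * a - 2) * ppow (2 * a - 2) (1 - u)"
        using ppow_scale[OF t, of "2 * a - 2" "1 - u"] by (simp add: algebra_simps)
      moreover have "\<bar>t * u\<bar> powr (- \<gamma>) = t powr (- \<gamma>) * \<bar>u\<bar> powr (- \<gamma>)"
        using t by (simp add: abs_mult powr_mult)
      moreover have "t powr (2 * a - 2 - \<gamma>) = t powr (2 * a - 2) * t powr (- \<gamma>)" by (simp flip: powr_add)
      ultimately show ?thesis by (simp add: rl_kernel_square)
    qed
    have "(\<integral>\<^sup>+ u. ennreal ((rl_kernel a \<gamma> t u)\<^sup>2) \<partial>lborel)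
        = ennreal \<bar>t\<bar> * (\<integral>\<^sup>+ u. ennreal ((rl_kernel a \<gamma> t (0 + t * u))\<^sup>2) \<partial>lborel)"
      by (rule nn_integral_real_affine) (use t in auto)
    also have "\<dots> = ennreal t * (ennreal (t powr (2 * a - 2 - \<gamma>)) * ennreal K)"
      unfolding sc using t by (simp add: ennreal_mult' nn_integral_cmult K(2))
    also have "\<dots> = ennreal (K * (t powr 1 * t powr (2 * a - 2 - \<gamma>)))"
      using t K(1) by (simp add: mult_ac flip: ennreal_mult')
    also have "t powr 1 * t powr (2 * a - 2 - \<gamma>) = t powr (2 * a - 1 - \<gamma>)"
      by (subst powr_add[symmetric]) (simp add: algebra_simps)
    finally show ?thesis .
  qed
  with K(1) show thesis by (rule that)
qed

lemma powr_split_le: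
  fixes h w :: real
  assumes "0 < h" "h \<le> w" "0 \<le> \<theta>"
  shows "h powr \<theta> * w powr a \<le> w powr (a + \<theta>)"
proof -
  have "h powr \<theta> \<le> w powr \<theta>" using assms by (intro powr_mono2) auto
  then have "h powr \<theta> * w powr a \<le> w powr \<theta> * w powr a" by (intro mult_right_mono) auto
  then show ?thesis by (simp add: add.commute flip: powr_add)
qed

text \<open>For \<open>w \<le> 3 * h\<close> every term is at most a power of w, and
  \<open>w powr (1 + \<theta>)\<close> is at most 9 times that of h; together with 4 this gives 36.
  For larger w two applications of the mean value theorem give at most
  \<open>18 * h\<^sup>2 * w powr (\<alpha> - 2)\<close>, and the factor
  \<open>h powr (1 - \<theta>)\<close> is traded for a power of w. The right side then involves the
  kernel of order \<open>\<alpha> - \<theta>\<close>.\<close>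

lemma ppow_second_difference:
  assumes \<alpha>: "0 < \<alpha>" "\<alpha> < 1" and \<theta>: "0 < \<theta>" "\<theta> < 1" and h: "0 < h"
  shows "\<bar>ppow \<alpha> w - 2 * ppow \<alpha> (w - h) + ppow \<alpha> (w - 2 * h)\<bar> \<le> 36 * h powr (1 + \<theta>) * ppow (\<alpha> - \<theta> - 1) w"
proof -
  consider "w \<le> 0" | "0 < w" "w \<le> 3 * h" | "3 * h < w" by linarith
  then show ?thesis
  proof cases
    case 1
    then show ?thesis using h by simp
  next
    case 2
    have m: "ppow \<alpha> (w - h) \<le> ppow \<alpha> w" "ppow \<alpha> (w - 2 * h) \<le> ppow \<alpha> w"
      using \<alpha> h by (auto intro!: ppow_mono)
    have "\<bar>ppow \<alpha> w - 2 * ppow \<alpha> (w - h) + ppow \<alpha> (w - 2 * h)\<bar> \<le> 4 * ppow \<alpha> w"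
      using m ppow_nonneg[of \<alpha> w] ppow_nonneg[of \<alpha> "w - h"] ppow_nonneg[of \<alpha> "w - 2 * h"] by linarith
    also have "\<dots> = 4 * (w powr (1 + \<theta>) * w powr (\<alpha> - \<theta> - 1))"
      using 2 by (simp flip: powr_add)
    also have "\<dots> \<le> 4 * ((3 * h) powr (1 + \<theta>) * w powr (\<alpha> - \<theta> - 1))"
      using 2 \<theta> by (intro mult_left_mono mult_right_mono powr_mono2) auto
    also have "\<dots> = 4 * 3 powr (1 + \<theta>) * h powr (1 + \<theta>) * w powr (\<alpha> - \<theta> - 1)"
      using h by (simp add: powr_mult)
    also have "\<dots> \<le> 4 * 3 powr 2 * h powr (1 + \<theta>) * w powr (\<alpha> - \<theta> - 1)"
      using \<theta> by (intro mult_right_mono mult_left_mono powr_mono) auto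
    finally show ?thesis using 2 by simp
  next
    case 3
    define x where "x = w - 2 * h"
    have x: "0 < x" "w / 3 \<le> x" "w = x + 2 * h" "w - h = x + h" using 3 h by (auto simp: x_def)
    obtain \<xi> where \<xi>: "x + h < \<xi>" "\<xi> < x + 2 * h" "(x + 2 * h) powr \<alpha> - (x + h) powr \<alpha> = h * (\<alpha> * \<xi> powr (\<alpha> - 1))"
      by (rule powr_mean_value[of "x + h" "x + 2 * h" \<alpha>]) (use x h in auto)
    obtain \<eta> where \<eta>: "x < \<eta>" "\<eta> < x + h" "(x + h) powr \<alpha> - x powr \<alpha> = h * (\<alpha> * \<eta> powr (\<alpha> - 1))"
      by (rule powr_mean_value[of x "x + h" \<alpha>]) (use x h in auto)
    obtain \<zeta> where \<zeta>: "\<eta> < \<zeta>" "\<zeta> < \<xi>" "\<xi> powr (\<alpha> - 1) - \<eta> powr (\<alpha> - 1) = (\<xi> - \<eta>) * ((\<alpha> - 1) * \<zeta> powr (\<alpha> - 1 - 1))"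
      by (rule powr_mean_value[of \<eta> \<xi> "\<alpha> - 1"]) (use x h \<xi> \<eta> in auto)
    have z: "\<zeta> powr (\<alpha> - 2) \<le> 9 * w powr (\<alpha> - 2)"
    proof -
      have "\<zeta> powr (\<alpha> - 2) \<le> (w / 3) powr (\<alpha> - 2)" using \<zeta> \<eta> x \<alpha> 3 h by (intro powr_neg_le_const) auto
      also have "\<dots> = 3 powr (2 - \<alpha>) * w powr (\<alpha> - 2)"
      proof -
        have "(w / 3) powr (\<alpha> - 2) = (1 / 3) powr (\<alpha> - 2) * w powr (\<alpha> - 2)"
          using powr_mult[of "1 / 3" w "\<alpha> - 2"] by simp
        also have "(1 / 3) powr (\<alpha> - 2) = 3 powr (- (\<alpha> - 2))"
            using powr_minus_divide[of 3 "\<alpha> - 2"] by (simp add: powr_divide)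
        finally show ?thesis by simp
      qed
      also have "\<dots> \<le> 3 powr 2 * w powr (\<alpha> - 2)" using \<alpha> by (intro mult_right_mono powr_mono) auto
      finally show ?thesis by simp
    qed
    have "ppow \<alpha> w - 2 * ppow \<alpha> (w - h) + ppow \<alpha> (w - 2 * h) = ((x + 2 * h) powr \<alpha> - (x + h) powr \<alpha>) - ((x + h) powr \<alpha> - x powr \<alpha>)"
      using x h by (simp add: x_def[symmetric] add.commute)
    also have "\<dots> = h * \<alpha> * (\<xi> powr (\<alpha> - 1) - \<eta> powr (\<alpha> - 1))"
      unfolding \<xi>(3) \<eta>(3) by (simp add: algebra_simps)
    also have "\<bar>\<dots>\<bar> = h * \<alpha> * ((\<xi> - \<eta>) * ((1 - \<alpha>) * \<zeta> powr (\<alpha> - 2)))"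
      unfolding \<zeta>(3) using h \<alpha> \<zeta> by (simp add: abs_mult)
    also have "\<dots> \<le> h * 1 * ((2 * h) * (1 * (9 * w powr (\<alpha> - 2))))"
      using h \<alpha> \<xi> \<eta> \<zeta> z by (intro mult_mono mult_nonneg_nonneg) auto
    also have "\<dots> = 18 * (h powr (1 + \<theta>) * (h powr (1 - \<theta>) * w powr (\<alpha> - 2)))"
    proof -
      have "h powr (1 + \<theta>) * h powr (1 - \<theta>) = h * h"
        using h powr_add[of h 1 1] by (simp flip: powr_add)
      then show ?thesis by (simp add: mult.assoc[symmetric])
    qed
    also have "\<dots> \<le> 18 * (h powr (1 + \<theta>) * w powr (\<alpha> - 2 + (1 - \<theta>)))"
      using h 3 \<theta> by (intro mult_left_mono powr_split_le) auto
    also have "\<dots> \<le> 36 * h powr (1 + \<theta>) * w powr (\<alpha> - \<theta> - 1)"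
      by (simp add: algebra_simps)
    finally show ?thesis using 3 h by simp
  qed
qed

text \<open>Two terms on the right because there are two singularities: for v in (-h,0] only the
  power at \<open>v + h\<close> is nonzero, for positive v the derivative at v dominates. As above,
  the power of h gained costs a lower order of the kernel.\<close>

lemma ppow_difference_quotient:
  assumes \<alpha>: "0 < \<alpha>" "\<alpha> < 1" and \<theta>: "0 < \<theta>" "\<theta> < 1" and h: "0 < h"
  shows "\<bar>(ppow \<alpha> (v + h) - ppow \<alpha> v) / h - \<alpha> * ppow (\<alpha> - 1) v\<bar>
    \<le> h powr \<theta> * ppow (\<alpha> - \<theta> - 1) (v + h) + h powr \<theta> * ppow (\<alpha> - \<theta> - 1) v"
proof -
  consider "v \<le> - h" | "- h < v" "v \<le> 0" | "0 < v" by linarith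
  then show ?thesis
  proof cases
    case 1
    then show ?thesis using h by simp
  next
    case 2
    define x where "x = v + h"
    have x: "0 < x" "x \<le> h" using 2 by (auto simp: x_def)
    have "x powr \<alpha> = x powr (1 + \<theta>) * x powr (\<alpha> - \<theta> - 1)" by (simp flip: powr_add)
    also have "\<dots> \<le> h powr (1 + \<theta>) * x powr (\<alpha> - \<theta> - 1)"
      using x \<theta> by (intro mult_right_mono powr_mono2) auto
    also have "\<dots> = h * (h powr \<theta> * x powr (\<alpha> - \<theta> - 1))" using h by (simp add: powr_add)
    finally have "x powr \<alpha> / h \<le> h powr \<theta> * x powr (\<alpha> - \<theta> - 1)"
      using h by (simp add: pos_divide_le_eq mult.commute)
    then show ?thesis using 2 x h by (simp add: x_def)
  next
    case 3
    obtain \<xi> where \<xi>: "v < \<xi>" "\<xi> < v + h" "(v + h) powr \<alpha> - v powr \<alpha> = (v + h - v) * (\<alpha> * \<xi> powr (\<alpha> - 1))"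
      by (rule powr_mean_value[of v "v + h" \<alpha>]) (use 3 h in auto)
    have eq: "(ppow \<alpha> (v + h) - ppow \<alpha> v) / h - \<alpha> * ppow (\<alpha> - 1) v = - (\<alpha> * (v powr (\<alpha> - 1) - \<xi> powr (\<alpha> - 1)))"
      using 3 h \<xi> by (simp add: algebra_simps)
    have le: "\<xi> powr (\<alpha> - 1) \<le> v powr (\<alpha> - 1)" using \<xi> 3 \<alpha> by (intro powr_mono2') auto
    have "v powr (\<alpha> - 1) - \<xi> powr (\<alpha> - 1) \<le> h powr \<theta> * v powr (\<alpha> - \<theta> - 1)"
    proof (cases "v \<le> h")
      case True
      have "v powr (\<alpha> - 1) = v powr \<theta> * v powr (\<alpha> - \<theta> - 1)" by (simp flip: powr_add)
      also have "\<dots> \<le> h powr \<theta> * v powr (\<alpha> - \<theta> - 1)"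
        using True 3 \<theta> by (intro mult_right_mono powr_mono2) auto
      finally show ?thesis using powr_ge_zero[of \<xi> "\<alpha> - 1"] by linarith
    next
      case False
      obtain \<zeta> where \<zeta>: "v < \<zeta>" "\<zeta> < \<xi>" "\<xi> powr (\<alpha> - 1) - v powr (\<alpha> - 1) = (\<xi> - v) * ((\<alpha> - 1) * \<zeta> powr (\<alpha> - 1 - 1))"
        by (rule powr_mean_value[of v \<xi> "\<alpha> - 1"]) (use 3 \<xi> in auto)
      have "v powr (\<alpha> - 1) - \<xi> powr (\<alpha> - 1) = (\<xi> - v) * ((1 - \<alpha>) * \<zeta> powr (\<alpha> - 2))"
        using \<zeta>(3) by (simp add: algebra_simps)
      also have "\<dots> \<le> h * (1 * v powr (\<alpha> - 2))"
        using \<xi> \<zeta> \<alpha> 3 by (intro mult_mono mult_nonneg_nonneg powr_mono2') auto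
      also have "\<dots> = h powr \<theta> * (h powr (1 - \<theta>) * v powr (\<alpha> - 2))"
        using h by (simp add: mult.assoc[symmetric] flip: powr_add)
      also have "\<dots> \<le> h powr \<theta> * v powr (\<alpha> - 2 + (1 - \<theta>))"
        using h False \<theta> by (intro mult_left_mono powr_split_le) auto
      finally show ?thesis by (simp add: algebra_simps)
    qed
    then have "\<alpha> * (v powr (\<alpha> - 1) - \<xi> powr (\<alpha> - 1)) \<le> 1 * (h powr \<theta> * v powr (\<alpha> - \<theta> - 1))"
      using \<alpha> le by (intro mult_mono) auto
    moreover have "0 \<le> \<alpha> * (v powr (\<alpha> - 1) - \<xi> powr (\<alpha> - 1))" using \<alpha> le by simp
    ultimately have "\<bar>(ppow \<alpha> (v + h) - ppow \<alpha> v) / h - \<alpha> * ppow (\<alpha> - 1) v\<bar> \<le> h powr \<theta> * v powr (\<alpha> - \<theta> - 1)"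
      unfolding eq by simp
    moreover have "0 \<le> h powr \<theta> * ppow (\<alpha> - \<theta> - 1) (v + h)" by simp
    ultimately show ?thesis unfolding ppow_simps(1)[OF 3] by linarith
  qed
qed

text \<open>Up to the factor c the kernel of \<open>X t - X s\<close>; the term of
  \<open>gfbm_kernel\<close> that does not depend on time has cancelled.\<close>

definition gfbm_inc :: "real \<Rightarrow> real \<Rightarrow> real \<Rightarrow> real \<Rightarrow> real \<Rightarrow> real" where
  "gfbm_inc \<alpha> \<gamma> s t u = (ppow \<alpha> (t - u) - ppow \<alpha> (s - u)) * \<bar>u\<bar> powr (- \<gamma> / 2)"

lemma measurable_gfbm_inc [measurable]: "gfbm_inc \<alpha> \<gamma> s t \<in> borel_measurable borel"
  unfolding gfbm_inc_def[abs_def] by measurable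

lemma gfbm_inc_square:
  "(gfbm_inc \<alpha> \<gamma> s t u)\<^sup>2 = (ppow \<alpha> (t - u) - ppow \<alpha> (s - u))\<^sup>2 * \<bar>u\<bar> powr (- \<gamma>)"
  by (simp add: gfbm_inc_def power_mult_distrib power2_powr)

text \<open>Three regions give the three summands of C. Within h of t the square is at most
  \<open>8 * h powr (2 * \<alpha>)\<close>, on an interval of length \<open>2 * h\<close>. Near 0
  the weight is singular but integrable, and the power difference is at most \<open>2 * h\<close>.
  Elsewhere the squared weight is at most 2, and the mean value theorem gives
  \<open>h * (t - u) powr (\<alpha> - 1)\<close>, whose square is integrable beyond distance h from
  t because \<alpha> < 1/2.\<close>

lemma gfbm_inc_norm_upper:
  assumes \<gamma>: "0 \<le> \<gamma>" "\<gamma> < 1" and \<alpha>: "0 < \<alpha>" "\<alpha> < 1 / 2"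
  obtains C where "0 < C"
    "\<And>t h. 1 \<le> t \<Longrightarrow> 0 < h \<Longrightarrow> h \<le> 1 \<Longrightarrow>
      (\<integral>\<^sup>+ u. ennreal ((gfbm_inc \<alpha> \<gamma> t (t + h) u)\<^sup>2) \<partial>lborel) \<le> ennreal (C * h powr (2 * \<alpha> + 1))"
proof -
  define J where "J = (1 / 2) powr (1 - \<gamma>) / (1 - \<gamma>)"
  define C where "C = 16 + 8 * J + 2 / (1 - 2 * \<alpha>)"
  have J: "0 \<le> J" using \<gamma> by (simp add: J_def)
  have C: "0 < C" using J \<alpha> by (simp add: C_def add_pos_nonneg)
  define g0 where "g0 u = ennreal (u powr (- \<gamma>)) * indicator {0..1/2} u" for u :: real
  have [measurable]: "g0 \<in> borel_measurable borel" unfolding g0_def by measurable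
  have g0: "(\<integral>\<^sup>+ u. g0 u \<partial>lborel) = ennreal J"
    using nn_integral_powr_from_0[of "- \<gamma>" "1 / 2"] \<gamma> by (simp add: g0_def J_def)
  have "(\<integral>\<^sup>+ u. ennreal ((gfbm_inc \<alpha> \<gamma> t (t + h) u)\<^sup>2) \<partial>lborel) \<le> ennreal (C * h powr (2 * \<alpha> + 1))"
    if t: "1 \<le> t" and h: "0 < h" "h \<le> 1" for t h
  proof -
    define g1 where "g1 u = ennreal (u powr (2 * \<alpha> - 2)) * indicator {h..} u" for u :: real
    have [measurable]: "g1 \<in> borel_measurable borel" unfolding g1_def by measurable
    have g1: "(\<integral>\<^sup>+ u. g1 u \<partial>lborel) = ennreal (h powr (2 * \<alpha> - 1) / (1 - 2 * \<alpha>))"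
      using nn_integral_powr_to_inf[of "2 * \<alpha> - 2" h] \<alpha> h minus_divide_right[of "h powr (2 * \<alpha> - 1)" "2 * \<alpha> - 1"]
      by (simp add: g1_def)
    have h2: "h\<^sup>2 \<le> h powr (2 * \<alpha> + 1)"
      using powr_mono'[of "2 * \<alpha> + 1" 2 h] h \<alpha> by simp
    have mv: "0 \<le> ppow \<alpha> (t + h - u) - ppow \<alpha> (t - u)"
      "ppow \<alpha> (t + h - u) - ppow \<alpha> (t - u) \<le> h * (t - u) powr (\<alpha> - 1)" if u: "u < t" for u
    proof -
      show "0 \<le> ppow \<alpha> (t + h - u) - ppow \<alpha> (t - u)" using ppow_mono[of \<alpha> "t - u" "t + h - u"] \<alpha> h by simp
      obtain \<xi> where \<xi>: "t - u < \<xi>" "\<xi> < t + h - u"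
        "(t + h - u) powr \<alpha> - (t - u) powr \<alpha> = (t + h - u - (t - u)) * (\<alpha> * \<xi> powr (\<alpha> - 1))"
        by (rule powr_mean_value[of "t - u" "t + h - u" \<alpha>]) (use u h in auto)
      have "\<alpha> * \<xi> powr (\<alpha> - 1) \<le> 1 * (t - u) powr (\<alpha> - 1)"
        using \<alpha> u \<xi> by (intro mult_mono powr_mono2') auto
      then show "ppow \<alpha> (t + h - u) - ppow \<alpha> (t - u) \<le> h * (t - u) powr (\<alpha> - 1)"
        using \<xi>(3) u h by (simp add: mult_left_mono)
    qed
    have w2: "\<bar>u\<bar> powr (- \<gamma>) \<le> 2" if "1 / 2 \<le> \<bar>u\<bar>" for u :: real
    proof -
      have "\<bar>u\<bar> powr (- \<gamma>) \<le> (1 / 2) powr (- \<gamma>)" using that \<gamma> by (intro powr_neg_le_const) auto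
      also have "\<dots> \<le> 2" using \<gamma> by (intro half_powr_le) auto
      finally show ?thesis .
    qed
    have le: "ennreal ((gfbm_inc \<alpha> \<gamma> t (t + h) u)\<^sup>2) \<le> ennreal (8 * h powr (2 * \<alpha>)) * indicator {t - h..t + h} u +
      (ennreal (4 * h powr (2 * \<alpha> + 1)) * (g0 u + g0 (0 - u)) + ennreal (2 * h\<^sup>2) * g1 (t - u))" (is "?l \<le> ?a + (?b + ?c)") for u
    proof -
      consider "t + h \<le> u" | "u = 0" | "u \<noteq> 0" "\<bar>u\<bar> \<le> 1 / 2" | "1 / 2 < \<bar>u\<bar>" "t - h \<le> u" "u < t + h" | "1 / 2 < \<bar>u\<bar>" "u < t - h"
        by linarith
      then show ?thesis
      proof cases
        case 1
        then show ?thesis using h by (simp add: gfbm_inc_def)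
      next
        case 2
        then show ?thesis by (simp add: gfbm_inc_def)
      next
        case 3
        have u: "u < t" using 3 t by linarith
        have "(t - u) powr (\<alpha> - 1) \<le> (1 / 2) powr (\<alpha> - 1)"
          using 3 t \<alpha> by (intro powr_neg_le_const) auto
        also have "\<dots> \<le> 2" using \<alpha> by (intro half_powr_le) auto
        finally have "h * (t - u) powr (\<alpha> - 1) \<le> h * 2" using h by (intro mult_left_mono) auto
        then have "(ppow \<alpha> (t + h - u) - ppow \<alpha> (t - u))\<^sup>2 \<le> (2 * h)\<^sup>2"
          using mv[OF u] by (intro power_mono) auto
        also have "\<dots> \<le> 4 * h powr (2 * \<alpha> + 1)" using h2 by (simp add: power_mult_distrib)
        finally have "(gfbm_inc \<alpha> \<gamma> t (t + h) u)\<^sup>2 \<le> 4 * h powr (2 * \<alpha> + 1) * \<bar>u\<bar> powr (- \<gamma>)"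
          unfolding gfbm_inc_square by (intro mult_right_mono) auto
        then have "?l \<le> ennreal (4 * h powr (2 * \<alpha> + 1)) * ennreal (\<bar>u\<bar> powr (- \<gamma>))"
          by (simp add: ennreal_leI flip: ennreal_mult)
        also have "ennreal (\<bar>u\<bar> powr (- \<gamma>)) = g0 u + g0 (0 - u)"
          using 3 by (cases "0 < u") (auto simp: g0_def)
        finally show ?thesis by (intro add_increasing add_increasing2) auto
      next
        case 4
        have "ppow \<alpha> (t + h - u) \<le> (2 * h) powr \<alpha>"
          using 4 \<alpha> by (simp add: powr_mono2)
        then have "ppow \<alpha> (t + h - u) - ppow \<alpha> (t - u) \<le> (2 * h) powr \<alpha>" using ppow_nonneg[of \<alpha> "t - u"] by linarith
        then have "(ppow \<alpha> (t + h - u) - ppow \<alpha> (t - u))\<^sup>2 \<le> ((2 * h) powr \<alpha>)\<^sup>2"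
          using ppow_mono[of \<alpha> "t - u" "t + h - u"] \<alpha> h by (intro power_mono) auto
        also have "\<dots> = 2 powr (2 * \<alpha>) * h powr (2 * \<alpha>)"
          unfolding power2_powr using h by (simp add: powr_mult)
        also have "\<dots> \<le> 2 powr 1 * h powr (2 * \<alpha>)" using \<alpha> by (intro mult_right_mono powr_mono) auto
        finally have "(gfbm_inc \<alpha> \<gamma> t (t + h) u)\<^sup>2 \<le> (2 * h powr (2 * \<alpha>)) * 2"
          unfolding gfbm_inc_square using w2[of u] 4 by (intro mult_mono) auto
        also have "\<dots> \<le> 8 * h powr (2 * \<alpha>)" by simp
        finally have "?l \<le> ennreal (8 * h powr (2 * \<alpha>))" by (rule ennreal_leI)
        moreover have "u \<in> {t - h..t + h}" using 4 by simp
        ultimately have "?l \<le> ?a" by (simp only: indicator_simps mult_1_right)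
        then show ?thesis by (rule order_trans[OF _ add_increasing2[OF zero_le order_refl]])
      next
        case 5
        then have u: "u < t" using h by linarith
        have "(ppow \<alpha> (t + h - u) - ppow \<alpha> (t - u))\<^sup>2 \<le> (h * (t - u) powr (\<alpha> - 1))\<^sup>2"
          using mv[OF u] by (intro power_mono) auto
        also have "\<dots> = h\<^sup>2 * (t - u) powr (2 * \<alpha> - 2)" by (simp add: power_mult_distrib power2_powr algebra_simps)
        finally have "(gfbm_inc \<alpha> \<gamma> t (t + h) u)\<^sup>2 \<le> (h\<^sup>2 * (t - u) powr (2 * \<alpha> - 2)) * 2"
          unfolding gfbm_inc_square using w2[of u] 5 by (intro mult_mono) auto
        also have "\<dots> = 2 * h\<^sup>2 * (t - u) powr (2 * \<alpha> - 2)" by simp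
        finally have "?l \<le> ennreal (2 * h\<^sup>2 * (t - u) powr (2 * \<alpha> - 2))" by (rule ennreal_leI)
        also have "\<dots> = ennreal (2 * h\<^sup>2) * ennreal ((t - u) powr (2 * \<alpha> - 2))" by (rule ennreal_mult) auto
        also have "ennreal ((t - u) powr (2 * \<alpha> - 2)) = g1 (t - u)" using 5 by (simp add: g1_def)
        finally show ?thesis by (rule order_trans[OF _ add_increasing[OF zero_le add_increasing[OF zero_le order_refl]]])
      qed
    qed
    have "(\<integral>\<^sup>+ u. ennreal ((gfbm_inc \<alpha> \<gamma> t (t + h) u)\<^sup>2) \<partial>lborel) \<le>
       (\<integral>\<^sup>+ u. ennreal (8 * h powr (2 * \<alpha>)) * indicator {t - h..t + h} u +
      (ennreal (4 * h powr (2 * \<alpha> + 1)) * (g0 u + g0 (0 - u)) + ennreal (2 * h\<^sup>2) * g1 (t - u)) \<partial>lborel)"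
      by (intro nn_integral_mono le)
    also have "\<dots> = ennreal (8 * h powr (2 * \<alpha>)) * ennreal (2 * h) +
      (ennreal (4 * h powr (2 * \<alpha> + 1)) * (ennreal J + ennreal J) + ennreal (2 * h\<^sup>2) * ennreal (h powr (2 * \<alpha> - 1) / (1 - 2 * \<alpha>)))"
      using h g0 g1 nn_integral_reflect[of g0 0] nn_integral_reflect[of g1 t]
      by (simp add: nn_integral_add nn_integral_cmult nn_integral_cmult_indicator)
    also have "\<dots> = ennreal (8 * h powr (2 * \<alpha>) * (2 * h) + (4 * h powr (2 * \<alpha> + 1) * (J + J) + 2 * h\<^sup>2 * (h powr (2 * \<alpha> - 1) / (1 - 2 * \<alpha>))))"
    proof -
      have "ennreal x * ennreal y + (ennreal z * (ennreal p + ennreal q) + ennreal v * ennreal w)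
          = ennreal (x * y + (z * (p + q) + v * w))"
        if "0 \<le> x" "0 \<le> y" "0 \<le> z" "0 \<le> p" "0 \<le> q" "0 \<le> v" "0 \<le> w" for x y z p q v w
        using that by (simp add: ennreal_mult)
      from this[of "8 * h powr (2 * \<alpha>)" "2 * h" "4 * h powr (2 * \<alpha> + 1)" J J] show ?thesis using h \<alpha> J by simp
    qed
    also have "8 * h powr (2 * \<alpha>) * (2 * h) + (4 * h powr (2 * \<alpha> + 1) * (J + J) + 2 * h\<^sup>2 * (h powr (2 * \<alpha> - 1) / (1 - 2 * \<alpha>)))
        = C * h powr (2 * \<alpha> + 1)"
    proof -
      have "h powr (2 * \<alpha>) * h = h powr (2 * \<alpha> + 1)" using h by (simp add: powr_add)
      moreover have "h\<^sup>2 * h powr (2 * \<alpha> - 1) = h powr (2 * \<alpha> + 1)"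
        using h powr_add[of h 2 "2 * \<alpha> - 1"] by (simp add: algebra_simps)
      ultimately show ?thesis by (simp add: C_def algebra_simps)
    qed
    finally show ?thesis .
  qed
  with C show thesis by (rule that)
qed

lemma ex_nat_powr_gt:
  fixes A b C :: real
  assumes "0 < A" "0 < b"
  shows "\<exists>n>1. C < A * real n powr b"
proof -
  obtain n :: nat where n: "max 2 ((\<bar>C\<bar> / A + 1) powr (1 / b)) < real n" using reals_Archimedean2 by blast
  have "C / A < \<bar>C\<bar> / A + 1" using assms by (smt (verit) abs_ge_self divide_right_mono)
  also have "\<dots> = ((\<bar>C\<bar> / A + 1) powr (1 / b)) powr b" using assms by (simp add: powr_powr add_nonneg_pos)
  also have "\<dots> \<le> real n powr b" using n assms by (intro powr_mono2) auto
  finally have "C < A * real n powr b" using assms by (simp add: pos_divide_less_eq mult.commute)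
  then show ?thesis using n by (intro exI[of _ n]) auto
qed

section \<open>The process as a Wiener integral, its normalization and the negative results\<close>

locale gfbm_process = gaussian_random_measure M B for M :: "'a measure" and B +
  fixes \<alpha> \<gamma> :: real and X :: "real \<Rightarrow> 'a \<Rightarrow> real"
  assumes \<gamma>_nonneg: "0 \<le> \<gamma>" and \<gamma>_less: "\<gamma> < 1"
    and \<alpha>_lower: "- 1 / 2 + \<gamma> / 2 < \<alpha>" and \<alpha>_upper: "\<alpha> < 1 / 2 + \<gamma> / 2"
    and gfbm: "gfbm M B \<alpha> \<gamma> X"
begin

abbreviation c :: real where
  "c \<equiv> gfbm_const \<alpha> \<gamma>"

lemma continuous_X: "continuous_process M X"
  using gfbm by (simp add: gfbm_def)

lemma hwi_kernel:
  assumes "0 \<le> t"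
  obtains Z where "hwi (gfbm_kernel \<alpha> \<gamma> t) Z" "X t = (\<lambda>\<omega>. c * Z \<omega>)"
  using gfbm assms unfolding gfbm_def by blast

text \<open>No computation: the existence of the Wiener integral, which is part of
  \<open>gfbm\<close>, entails it.\<close>

lemma kernel_square_integrable: "0 \<le> t \<Longrightarrow> integrable lborel (\<lambda>u. (gfbm_kernel \<alpha> \<gamma> t u)\<^sup>2)"
  using hwi_kernel hwi_gaussian(1) by metis

lemma hwi_X: "0 \<le> t \<Longrightarrow> hwi (\<lambda>u. c * gfbm_kernel \<alpha> \<gamma> t u) (X t)"
  using hwi_kernel[of t] hwi_cmult by metis

lemma hwi_inc:
  assumes "0 \<le> s" "0 \<le> t"
  shows "hwi (\<lambda>u. c * gfbm_inc \<alpha> \<gamma> s t u) (\<lambda>\<omega>. X t \<omega> - X s \<omega>)"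
proof -
  have "(\<lambda>u. c * gfbm_kernel \<alpha> \<gamma> t u - c * gfbm_kernel \<alpha> \<gamma> s u) = (\<lambda>u. c * gfbm_inc \<alpha> \<gamma> s t u)"
    by (simp add: gfbm_inc_def gfbm_kernel_diff flip: right_diff_distrib)
  then show ?thesis using hwi_diff[OF hwi_X[OF assms(2)] hwi_X[OF assms(1)]] by simp
qed

lemma inc_square_integrable:
  assumes "0 \<le> s" "0 \<le> t"
  shows "integrable lborel (\<lambda>u. (gfbm_inc \<alpha> \<gamma> s t u)\<^sup>2)"
proof -
  have "gfbm_inc \<alpha> \<gamma> s t = (\<lambda>u. 1 * gfbm_kernel \<alpha> \<gamma> t u + (- 1) * gfbm_kernel \<alpha> \<gamma> s u)"
    using gfbm_kernel_diff[of \<alpha> \<gamma> t] by (simp add: gfbm_inc_def fun_eq_iff)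
  then show ?thesis
    using square_integrable_lin(1)[OF _ _ kernel_square_integrable[OF assms(2)] kernel_square_integrable[OF assms(1)], of 1 "- 1"]
    by simp
qed

lemma gaussian_inc:
  assumes "0 \<le> s" "0 \<le> t"
  shows "gaussian_rv (c\<^sup>2 * (\<integral>u. (gfbm_inc \<alpha> \<gamma> s t u)\<^sup>2 \<partial>lborel)) (\<lambda>\<omega>. X t \<omega> - X s \<omega>)"
  using hwi_gaussian(2)[OF hwi_inc[OF assms]] by (simp add: power_mult_distrib)

lemma kernel_1_norm_pos: "0 < (\<integral>u. (gfbm_kernel \<alpha> \<gamma> 1 u)\<^sup>2 \<partial>lborel)"
proof (rule ccontr)
  assume "\<not> ?thesis"
  moreover have "0 \<le> (\<integral>u. (gfbm_kernel \<alpha> \<gamma> 1 u)\<^sup>2 \<partial>lborel)" by simp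
  ultimately have "(\<integral>u. (gfbm_kernel \<alpha> \<gamma> 1 u)\<^sup>2 \<partial>lborel) = 0" by linarith
  then have "AE u in lborel. (gfbm_kernel \<alpha> \<gamma> 1 u)\<^sup>2 = 0"
    using kernel_square_integrable[of 1] by (subst (asm) integral_nonneg_eq_0_iff_AE) auto
  then have "AE u in lborel. u \<notin> {0<..<1::real}"
  proof eventually_elim
    fix u :: real assume "(gfbm_kernel \<alpha> \<gamma> 1 u)\<^sup>2 = 0"
    then show "u \<notin> {0<..<1}" by (auto simp: gfbm_kernel_ppow)
  qed
  then have "{0<..<1::real} \<in> null_sets lborel" by (subst AE_iff_null_sets) auto
  then show False by (simp add: null_sets_def)
qed

text \<open>The two integrals in \<open>gfbm_const\<close> are the squared norm of the kernel at
  time 1 over (0,1) and, after reflection, over the negative half-line. So c normalizes the variance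
  of X at time 1.\<close>

lemma gfbm_const_eq: "c = (\<integral>u. (gfbm_kernel \<alpha> \<gamma> 1 u)\<^sup>2 \<partial>lborel) powr (- 1 / 2)"
proof -
  let ?k = "\<lambda>u. (gfbm_kernel \<alpha> \<gamma> 1 u)\<^sup>2"
  let ?k1 = "\<lambda>u. indicator {0<..<1} u *\<^sub>R ?k u" and ?k2 = "\<lambda>u. indicator {..<0} u *\<^sub>R ?k u"
  note i = kernel_square_integrable[of 1, simplified]
  have i1: "integrable lborel ?k1" and i2: "integrable lborel ?k2"
    by (intro integrable_mult_indicator i; simp)+
  have "?k u = ?k1 u + ?k2 u" for u
    by (auto simp: indicator_def gfbm_kernel_ppow ppow_def max_def)
  then have "(\<integral>u. ?k u \<partial>lborel) = (\<integral>u. ?k1 u + ?k2 u \<partial>lborel)" by simp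
  also have "\<dots> = (\<integral>u. ?k1 u \<partial>lborel) + (\<integral>u. ?k2 u \<partial>lborel)"
    by (rule Bochner_Integration.integral_add[OF i1 i2])
  also have "(\<integral>u. ?k1 u \<partial>lborel) = (LBINT v:{0<..<1}. (1 - v) powr (2 * \<alpha>) * v powr (- \<gamma>))"
    unfolding set_lebesgue_integral_def
    by (intro Bochner_Integration.integral_cong refl)
       (auto simp: indicator_def gfbm_kernel_ppow power_mult_distrib power2_powr)
  also have "(\<integral>u. ?k2 u \<partial>lborel) = (LBINT v:{0<..}. ((1 + v) powr \<alpha> - v powr \<alpha>)\<^sup>2 * v powr (- \<gamma>))"
    unfolding set_lebesgue_integral_def
    by (subst lborel_integral_real_affine[where c = "- 1" and t = 0])
       (auto intro!: Bochner_Integration.integral_cong simp: indicator_def gfbm_kernel_ppow power_mult_distrib power2_powr)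
  finally show ?thesis by (simp add: gfbm_const_def)
qed

lemma c_pos: "0 < c"
  unfolding gfbm_const_eq using kernel_1_norm_pos by simp

lemma c_norm: "c\<^sup>2 * (\<integral>u. (gfbm_kernel \<alpha> \<gamma> 1 u)\<^sup>2 \<partial>lborel) = 1"
proof -
  have "c\<^sup>2 = (\<integral>u. (gfbm_kernel \<alpha> \<gamma> 1 u)\<^sup>2 \<partial>lborel) powr (- 1)"
    unfolding gfbm_const_eq power2_powr by simp
  then show ?thesis using kernel_1_norm_pos by (simp add: powr_minus)
qed

text \<open>The interval (s, s+h) alone gives the variance of an increment its order: there only one
  power survives, it is at least \<open>h powr \<alpha>\<close> as \<alpha> is negative, and the
  squared weight is at least \<open>2 powr (- \<gamma>)\<close>. The n variances then add up to a
  multiple of \<open>real n powr (- 2 * \<alpha>)\<close>.\<close>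

lemma not_semimartingale_negative:
  assumes filt: "filtration (space M) F" "\<And>t. subalgebra M (F t)" and neg: "\<alpha> < 0"
  shows "\<not> semimartingale M F X"
proof (rule not_semimartingale_quadratic_variation[OF filt continuous_X gaussian_inc])
  fix C :: real
  define A where "A = c\<^sup>2 * 2 powr (- \<gamma>)"
  have A: "0 < A" using c_pos by (simp add: A_def)
  have lower: "2 powr (- \<gamma>) * h powr (2 * \<alpha> + 1) \<le> (\<integral>u. (gfbm_inc \<alpha> \<gamma> s (s + h) u)\<^sup>2 \<partial>lborel)"
    if s: "1 \<le> s" "s + h \<le> 2" and h: "0 < h" for s h
  proof -
    have "2 powr (- \<gamma>) * h powr (2 * \<alpha> + 1) = (h powr (2 * \<alpha>) * 2 powr (- \<gamma>)) * measure lborel {s<..<s + h}"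
      using h by (simp add: powr_add)
    also have "\<dots> = (\<integral>u. (h powr (2 * \<alpha>) * 2 powr (- \<gamma>)) * indicator {s<..<s + h} u \<partial>lborel)"
      using h by simp
    also have "\<dots> \<le> (\<integral>u. (gfbm_inc \<alpha> \<gamma> s (s + h) u)\<^sup>2 \<partial>lborel)"
    proof (rule integral_mono)
      show "integrable lborel (\<lambda>u. (gfbm_inc \<alpha> \<gamma> s (s + h) u)\<^sup>2)" using s h by (intro inc_square_integrable) auto
      show "integrable lborel (\<lambda>u. (h powr (2 * \<alpha>) * 2 powr (- \<gamma>)) * indicator {s<..<s + h} u)" using h by simp
      fix u
      show "(h powr (2 * \<alpha>) * 2 powr (- \<gamma>)) * indicator {s<..<s + h} u \<le> (gfbm_inc \<alpha> \<gamma> s (s + h) u)\<^sup>2"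
      proof (cases "u \<in> {s<..<s + h}")
        case True
        have "h powr (2 * \<alpha>) \<le> (s + h - u) powr (2 * \<alpha>)" using True neg by (intro powr_mono2') auto
        moreover have "2 powr (- \<gamma>) \<le> u powr (- \<gamma>)" using True s \<gamma>_nonneg by (intro powr_mono2') auto
        ultimately have "h powr (2 * \<alpha>) * 2 powr (- \<gamma>) \<le> (s + h - u) powr (2 * \<alpha>) * u powr (- \<gamma>)"
          by (intro mult_mono) auto
        then show ?thesis using True s unfolding gfbm_inc_square by (simp add: power2_powr)
      qed simp
    qed
    finally show ?thesis .
  qed
  from ex_nat_powr_gt[OF A, of "- 2 * \<alpha>" C] neg obtain n where n: "1 < n" "C < A * real n powr (- 2 * \<alpha>)" by auto
  have "A * real n powr (- 2 * \<alpha>) = (\<Sum>i<n. A * (1 / real n) powr (2 * \<alpha> + 1))"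
  proof -
    have "real n powr (- 2 * \<alpha>) = real n powr 1 * real n powr (- (2 * \<alpha> + 1))" by (subst powr_add[symmetric]) simp
    also have "real n powr (- (2 * \<alpha> + 1)) = (1 / real n) powr (2 * \<alpha> + 1)"
      using powr_minus_divide[of "real n" "2 * \<alpha> + 1"] by (simp add: powr_divide)
    finally show ?thesis using n by simp
  qed
  also have "\<dots> \<le> (\<Sum>i<n. c\<^sup>2 * (\<integral>u. (gfbm_inc \<alpha> \<gamma> (1 + real i / real n) (1 + real (Suc i) / real n) u)\<^sup>2 \<partial>lborel))"
  proof (rule sum_mono)
    fix i assume "i \<in> {..<n}"
    then have "real (Suc i) / real n \<le> 1" using n by simp
    moreover have e: "1 + real (Suc i) / real n = 1 + real i / real n + 1 / real n" by (simp add: add_divide_distrib)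
    ultimately have "2 powr (- \<gamma>) * (1 / real n) powr (2 * \<alpha> + 1)
       \<le> (\<integral>u. (gfbm_inc \<alpha> \<gamma> (1 + real i / real n) (1 + real (Suc i) / real n) u)\<^sup>2 \<partial>lborel)"
      unfolding e using n by (intro lower) (auto simp: add_divide_distrib)
    then have "c\<^sup>2 * (2 powr (- \<gamma>) * (1 / real n) powr (2 * \<alpha> + 1))
       \<le> c\<^sup>2 * (\<integral>u. (gfbm_inc \<alpha> \<gamma> (1 + real i / real n) (1 + real (Suc i) / real n) u)\<^sup>2 \<partial>lborel)"
      by (rule mult_left_mono) simp
    then show "A * (1 / real n) powr (2 * \<alpha> + 1)
       \<le> c\<^sup>2 * (\<integral>u. (gfbm_inc \<alpha> \<gamma> (1 + real i / real n) (1 + real (Suc i) / real n) u)\<^sup>2 \<partial>lborel)"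
      by (simp add: A_def mult.assoc)
  qed
  finally show "\<exists>n>0. C < (\<Sum>i<n. c\<^sup>2 * (\<integral>u. (gfbm_inc \<alpha> \<gamma> (1 + real i / real n) (1 + real (Suc i) / real n) u)\<^sup>2 \<partial>lborel))"
    using n by (intro exI[of _ n]) auto
qed auto

end

lemma (in prob_space) martingaleI_orthogonal:
  fixes Y :: "real \<Rightarrow> 'a \<Rightarrow> real"
  assumes sub: "\<And>t. subalgebra M (F t)" and ad: "adapted_process F Y" and i: "\<And>t. 0 \<le> t \<Longrightarrow> integrable M (Y t)"
    and orth: "\<And>s t A. 0 \<le> s \<Longrightarrow> s \<le> t \<Longrightarrow> A \<in> sets (F s) \<Longrightarrow> expectation (\<lambda>\<omega>. indicator A \<omega> * (Y t \<omega> - Y s \<omega>)) = 0"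
  shows "martingale M F Y"
  unfolding martingale_def
proof (intro conjI ad allI impI i)
  fix s t :: real assume st: "0 \<le> s \<and> s \<le> t"
  interpret S: finite_measure_subalgebra M "F s" using sub by unfold_locales
  show "AE \<omega> in M. real_cond_exp M (F s) (Y t) \<omega> = Y s \<omega>"
  proof (rule S.real_cond_exp_charact)
    fix A assume A: "A \<in> sets (F s)"
    then have AM: "A \<in> sets M" using sub[of s] by (auto simp: subalgebra_def)
    have int: "integrable M (\<lambda>\<omega>. indicator A \<omega> * Y r \<omega>)" if "0 \<le> r" for r
      using integrable_mult_indicator[OF AM i[OF that]] by simp
    show "(LINT \<omega>:A|M. Y t \<omega>) = (LINT \<omega>:A|M. Y s \<omega>)"
      using orth[of s t A] st A int[of s] int[of t]
      by (simp add: set_lebesgue_integral_def right_diff_distrib)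
  qed (use st i ad in \<open>auto simp: adapted_process_def\<close>)
qed

lemma continuous_imp_cadlag:
  assumes "continuous_on {0..} f"
  shows "cadlag_path f"
proof -
  have "continuous (at t within {0..}) f" if "0 \<le> t" for t
    using assms that by (simp add: continuous_on_eq_continuous_within)
  then have lim: "(f \<longlongrightarrow> f t) (at t within {0..})" if "0 \<le> t" for t
    using that by (simp add: continuous_within)
  have "continuous (at_right t) f" if "0 \<le> t" for t
  proof -
    have "{t<..} \<subseteq> {0..}" using that by auto
    from tendsto_within_subset[OF lim[OF that] this] show ?thesis by (simp add: continuous_within)
  qed
  moreover have "(f \<longlongrightarrow> f t) (at_left t)" if "0 < t" for t
  proof -
    have "(f \<longlongrightarrow> f t) (at t within {0..t})"
      using that by (intro tendsto_within_subset[OF lim]) auto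
    then show ?thesis by (simp only: at_within_Icc_at_left[OF that])
  qed
  ultimately show ?thesis unfolding cadlag_path_def by blast
qed

context gfbm_process begin

text \<open>For positive \<alpha> truncated powers are increasing, so both kernels are nonnegative
  and the integral may be restricted to (s, s + h/2). There the first power difference is at least
  \<open>(h / 2) powr \<alpha>\<close> and the second, by the mean value theorem, at least
  \<open>h * \<alpha> * (2 * h) powr (\<alpha> - 1)\<close>. The length h/2 turns \<alpha>/2 into
  \<alpha>/4.\<close>

lemma inc_product_lower:
  assumes \<alpha>: "0 < \<alpha>" "\<alpha> < 1 / 2" and s: "1 \<le> s" "s + 2 * h \<le> 2" and h: "0 < h"
  shows "\<alpha> / 4 * 2 powr (- \<gamma>) * h powr (2 * \<alpha> + 1)
    \<le> (\<integral>u. gfbm_inc \<alpha> \<gamma> s (s + h) u * gfbm_inc \<alpha> \<gamma> (s + h) (s + 2 * h) u \<partial>lborel)"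
proof -
  let ?L = "\<alpha> / 2 * 2 powr (- \<gamma>) * h powr (2 * \<alpha>)"
  have "\<alpha> / 4 * 2 powr (- \<gamma>) * h powr (2 * \<alpha> + 1) = (\<integral>u. ?L * indicator {s<..<s + h / 2} u \<partial>lborel)"
    using h by (simp add: powr_add)
  also have "\<dots> \<le> (\<integral>u. gfbm_inc \<alpha> \<gamma> s (s + h) u * gfbm_inc \<alpha> \<gamma> (s + h) (s + 2 * h) u \<partial>lborel)"
  proof (rule integral_mono)
    show "integrable lborel (\<lambda>u. ?L * indicator {s<..<s + h / 2} u)" using h by simp
    show "integrable lborel (\<lambda>u. gfbm_inc \<alpha> \<gamma> s (s + h) u * gfbm_inc \<alpha> \<gamma> (s + h) (s + 2 * h) u)"
      using s h by (intro Cauchy_Schwarz_integral(1) inc_square_integrable) auto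
    fix u
    show "?L * indicator {s<..<s + h / 2} u \<le> gfbm_inc \<alpha> \<gamma> s (s + h) u * gfbm_inc \<alpha> \<gamma> (s + h) (s + 2 * h) u"
    proof (cases "u \<in> {s<..<s + h / 2}")
      case True
      define x where "x = s + h - u"
      have x: "h / 2 < x" "x < h" "s + 2 * h - u = x + h" "s - u < 0" using True by (auto simp: x_def)
      have u: "0 < u" "u \<le> 2" using True s h by auto
      obtain \<xi> where \<xi>: "x < \<xi>" "\<xi> < x + h" "(x + h) powr \<alpha> - x powr \<alpha> = (x + h - x) * (\<alpha> * \<xi> powr (\<alpha> - 1))"
        by (rule powr_mean_value[of x "x + h" \<alpha>]) (use x h in auto)
      have "(2 * h) powr (\<alpha> - 1) \<le> \<xi> powr (\<alpha> - 1)" using \<xi> x h \<alpha> by (intro powr_mono2') auto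
      then have "h * (\<alpha> * (2 * h) powr (\<alpha> - 1)) \<le> (x + h) powr \<alpha> - x powr \<alpha>"
        unfolding \<xi>(3) using h \<alpha> by simp
      moreover have "(h / 2) powr \<alpha> \<le> x powr \<alpha>" using x h \<alpha> by (intro powr_mono2) auto
      moreover have "2 powr (- \<gamma>) \<le> u powr (- \<gamma>)" using u \<gamma>_nonneg by (intro powr_mono2') auto
      ultimately have "(h / 2) powr \<alpha> * (h * (\<alpha> * (2 * h) powr (\<alpha> - 1))) * 2 powr (- \<gamma>)
          \<le> x powr \<alpha> * ((x + h) powr \<alpha> - x powr \<alpha>) * u powr (- \<gamma>)"
        using h \<alpha> by (intro mult_mono mult_nonneg_nonneg order_trans[OF _ \<open>h * (\<alpha> * (2 * h) powr (\<alpha> - 1)) \<le> (x + h) powr \<alpha> - x powr \<alpha>\<close>]) auto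
      also have "(h / 2) powr \<alpha> * (h * (\<alpha> * (2 * h) powr (\<alpha> - 1))) * 2 powr (- \<gamma>) = ?L"
      proof -
        have 1: "h * (2 * h) powr (\<alpha> - 1) = (2 * h) powr \<alpha> / 2"
          using h powr_diff[of "2 * h" \<alpha> 1] by simp
        have "(h / 2) powr \<alpha> * (2 * h) powr \<alpha> = h powr (2 * \<alpha>)"
          using h powr_mult[of "h / 2" "2 * h" \<alpha>] power2_powr[of h \<alpha>] powr_mult[of h h \<alpha>] by (simp add: power2_eq_square)
        then have "(h / 2) powr \<alpha> * (h * (2 * h) powr (\<alpha> - 1)) = h powr (2 * \<alpha>) / 2" unfolding 1 by simp
        then show ?thesis by (simp add: algebra_simps)
      qed
      also have "x powr \<alpha> * ((x + h) powr \<alpha> - x powr \<alpha>) * u powr (- \<gamma>)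
        = gfbm_inc \<alpha> \<gamma> s (s + h) u * gfbm_inc \<alpha> \<gamma> (s + h) (s + 2 * h) u"
      proof -
        have "u powr (- \<gamma>) = u powr (- \<gamma> / 2) * u powr (- \<gamma> / 2)" by (simp flip: powr_add)
        moreover have "0 < x" "0 < x + h" using x h by auto
        ultimately show ?thesis unfolding gfbm_inc_def x(3) x_def[symmetric] using x(4) u by simp
      qed
      finally show ?thesis using True by simp
    next
      case False
      have "0 \<le> gfbm_inc \<alpha> \<gamma> s (s + h) u" "0 \<le> gfbm_inc \<alpha> \<gamma> (s + h) (s + 2 * h) u"
        unfolding gfbm_inc_def using ppow_mono[of \<alpha> "s - u" "s + h - u"] ppow_mono[of \<alpha> "s + h - u" "s + 2 * h - u"] \<alpha> h
        by auto
      then show ?thesis using False by simp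
    qed
  qed
  finally show ?thesis .
qed

text \<open>The constant \<rho> is the quotient of the covariance bound and the variance bound; both
  carry the same power of the mesh, so it does not depend on n. The order
  \<open>real n * sqrt (w n)\<close> of the transform is a multiple of
  \<open>real n powr (1 / 2 - \<alpha>)\<close>, which is unbounded.\<close>

lemma not_semimartingale_positive:
  assumes filt: "filtration (space M) F" "\<And>t. subalgebra M (F t)" and \<alpha>: "0 < \<alpha>" "\<alpha> < 1 / 2"
  shows "\<not> semimartingale M F X"
proof -
  obtain C where C: "0 < C" "\<And>t h. 1 \<le> t \<Longrightarrow> 0 < h \<Longrightarrow> h \<le> 1 \<Longrightarrow>
      (\<integral>\<^sup>+ u. ennreal ((gfbm_inc \<alpha> \<gamma> t (t + h) u)\<^sup>2) \<partial>lborel) \<le> ennreal (C * h powr (2 * \<alpha> + 1))"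
    using gfbm_inc_norm_upper[OF \<gamma>_nonneg \<gamma>_less \<alpha>] by blast
  have upper: "(\<integral>u. (gfbm_inc \<alpha> \<gamma> t (t + h) u)\<^sup>2 \<partial>lborel) \<le> C * h powr (2 * \<alpha> + 1)"
    if "1 \<le> t" "0 < h" "h \<le> 1" for t h
  proof -
    have "integrable lborel (\<lambda>u. (gfbm_inc \<alpha> \<gamma> t (t + h) u)\<^sup>2)"
      using that by (intro inc_square_integrable) auto
    from nn_integral_eq_integral[OF this] C(2)[OF that] C(1) show ?thesis by simp
  qed
  define w where "w n = c\<^sup>2 * (C * (1 / real n) powr (2 * \<alpha> + 1))" for n :: nat
  define \<rho> where "\<rho> = \<alpha> / 4 * 2 powr (- \<gamma>) / C"
  have step: "1 + real (Suc i) / real n = 1 + real i / real n + 1 / real n" for i n by (simp add: add_divide_distrib)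
  show ?thesis
  proof (rule not_semimartingale_correlated[OF filt gaussian_inc, where w = w and \<rho> = \<rho>])
    fix n i :: nat assume i: "i < n"
    show "c\<^sup>2 * (\<integral>u. (gfbm_inc \<alpha> \<gamma> (1 + real i / real n) (1 + real (Suc i) / real n) u)\<^sup>2 \<partial>lborel) \<le> w n"
      unfolding w_def step using i by (intro mult_left_mono upper) auto
  next
    fix n :: nat assume "0 < n"
    then show "0 < w n" using c_pos C(1) by (simp add: w_def)
  next
    show "0 < \<rho>" using \<alpha> C(1) by (simp add: \<rho>_def)
  next
    fix n i :: nat assume i: "Suc i < n"
    define s h where "s = 1 + real i / real n" and "h = 1 / real n"
    have h: "0 < h" using i by (simp add: h_def)
    have e: "1 + real i / real n = s" "1 + real (Suc i) / real n = s + h" "1 + real (Suc (Suc i)) / real n = s + 2 * h"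
      by (simp_all add: s_def h_def add_divide_distrib)
    have "real (Suc (Suc i)) / real n \<le> 1" using i by simp
    then have s: "1 \<le> s" "s + 2 * h \<le> 2" using e(3) by (auto simp: s_def)
    have "\<rho> * w n = c\<^sup>2 * (\<alpha> / 4 * 2 powr (- \<gamma>) * h powr (2 * \<alpha> + 1))"
      using C(1) by (simp add: \<rho>_def w_def h_def)
    also have "\<dots> \<le> c\<^sup>2 * (\<integral>u. gfbm_inc \<alpha> \<gamma> s (s + h) u * gfbm_inc \<alpha> \<gamma> (s + h) (s + 2 * h) u \<partial>lborel)"
      by (intro mult_left_mono inc_product_lower \<alpha> s h) simp
    also have "\<dots> = (\<integral>u. c\<^sup>2 * (gfbm_inc \<alpha> \<gamma> s (s + h) u * gfbm_inc \<alpha> \<gamma> (s + h) (s + 2 * h) u) \<partial>lborel)"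
      by simp
    also have "\<dots> = (\<integral>u. (c * gfbm_inc \<alpha> \<gamma> s (s + h) u) * (c * gfbm_inc \<alpha> \<gamma> (s + h) (s + 2 * h) u) \<partial>lborel)"
      by (intro Bochner_Integration.integral_cong refl) (simp add: power2_eq_square)
    also have "\<dots> = expectation (\<lambda>\<omega>. (X (s + h) \<omega> - X s \<omega>) * (X (s + 2 * h) \<omega> - X (s + h) \<omega>))"
      using s h by (intro hwi_covariance(2)[symmetric] hwi_inc) auto
    finally show "\<rho> * w n \<le> expectation (\<lambda>\<omega>. (X (1 + real (Suc i) / real n) \<omega> - X (1 + real i / real n) \<omega>) *
        (X (1 + real (Suc (Suc i)) / real n) \<omega> - X (1 + real (Suc i) / real n) \<omega>))"
      unfolding e .
  next
    fix D :: real
    have "0 < c * sqrt C" "0 < 1 / 2 - \<alpha>" using c_pos C(1) \<alpha> by auto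
    from ex_nat_powr_gt[OF this, of D] obtain n where n: "1 < n" "D < c * sqrt C * real n powr (1 / 2 - \<alpha>)" by blast
    have "real n * sqrt (w n) = c * sqrt C * (real n * sqrt ((1 / real n) powr (2 * \<alpha> + 1)))"
      using c_pos by (simp add: w_def real_sqrt_mult)
    also have "sqrt ((1 / real n) powr (2 * \<alpha> + 1)) = (1 / real n) powr (\<alpha> + 1 / 2)"
      by (intro real_sqrt_unique) (simp_all add: power2_powr algebra_simps)
    also have "\<dots> = real n powr (- (\<alpha> + 1 / 2))"
      using powr_minus_divide[of "real n" "\<alpha> + 1 / 2"] by (simp add: powr_divide)
    also have "real n * real n powr (- (\<alpha> + 1 / 2)) = real n powr 1 * real n powr (- (\<alpha> + 1 / 2))" using n by simp
    also have "\<dots> = real n powr (1 / 2 - \<alpha>)" by (subst powr_add[symmetric]) (simp add: algebra_simps)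
    finally show "\<exists>n>1. D < real n * sqrt (w n)" using n by (intro exI[of _ n]) auto
  qed auto
qed

section \<open>Adaptedness, fractional Brownian motion for \<gamma> = 0 and the martingale for
  \<alpha> = 0\<close>

lemma X_0: "AE \<omega> in M. X 0 \<omega> = 0"
proof -
  have "(\<lambda>u. c * gfbm_kernel \<alpha> \<gamma> 0 u) = (\<lambda>_. 0)" by (simp add: gfbm_kernel_def)
  then show ?thesis using hwi_unique[OF hwi_X[of 0]] hwi_0 by simp
qed

lemma X_filt:
  assumes "0 \<le> s" "s \<le> t"
  shows "X s \<in> borel_measurable (filt t)"
  using assms by (intro hwi_adapted[OF hwi_X]) (auto simp: gfbm_kernel_ppow)

lemma X_integrable:
  assumes "0 \<le> t"
  shows "integrable M (X t)" "integrable M (\<lambda>\<omega>. (X t \<omega>)\<^sup>2)"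
  using gaussian_rv_moment[OF hwi_gaussian(2)[OF hwi_X[OF assms]]] by auto

lemma AE_cadlag_X: "AE \<omega> in M. cadlag_path (\<lambda>t. X t \<omega>)"
proof -
  have "AE \<omega> in M. continuous_on {0..} (\<lambda>t. X t \<omega>)" using continuous_X by (simp add: continuous_process_def)
  then show ?thesis by eventually_elim (rule continuous_imp_cadlag)
qed

lemma cadlag_shift:
  assumes "cadlag_path f"
  shows "cadlag_path (\<lambda>t. f t - a)"
  unfolding cadlag_path_def
proof (intro conjI allI impI)
  fix t :: real assume "0 \<le> t"
  then have "continuous (at_right t) f" using assms by (simp add: cadlag_path_def)
  then show "continuous (at_right t) (\<lambda>t. f t - a)" by (intro continuous_diff continuous_const)
next
  fix t :: real assume "0 < t"
  then obtain l where "(f \<longlongrightarrow> l) (at_left t)" using assms unfolding cadlag_path_def by blast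
  then have "((\<lambda>t. f t - a) \<longlongrightarrow> l - a) (at_left t)" by (intro tendsto_diff tendsto_const)
  then show "\<exists>l. ((\<lambda>t. f t - a) \<longlongrightarrow> l) (at_left t)" by blast
qed

text \<open>Without the weight the substitution of \<open>s + (t - s) * u\<close> for u carries the
  increment kernel to a multiple of the kernel at time 1, whose norm is fixed by
  \<open>c_norm\<close>.\<close>

lemma variance_inc_0:
  assumes \<gamma>: "\<gamma> = 0" and st: "0 \<le> s" "0 \<le> t"
  shows "expectation (\<lambda>\<omega>. (X t \<omega> - X s \<omega>)\<^sup>2) = \<bar>t - s\<bar> powr (2 * (\<alpha> + 1 / 2))"
proof -
  have less: "expectation (\<lambda>\<omega>. (X t \<omega> - X s \<omega>)\<^sup>2) = (t - s) powr (2 * (\<alpha> + 1 / 2))"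
    if "0 \<le> s" "s < t" for s t
  proof -
    let ?h = "t - s"
    have "expectation (\<lambda>\<omega>. (X t \<omega> - X s \<omega>)\<^sup>2) = c\<^sup>2 * (\<integral>u. (gfbm_inc \<alpha> \<gamma> s t u)\<^sup>2 \<partial>lborel)"
      using that by (intro gaussian_rv_moment(6) gaussian_inc) auto
    also have "(\<integral>u. (gfbm_inc \<alpha> \<gamma> s t u)\<^sup>2 \<partial>lborel) = \<bar>?h\<bar> *\<^sub>R (\<integral>u. (gfbm_inc \<alpha> \<gamma> s t (s + ?h * u))\<^sup>2 \<partial>lborel)"
      using that by (intro lborel_integral_real_affine) auto
    also have "(\<integral>u. (gfbm_inc \<alpha> \<gamma> s t (s + ?h * u))\<^sup>2 \<partial>lborel) = (\<integral>u. ?h powr (2 * \<alpha>) * (gfbm_kernel \<alpha> \<gamma> 1 u)\<^sup>2 \<partial>lborel)"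
    proof (rule integral_cong_AE)
      \<comment> \<open>The weight is a power with exponent 0: it is 1 except at base 0, where
        \<open>powr\<close> gives 0. The two excluded points are those at which the weights on the
        two sides vanish.\<close>
      have "AE u in lborel. u \<noteq> 0" "AE u in lborel. u \<noteq> - s / ?h" by (rule AE_lborel_singleton)+
      then show "AE u in lborel. (gfbm_inc \<alpha> \<gamma> s t (s + ?h * u))\<^sup>2 = ?h powr (2 * \<alpha>) * (gfbm_kernel \<alpha> \<gamma> 1 u)\<^sup>2"
      proof eventually_elim
        fix u assume u: "u \<noteq> 0" "u \<noteq> - s / ?h"
        then have "s + ?h * u \<noteq> 0" using that by (simp add: field_simps)
        then have "gfbm_inc \<alpha> \<gamma> s t (s + ?h * u) = ppow \<alpha> (?h * (1 - u)) - ppow \<alpha> (?h * (- u))"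
          using \<gamma> by (simp add: gfbm_inc_def algebra_simps)
        also have "\<dots> = ?h powr \<alpha> * gfbm_kernel \<alpha> \<gamma> 1 u"
          using that u \<gamma> by (simp only: ppow_scale gfbm_kernel_ppow) (simp add: algebra_simps)
        finally show "(gfbm_inc \<alpha> \<gamma> s t (s + ?h * u))\<^sup>2 = ?h powr (2 * \<alpha>) * (gfbm_kernel \<alpha> \<gamma> 1 u)\<^sup>2"
          by (simp add: power_mult_distrib power2_powr)
      qed
    qed measurable
    also have "c\<^sup>2 * (\<bar>?h\<bar> *\<^sub>R (\<integral>u. ?h powr (2 * \<alpha>) * (gfbm_kernel \<alpha> \<gamma> 1 u)\<^sup>2 \<partial>lborel))
        = ?h * ?h powr (2 * \<alpha>) * (c\<^sup>2 * (\<integral>u. (gfbm_kernel \<alpha> \<gamma> 1 u)\<^sup>2 \<partial>lborel))"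
      using that by simp
    also have "\<dots> = ?h powr (2 * (\<alpha> + 1 / 2))" unfolding c_norm using that powr_add[of ?h "2 * \<alpha>" 1] by (simp add: algebra_simps)
    finally show ?thesis .
  qed
  consider "s < t" | "t < s" | "s = t" by linarith
  then show ?thesis
  proof cases
    case 2
    then show ?thesis using less[of t s] st by (simp add: power2_commute)
  qed (use less[of s t] st in auto)
qed

lemma fractional_brownian_motion_0:
  assumes "\<gamma> = 0"
  shows "fractional_brownian_motion M (\<alpha> + 1 / 2) X"
  unfolding fractional_brownian_motion_def centered_gaussian_process_def
proof (intro conjI allI impI continuous_X)
  show "X t \<in> borel_measurable M" if "0 \<le> t" for t using hwi_measurable(2)[OF hwi_X[OF that]] .
next
  fix I :: "real set" and a assume I: "finite I \<and> I \<subseteq> {0..}"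
  have "hwi (\<lambda>u. \<Sum>t\<in>I. a t * (c * gfbm_kernel \<alpha> \<gamma> t u)) (\<lambda>\<omega>. \<Sum>t\<in>I. a t * X t \<omega>)"
    using I by (intro hwi_sum hwi_X) auto
  from hwi_gaussian(2)[OF this] show "\<exists>v\<ge>0. distr M borel (\<lambda>\<omega>. \<Sum>t\<in>I. a t * X t \<omega>) = centered_normal v"
    unfolding gaussian_rv_def by blast
next
  fix s t :: real assume s: "0 \<le> s" and t: "0 \<le> t"
  have sq: "expectation (\<lambda>\<omega>. (X r \<omega>)\<^sup>2) = r powr (2 * (\<alpha> + 1 / 2))" if "0 \<le> r" for r
  proof -
    have "expectation (\<lambda>\<omega>. (X r \<omega>)\<^sup>2) = expectation (\<lambda>\<omega>. (X r \<omega> - X 0 \<omega>)\<^sup>2)"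
      using X_0 hwi_measurable(2)[OF hwi_X[OF that]] hwi_measurable(2)[OF hwi_X[of 0]]
      by (intro integral_cong_AE) (auto elim: eventually_mono)
    then show ?thesis using variance_inc_0[OF assms, of 0 r] that by simp
  qed
  have "expectation (\<lambda>\<omega>. (X t \<omega> - X s \<omega>)\<^sup>2) = expectation (\<lambda>\<omega>. (X t \<omega>)\<^sup>2) - 2 * expectation (\<lambda>\<omega>. X t \<omega> * X s \<omega>) + expectation (\<lambda>\<omega>. (X s \<omega>)\<^sup>2)"
    using square_integrable_lin(2)[OF hwi_measurable(2)[OF hwi_X[OF t]] hwi_measurable(2)[OF hwi_X[OF s]]
       X_integrable(2)[OF t] X_integrable(2)[OF s], of 1 "- 1"] by simp
  then show "expectation (\<lambda>\<omega>. X s \<omega> * X t \<omega>) =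
     (s powr (2 * (\<alpha> + 1 / 2)) + t powr (2 * (\<alpha> + 1 / 2)) - \<bar>t - s\<bar> powr (2 * (\<alpha> + 1 / 2))) / 2"
    using sq[OF s] sq[OF t] variance_inc_0[OF assms s t] by (simp add: mult.commute)
qed

lemma hwi_closed_interval:
  assumes \<alpha>: "\<alpha> = 0" and t: "0 \<le> t"
  shows "\<exists>Z. hwi (\<lambda>u. indicator {0..t} u * u powr (- \<gamma> / 2)) Z \<and> X t = (\<lambda>\<omega>. gfbm_const 0 \<gamma> * Z \<omega>)"
proof -
  from hwi_kernel[OF t] obtain Z where Z: "hwi (gfbm_kernel \<alpha> \<gamma> t) Z" "X t = (\<lambda>\<omega>. c * Z \<omega>)" by blast
  have "hwi (\<lambda>u. indicator {0..t} u * u powr (- \<gamma> / 2)) Z"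
  proof (rule hwi_cong_AE[OF Z(1)])
    have "AE u in lborel. u \<noteq> t" by (rule AE_lborel_singleton)
    then show "AE u in lborel. gfbm_kernel \<alpha> \<gamma> t u = indicator {0..t} u * u powr (- \<gamma> / 2)"
      by eventually_elim (auto simp: \<alpha> gfbm_kernel_0[OF t] indicator_def)
  qed (use hwi_measurable[OF Z(1)] in auto)
  then show ?thesis using Z(2) \<alpha> by auto
qed

lemma orthogonal_past:
  assumes \<alpha>: "\<alpha> = 0" and st: "0 \<le> s" "s \<le> t" and A: "A \<in> sets (filt s)"
  shows "expectation (\<lambda>\<omega>. indicator A \<omega> * (X t \<omega> - X s \<omega>)) = 0"
proof (rule hwi_past[OF _ _ A])
  note inc = hwi_inc[of s t]
  show "hwi (\<lambda>u. c * gfbm_inc \<alpha> \<gamma> s t u * indicator {s<..} u) (\<lambda>\<omega>. X t \<omega> - X s \<omega>)"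
  proof (rule hwi_cong_AE[OF inc])
    \<comment> \<open>If s < t, the kernel does not vanish at \<open>u = s\<close>, because
      \<open>ppow 0\<close> jumps right after 0. Dropping this null point leaves an integrand on the
      strict future of s.\<close>
    have "AE u in lborel. u \<noteq> s" by (rule AE_lborel_singleton)
    then show "AE u in lborel. c * gfbm_inc \<alpha> \<gamma> s t u = c * gfbm_inc \<alpha> \<gamma> s t u * indicator {s<..} u"
    proof eventually_elim
      fix u assume "u \<noteq> s"
      then show "c * gfbm_inc \<alpha> \<gamma> s t u = c * gfbm_inc \<alpha> \<gamma> s t u * indicator {s<..} u"
        using st \<alpha> by (cases "s < u") (auto simp: gfbm_inc_def)
    qed
  qed (use st hwi_measurable[OF inc] in auto)
qed simp

lemma martingale_stopped:
  assumes \<alpha>: "\<alpha> = 0" and r: "0 \<le> r"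
  shows "martingale M filt (\<lambda>t \<omega>. X (min t r) \<omega> - X 0 \<omega>)"
proof (rule martingaleI_orthogonal[OF subalgebra_filt])
  show "adapted_process filt (\<lambda>t \<omega>. X (min t r) \<omega> - X 0 \<omega>)"
    unfolding adapted_process_def using r by (intro allI impI borel_measurable_diff X_filt) auto
  show "integrable M (\<lambda>\<omega>. X (min t r) \<omega> - X 0 \<omega>)" if "0 \<le> t" for t
    using that r by (intro Bochner_Integration.integrable_diff X_integrable) auto
  fix s t A assume st: "0 \<le> s" "s \<le> t" and A: "A \<in> sets (filt s)"
  show "expectation (\<lambda>\<omega>. indicator A \<omega> * (X (min t r) \<omega> - X 0 \<omega> - (X (min s r) \<omega> - X 0 \<omega>))) = 0"
  proof (cases "s \<le> r")
    case True
    then show ?thesis using orthogonal_past[OF \<alpha>, of s "min t r" A] st A by (simp add: min_absorb1)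
  next
    case False
    then show ?thesis using st by (simp add: min_absorb2)
  qed
qed

lemma martingale_X:
  assumes "\<alpha> = 0"
  shows "martingale M filt X"
proof (rule martingaleI_orthogonal[OF subalgebra_filt])
  show "adapted_process filt X" unfolding adapted_process_def using X_filt by auto
qed (use X_integrable orthogonal_past[OF assms] in auto)

lemma semimartingale_0:
  assumes "\<alpha> = 0"
  shows "semimartingale M filt X"
  unfolding semimartingale_def
proof (rule conjI)
  show "adapted_process filt X" unfolding adapted_process_def using X_filt by auto
next
  show "\<exists>N A. local_martingale M filt N \<and> finite_variation_process M filt A \<and>
        (AE \<omega> in M. N 0 \<omega> = 0 \<and> A 0 \<omega> = 0 \<and> (\<forall>t\<ge>0. X t \<omega> = X 0 \<omega> + N t \<omega> + A t \<omega>))"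
  proof (rule exI[of _ "\<lambda>t \<omega>. X t \<omega> - X 0 \<omega>"], rule exI[of _ "\<lambda>t \<omega>. 0"], intro conjI)
  show "finite_variation_process M filt (\<lambda>t \<omega>. 0)"
    by (auto simp: finite_variation_process_def adapted_process_def cadlag_path_def finite_variation_path_def)
  show "local_martingale M filt (\<lambda>t \<omega>. X t \<omega> - X 0 \<omega>)"
    unfolding local_martingale_def
  \<comment> \<open>Constant localizing times are enough, as the process is already a
    martingale.\<close>
  proof (intro conjI exI[of _ "\<lambda>n _. real n"] allI)
    show "adapted_process filt (\<lambda>t \<omega>. X t \<omega> - X 0 \<omega>)"
      unfolding adapted_process_def by (intro allI impI borel_measurable_diff X_filt) auto
    show "AE \<omega> in M. cadlag_path (\<lambda>t. X t \<omega> - X 0 \<omega>)"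
      using AE_cadlag_X by eventually_elim (rule cadlag_shift)
    show "AE \<omega> in M. incseq (\<lambda>n. real n) \<and> filterlim (\<lambda>n. real n) at_top sequentially"
      by (simp add: incseq_def filterlim_real_sequentially)
    show "martingale M filt (\<lambda>t \<omega>. X (min t (real n)) \<omega> - X 0 \<omega> - (X 0 \<omega> - X 0 \<omega>))" for n
      using martingale_stopped[OF assms, of "real n"] by simp
  qed (auto intro: stopping_time_const)
  qed simp
qed

end

subsection \<open>Differentiability from second differences at dyadic points\<close>

definition dyadic_slope :: "(real \<Rightarrow> real) \<Rightarrow> nat \<Rightarrow> int \<Rightarrow> real" where
  "dyadic_slope f n j = 2 ^ n * (f (of_int (j + 1) / 2 ^ n) - f (of_int j / 2 ^ n))"

lemma dyadic_floor:
  "of_int \<lfloor>s * 2 ^ n\<rfloor> / 2 ^ n \<le> (s :: real)" "s < of_int \<lfloor>s * 2 ^ n\<rfloor> / 2 ^ n + 1 / 2 ^ n"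
proof -
  show "of_int \<lfloor>s * 2 ^ n\<rfloor> / 2 ^ n \<le> s" by (simp add: divide_le_eq)
  have "s * 2 ^ n < of_int \<lfloor>s * 2 ^ n\<rfloor> + 1" by linarith
  then show "s < of_int \<lfloor>s * 2 ^ n\<rfloor> / 2 ^ n + 1 / 2 ^ n"
    by (simp add: less_divide_eq flip: add_divide_distrib)
qed

lemma dyadic_floor_tendsto: "(\<lambda>n. of_int \<lfloor>s * 2 ^ n\<rfloor> / 2 ^ n) \<longlonglongrightarrow> (s :: real)"
proof (rule tendsto_sandwich)
  show "\<forall>\<^sub>F n in sequentially. s - (1 / 2) ^ n \<le> of_int \<lfloor>s * 2 ^ n\<rfloor> / 2 ^ n"
  proof (intro always_eventually allI)
    show "s - (1 / 2) ^ n \<le> of_int \<lfloor>s * 2 ^ n\<rfloor> / 2 ^ n" for n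
      using dyadic_floor(2)[of s n] by (simp add: power_one_over)
  qed
  show "\<forall>\<^sub>F n in sequentially. of_int \<lfloor>s * 2 ^ n\<rfloor> / 2 ^ n \<le> s"
    using dyadic_floor(1)[of s] by (intro always_eventually allI)
  have "(\<lambda>n. (1 / 2 :: real) ^ n) \<longlonglongrightarrow> 0" by (rule LIMSEQ_power_zero) simp
  from tendsto_diff[OF tendsto_const[of s] this] show "(\<lambda>n. s - (1 / 2) ^ n) \<longlonglongrightarrow> s" by simp
qed simp

text \<open>Multiplied by \<open>2 ^ n\<close>, a second difference is the difference of two
  adjacent slopes of level n. So refining a dyadic interval changes the slope by at most
  \<open>r ^ n\<close>, and the slopes at a point converge geometrically, uniformly near t. Adding
  up fine slopes between two grid points near t gives a linear approximation with slope g and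
  relative error \<open>r ^ n * q\<close>; continuity of f extends it to all points near t. The
  windows in the hypothesis allow its n0 to depend on the distance from 0 and infinity.\<close>

lemma dyadic_slopes_derivative:
  fixes f :: "real \<Rightarrow> real" and r :: real
  assumes r: "0 < r" "r < 1" and cont: "continuous_on {0..} f"
    and sd: "\<And>N::nat. \<exists>n0. \<forall>n\<ge>n0. \<forall>j::int. 1 / real (Suc N) \<le> of_int j / 2 ^ n \<and> of_int j / 2 ^ n \<le> real (Suc N) \<longrightarrow>
      \<bar>f (of_int (j + 1) / 2 ^ n) - 2 * f (of_int j / 2 ^ n) + f (of_int (j - 1) / 2 ^ n)\<bar> \<le> r ^ n / 2 ^ n"
    and t: "0 < t"
  shows "(f has_real_derivative lim (\<lambda>n. dyadic_slope f n \<lfloor>t * 2 ^ n\<rfloor>)) (at t)"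
proof -
  let ?sl = "dyadic_slope f"
  define D where "D n s = ?sl n \<lfloor>s * 2 ^ n\<rfloor>" for n and s :: real
  \<comment> \<open>This window contains [t/4, t+2]. The points considered lie in [t/2, t+1] and are
    rounded to the grid by at most t/4 and at most 1.\<close>
  obtain N :: nat where N: "max (4 / t) (t + 2) < real N" using reals_Archimedean2 by blast
  then have N': "1 / real (Suc N) \<le> t / 4" "t + 2 \<le> real (Suc N)"
    using t by (auto simp: field_simps)
  obtain n0 where n0: "\<And>n j. n0 \<le> n \<Longrightarrow> 1 / real (Suc N) \<le> of_int j / 2 ^ n \<Longrightarrow> of_int j / 2 ^ n \<le> real (Suc N) \<Longrightarrow>
      \<bar>f (of_int (j + 1) / 2 ^ n) - 2 * f (of_int j / 2 ^ n) + f (of_int (j - 1) / 2 ^ n)\<bar> \<le> r ^ n / 2 ^ n"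
    using sd[of N] by blast
  have adj: "\<bar>?sl n j - ?sl n (j - 1)\<bar> \<le> r ^ n"
    if "n0 \<le> n" "t / 4 \<le> of_int j / 2 ^ n" "of_int j / 2 ^ n \<le> t + 2" for n j
  proof -
    have "?sl n j - ?sl n (j - 1) = 2 ^ n * (f (of_int (j + 1) / 2 ^ n) - 2 * f (of_int j / 2 ^ n) + f (of_int (j - 1) / 2 ^ n))"
      by (simp add: dyadic_slope_def algebra_simps)
    also have "\<bar>\<dots>\<bar> \<le> 2 ^ n * (r ^ n / 2 ^ n)"
    proof -
      have "\<bar>f (of_int (j + 1) / 2 ^ n) - 2 * f (of_int j / 2 ^ n) + f (of_int (j - 1) / 2 ^ n)\<bar> \<le> r ^ n / 2 ^ n"
      proof (rule n0[OF that(1)])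
        show "1 / real (Suc N) \<le> of_int j / 2 ^ n" using that N' by linarith
        show "of_int j / 2 ^ n \<le> real (Suc N)" using that N' by linarith
      qed
      then show ?thesis unfolding abs_mult by (intro mult_mono) auto
    qed
    finally show ?thesis by simp
  qed
  obtain n1 :: nat where n1: "(1 / 2) ^ n1 < min (t / 4) 1"
    using real_arch_pow_inv[of "min (t / 4) 1" "1 / 2"] t by auto
  define n2 where "n2 = max n0 n1"
  have small: "1 / 2 ^ n \<le> t / 4" "1 / 2 ^ n \<le> (1::real)" if "n2 \<le> n" for n
  proof -
    have "(1 / 2 :: real) ^ n \<le> (1 / 2) ^ n1" using that by (intro power_decreasing) (auto simp: n2_def)
    then show "1 / 2 ^ n \<le> t / 4" "1 / 2 ^ n \<le> (1::real)" using n1 by (auto simp: power_one_over)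
  qed
  have ar: "t / 4 \<le> A" "A \<le> t + 2" "t / 4 \<le> A + z / 2" "A + z / 2 \<le> t + 2"
    if "A \<le> s" "s < A + z" "z \<le> t / 4" "z \<le> 1" "t / 2 \<le> s" "s \<le> t + 1" for A z s :: real
    using that t by linarith+
  have refine: "\<bar>D (Suc n) s - D n s\<bar> \<le> r ^ n" if n: "n2 \<le> n" and s: "t / 2 \<le> s" "s \<le> t + 1" for n s
  proof -
    define j where "j = \<lfloor>s * 2 ^ n\<rfloor>"
    have j: "of_int j / 2 ^ n \<le> s" "s < of_int j / 2 ^ n + 1 / 2 ^ n"
      using dyadic_floor[of s n] by (auto simp: j_def)
    define i where "i = \<lfloor>s * 2 ^ Suc n\<rfloor>"
    have i: "i = 2 * j \<or> i = 2 * j + 1"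
      unfolding i_def j_def by (simp add: mult.assoc[symmetric] mult.commute[of _ 2]) linarith
    have e: "of_int (2 * j) / 2 ^ Suc n = (of_int j / 2 ^ n :: real)"
      "of_int (2 * j + 1 + 1) / 2 ^ Suc n = (of_int (j + 1) / 2 ^ n :: real)"
      by (simp_all add: field_simps)
    \<comment> \<open>A slope is the mean of the two slopes one level further down.\<close>
    have dn: "?sl n j = (?sl (Suc n) (2 * j + 1) + ?sl (Suc n) (2 * j)) / 2"
      unfolding dyadic_slope_def e by (simp add: algebra_simps)
    have "\<bar>?sl (Suc n) (2 * j + 1) - ?sl (Suc n) (2 * j + 1 - 1)\<bar> \<le> r ^ Suc n"
    proof (rule adj)
      show "n0 \<le> Suc n" using n by (simp add: n2_def)
      have m: "of_int (2 * j + 1) / 2 ^ Suc n = (of_int j / 2 ^ n :: real) + (1 / 2 ^ n) / 2" by (simp add: field_simps)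
      show "t / 4 \<le> of_int (2 * j + 1) / 2 ^ Suc n" unfolding m by (rule ar(3)[OF j small[OF n] s])
      show "of_int (2 * j + 1) / 2 ^ Suc n \<le> t + 2" unfolding m by (rule ar(4)[OF j small[OF n] s])
    qed
    then have "\<bar>?sl (Suc n) (2 * j + 1) - ?sl (Suc n) (2 * j)\<bar> \<le> r * r ^ n" by simp
    also have "\<dots> \<le> 1 * r ^ n" using r by (intro mult_right_mono) auto
    finally have "\<bar>?sl (Suc n) (2 * j + 1) - ?sl (Suc n) (2 * j)\<bar> \<le> r ^ n" by simp
    moreover have "0 \<le> r ^ n" using r by simp
    ultimately have "\<bar>?sl (Suc n) i - ?sl n j\<bar> \<le> r ^ n" using i unfolding dn by (elim disjE) (simp_all add: abs_if field_simps split: if_splits)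
    then show ?thesis by (simp only: D_def i_def[symmetric] j_def[symmetric])
  qed
  have tail: "\<bar>D m s - D n s\<bar> \<le> r ^ n / (1 - r)" if n: "n2 \<le> n" "n \<le> m" and s: "t / 2 \<le> s" "s \<le> t + 1" for n m s
  proof -
    have "\<bar>D (n + k) s - D n s\<bar> \<le> (r ^ n - r ^ (n + k)) / (1 - r)" for k
    proof (induction k)
      case (Suc k)
      have "\<bar>D (n + Suc k) s - D n s\<bar> \<le> \<bar>D (Suc (n + k)) s - D (n + k) s\<bar> + \<bar>D (n + k) s - D n s\<bar>" by simp
      also have "\<dots> \<le> r ^ (n + k) + (r ^ n - r ^ (n + k)) / (1 - r)"
        using n by (intro add_mono Suc refine s) auto
      also have "\<dots> = (r ^ n - r ^ (n + Suc k)) / (1 - r)" using r by (simp add: field_simps)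
      finally show ?case .
    qed simp
    from this[of "m - n"] have "\<bar>D m s - D n s\<bar> \<le> (r ^ n - r ^ m) / (1 - r)" using n by simp
    also have "\<dots> \<le> r ^ n / (1 - r)" using r by (intro divide_right_mono) auto
    finally show ?thesis .
  qed
  have rlim: "(\<lambda>n. r ^ n * q) \<longlonglongrightarrow> 0" for q
    using tendsto_mult_right[OF LIMSEQ_power_zero[of r], of q] r by simp
  define g where "g = lim (\<lambda>n. D n t)"
  have "Cauchy (\<lambda>n. D n t)"
  proof (rule CauchyI')
    fix e :: real assume "0 < e"
    from order_tendstoD(2)[OF rlim this, of "1 / (1 - r)"] obtain n3 where n3: "\<And>n. n3 \<le> n \<Longrightarrow> r ^ n * (1 / (1 - r)) < e"
      by (auto simp: eventually_sequentially)
    show "\<exists>M. \<forall>m\<ge>M. \<forall>n>m. dist (D m t) (D n t) < e"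
    proof (intro exI[of _ "max n2 n3"] allI impI)
      fix m n assume "max n2 n3 \<le> m" "m < n"
      then have "\<bar>D n t - D m t\<bar> \<le> r ^ m / (1 - r)" "r ^ m * (1 / (1 - r)) < e"
        using t by (intro tail n3; simp)+
      then have "\<bar>D n t - D m t\<bar> < e" by simp
      then show "dist (D m t) (D n t) < e" by (simp add: dist_real_def abs_minus_commute)
    qed
  qed
  then have Dg: "(\<lambda>n. D n t) \<longlonglongrightarrow> g"
    unfolding g_def using Cauchy_convergent convergent_LIMSEQ_iff by blast
  have gt: "\<bar>g - D n t\<bar> \<le> r ^ n / (1 - r)" if "n2 \<le> n" for n
  proof -
    have "(\<lambda>m. \<bar>D m t - D n t\<bar>) \<longlonglongrightarrow> \<bar>g - D n t\<bar>"
      by (rule tendsto_rabs[OF tendsto_diff[OF Dg tendsto_const]])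
    moreover have "\<forall>m\<ge>n. \<bar>D m t - D n t\<bar> \<le> r ^ n / (1 - r)"
      using that t by (intro allI impI tail) simp_all
    ultimately show ?thesis by (intro LIMSEQ_le_const2) blast+
  qed
  \<comment> \<open>Two tails \<open>r ^ n / (1 - r)\<close>, at s and at t, and one jump
    \<open>r ^ n\<close> between neighbouring intervals of level n.\<close>
  define q where "q = 2 / (1 - r) + 1"
  have near: "\<bar>D m s - g\<bar> \<le> r ^ n * q"
    if n: "n2 \<le> n" "n \<le> m" and s: "t / 2 \<le> s" "s \<le> t + 1" "\<bar>s - t\<bar> < 1 / 2 ^ n" for n m s
  proof -
    define j i where "j = \<lfloor>s * 2 ^ n\<rfloor>" and "i = \<lfloor>t * 2 ^ n\<rfloor>"
    have "\<bar>s * 2 ^ n - t * 2 ^ n\<bar> < 1"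
      using s(3) by (simp add: less_divide_eq abs_mult flip: left_diff_distrib)
    then have ij: "j = i \<or> j = i + 1 \<or> i = j + 1" unfolding j_def i_def by linarith
    have dj: "of_int j / 2 ^ n \<le> s" "s < of_int j / 2 ^ n + 1 / 2 ^ n"
      using dyadic_floor[of s n] by (auto simp: j_def)
    have di: "of_int i / 2 ^ n \<le> t" "t < of_int i / 2 ^ n + 1 / 2 ^ n"
      using dyadic_floor[of t n] by (auto simp: i_def)
    have "\<bar>?sl n j - ?sl n i\<bar> \<le> r ^ n"
      using ij
    proof (elim disjE)
      assume "j = i"
      then show ?thesis using r by simp
    next
      assume "j = i + 1"
      moreover have "\<bar>?sl n j - ?sl n (j - 1)\<bar> \<le> r ^ n"
        using n(1) by (intro adj ar(1,2)[OF dj small[OF n(1)] s(1,2)]) (simp add: n2_def)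
      ultimately show ?thesis by simp
    next
      assume "i = j + 1"
      moreover have "\<bar>?sl n i - ?sl n (i - 1)\<bar> \<le> r ^ n"
        using n(1) t by (intro adj ar(1,2)[OF di small[OF n(1)]]) (simp_all add: n2_def)
      ultimately show ?thesis by (simp add: abs_minus_commute)
    qed
    then have "\<bar>D n s - D n t\<bar> \<le> r ^ n" by (simp only: D_def j_def i_def)
    moreover have "\<bar>D m s - D n s\<bar> \<le> r ^ n / (1 - r)" using tail n s by blast
    moreover have "\<bar>g - D n t\<bar> \<le> r ^ n / (1 - r)" using gt n by blast
    moreover have "r ^ n * q = r ^ n / (1 - r) + r ^ n / (1 - r) + r ^ n" by (simp add: q_def algebra_simps)
    ultimately show ?thesis by linarith
  qed
  have bound: "\<bar>f y - f x - g * (y - x)\<bar> \<le> r ^ n * q * (y - x)"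
    if n: "n2 \<le> n" and x: "t / 2 < x" "t - 1 / 2 ^ n < x" and xy: "x \<le> y" and y: "y < t + 1" "y < t + 1 / 2 ^ n" for n x y
  proof -
    define a b where "a m = \<lfloor>x * 2 ^ m\<rfloor>" and "b m = \<lfloor>y * 2 ^ m\<rfloor>" for m :: nat
    define X Y where "X m = (of_int (a m) / 2 ^ m :: real)" and "Y m = (of_int (b m) / 2 ^ m :: real)" for m
    have Xl: "X \<longlonglongrightarrow> x" and Yl: "Y \<longlonglongrightarrow> y"
      unfolding X_def[abs_def] Y_def[abs_def] a_def b_def by (rule dyadic_floor_tendsto)+
    have Yy: "Y m \<le> y" for m using dyadic_floor(1) by (simp add: Y_def b_def)
    have ab: "a m \<le> b m" for m unfolding a_def b_def using xy by (intro floor_mono mult_right_mono) auto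
    have "\<forall>\<^sub>F m in sequentially. max (t / 2) (t - 1 / 2 ^ n) < X m"
      by (rule order_tendstoD(1)[OF Xl]) (use x in simp)
    then have ev: "\<forall>\<^sub>F m in sequentially. \<bar>f (Y m) - f (X m) - g * (Y m - X m)\<bar> \<le> r ^ n * q * (Y m - X m)"
      using eventually_ge_at_top[of n]
    proof eventually_elim
      fix m assume Xm: "max (t / 2) (t - 1 / 2 ^ n) < X m" and m: "n \<le> m"
      define k where "k = nat (b m - a m)"
      \<comment> \<open>Walking along the grid of level m from \<open>X m\<close>, every interval
        adds an error of at most \<open>r ^ n * q\<close> times its length.\<close>
      have "\<bar>f (of_int (a m + int k) / 2 ^ m) - f (X m) - g * (real k / 2 ^ m)\<bar> \<le> r ^ n * q * (real k / 2 ^ m)"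
        if "int k \<le> b m - a m" for k
        using that
      proof (induction k)
        case 0
        then show ?case by (simp add: X_def)
      next
        case (Suc k)
        define s where "s = (of_int (a m + int k) / 2 ^ m :: real)"
        have s: "X m \<le> s" "s \<le> Y m" using Suc.prems by (auto simp: s_def X_def Y_def divide_right_mono)
        have "\<bar>D m s - g\<bar> \<le> r ^ n * q"
        proof (rule near[OF n m])
          show "t / 2 \<le> s" using s(1) Xm by simp
          show "s \<le> t + 1" using s(2) Yy[of m] y by simp
          have "t - 1 / 2 ^ n < s" "s < t + 1 / 2 ^ n"
            using less_le_trans[of "t - 1 / 2 ^ n" "X m" s] le_less_trans[of s y "t + 1 / 2 ^ n"] s Xm Yy[of m] y by auto
          then show "\<bar>s - t\<bar> < 1 / 2 ^ n" by (simp add: abs_less_iff algebra_simps)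
        qed
        moreover have "D m s = ?sl m (a m + int k)" by (simp add: D_def s_def)
        ultimately have "\<bar>2 ^ m * (f (of_int (a m + int k + 1) / 2 ^ m) - f s) - g\<bar> \<le> r ^ n * q"
          by (simp add: dyadic_slope_def s_def)
        then have "\<bar>(2 ^ m * (f (of_int (a m + int k + 1) / 2 ^ m) - f s) - g) / 2 ^ m\<bar> \<le> r ^ n * q / 2 ^ m"
          by (simp add: divide_right_mono)
        then have "\<bar>f (of_int (a m + int k + 1) / 2 ^ m) - f s - g / 2 ^ m\<bar> \<le> r ^ n * q / 2 ^ m"
          by (simp add: diff_divide_distrib)
        moreover have "\<bar>f s - f (X m) - g * (real k / 2 ^ m)\<bar> \<le> r ^ n * q * (real k / 2 ^ m)"
          using Suc by (simp add: s_def)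
        moreover have "a m + int (Suc k) = a m + int k + 1" by simp
        moreover have "g * (real (Suc k) / 2 ^ m) = g * (real k / 2 ^ m) + g / 2 ^ m"
          "r ^ n * q * (real (Suc k) / 2 ^ m) = r ^ n * q * (real k / 2 ^ m) + r ^ n * q / 2 ^ m"
          by (simp_all add: add_divide_distrib algebra_simps)
        ultimately show ?case by (simp only:)
      qed
      from this[of k] ab[of m] have "\<bar>f (of_int (a m + int k) / 2 ^ m) - f (X m) - g * (real k / 2 ^ m)\<bar> \<le> r ^ n * q * (real k / 2 ^ m)"
        by (simp add: k_def)
      moreover have "a m + int k = b m" using ab[of m] by (simp add: k_def)
      moreover have "real k / 2 ^ m = Y m - X m"
        using ab[of m] by (simp add: k_def X_def Y_def diff_divide_distrib)
      ultimately show "\<bar>f (Y m) - f (X m) - g * (Y m - X m)\<bar> \<le> r ^ n * q * (Y m - X m)"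
        by (simp add: Y_def[of m, symmetric])
    qed
    have cf: "isCont f z" if "0 < z" for z
    proof -
      have "continuous_on {0<..} f" using cont by (rule continuous_on_subset) auto
      then show ?thesis using that by (simp add: continuous_on_eq_continuous_at)
    qed
    have fl: "(\<lambda>m. f (X m)) \<longlonglongrightarrow> f x" "(\<lambda>m. f (Y m)) \<longlonglongrightarrow> f y"
      using isCont_tendsto_compose[OF cf Xl] isCont_tendsto_compose[OF cf Yl] x xy t by auto
    show ?thesis
    proof (rule tendsto_le[OF _ _ _ ev])
      show "(\<lambda>m. \<bar>f (Y m) - f (X m) - g * (Y m - X m)\<bar>) \<longlonglongrightarrow> \<bar>f y - f x - g * (y - x)\<bar>"
        by (intro tendsto_intros fl Xl Yl)
      show "(\<lambda>m. r ^ n * q * (Y m - X m)) \<longlonglongrightarrow> r ^ n * q * (y - x)"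
        by (intro tendsto_intros Xl Yl)
    qed simp
  qed
  have "(f has_derivative (*) g) (at t)"
    unfolding has_derivative_within_alt
  proof (intro conjI allI impI bounded_linear_mult_right)
    fix e :: real assume e: "0 < e"
    from order_tendstoD(2)[OF rlim e, of q] obtain n3 where n3: "\<And>n. n3 \<le> n \<Longrightarrow> r ^ n * q < e"
      by (auto simp: eventually_sequentially)
    define n where "n = max n2 n3"
    have n: "n2 \<le> n" "r ^ n * q < e" using n3 by (auto simp: n_def)
    define d where "d = min (t / 2) (1 / 2 ^ n)"
    have d: "0 < d" using t by (simp add: d_def)
    show "\<exists>d>0. \<forall>y\<in>UNIV. norm (y - t) < d \<longrightarrow> norm (f y - f t - g * (y - t)) \<le> e * norm (y - t)"
    proof (intro exI[of _ d] conjI d ballI impI)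
      fix y assume "norm (y - t) < d"
      then have y: "\<bar>y - t\<bar> < t / 2" "\<bar>y - t\<bar> < 1 / 2 ^ n" "\<bar>y - t\<bar> < 1"
        using less_le_trans[OF _ small(2)[OF n(1)], of "\<bar>y - t\<bar>"] by (auto simp: d_def)
      have "\<bar>f y - f t - g * (y - t)\<bar> \<le> r ^ n * q * \<bar>y - t\<bar>"
      proof (cases "t \<le> y")
        case True
        then have "\<bar>f y - f t - g * (y - t)\<bar> \<le> r ^ n * q * (y - t)"
          using y t by (intro bound[OF n(1)]) auto
        then show ?thesis using True by simp
      next
        case False
        have "\<bar>f t - f y - g * (t - y)\<bar> \<le> r ^ n * q * (t - y)"
          using False y t by (intro bound[OF n(1)]) auto
        moreover have eq: "f y - f t - g * (y - t) = - (f t - f y - g * (t - y))" by (simp add: algebra_simps)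
        ultimately show ?thesis using False unfolding eq abs_minus_cancel by simp
      qed
      also have "\<dots> \<le> e * \<bar>y - t\<bar>" using n(2) by (intro mult_right_mono) auto
      finally show "norm (f y - f t - g * (y - t)) \<le> e * norm (y - t)" by simp
    qed
  qed
  then show ?thesis by (simp only: has_field_derivative_def g_def D_def)
qed

subsection \<open>The smooth case\<close>

text \<open>Markov's inequality for the moment of order \<open>2 * p\<close>. The free p is later
  taken large enough to beat the number of grid points.\<close>

lemma (in prob_space) gaussian_rv_tail:
  assumes g: "gaussian_rv v Z" and v: "v \<le> V" and l: "0 < l"
  shows "prob {\<omega>\<in>space M. l < \<bar>Z \<omega>\<bar>} \<le> fact (2 * p) / (2 ^ p * fact p) * (V / l\<^sup>2) ^ p"
proof -
  have [measurable]: "Z \<in> borel_measurable M" and v0: "0 \<le> v" using g by (auto simp: gaussian_rv_def)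
  define A where "A = {\<omega>\<in>space M. l < \<bar>Z \<omega>\<bar>}"
  have [measurable]: "A \<in> sets M" unfolding A_def by measurable
  have Ai: "integrable M (\<lambda>\<omega>. l ^ (2 * p) * indicator A \<omega>)"
    by (intro integrable_mult_right integrable_real_indicator) (simp_all add: emeasure_eq_measure)
  have "l ^ (2 * p) * prob A = expectation (\<lambda>\<omega>. l ^ (2 * p) * indicator A \<omega>)" by simp
  also have "\<dots> \<le> expectation (\<lambda>\<omega>. Z \<omega> ^ (2 * p))"
  proof (rule integral_mono[OF Ai gaussian_rv_moment(1)[OF g]])
    fix \<omega>
    show "l ^ (2 * p) * indicator A \<omega> \<le> Z \<omega> ^ (2 * p)"
    proof (cases "\<omega> \<in> A")
      case True
      then have "l ^ (2 * p) \<le> \<bar>Z \<omega>\<bar> ^ (2 * p)" using l by (intro power_mono) (auto simp: A_def)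
      then show ?thesis using True by (simp add: power_mult)
    qed (simp add: zero_le_even_power)
  qed
  also have "\<dots> = v ^ p * (fact (2 * p) / (2 ^ p * fact p))" by (rule gaussian_rv_moment(2)[OF g])
  also have "\<dots> \<le> V ^ p * (fact (2 * p) / (2 ^ p * fact p))"
    using v v0 by (intro mult_right_mono power_mono) auto
  finally have "prob A \<le> V ^ p * (fact (2 * p) / (2 ^ p * fact p)) / l ^ (2 * p)"
    using l by (simp only: pos_le_divide_eq zero_less_power mult.commute[of "prob A"])
  also have "\<dots> = fact (2 * p) / (2 ^ p * fact p) * (V / l\<^sup>2) ^ p"
    by (simp add: power_divide power_mult)
  finally show ?thesis by (simp add: A_def)
qed

lemma rl_kernel_integral:
  assumes "0 < \<gamma>" "\<gamma> < 1" "1 / 2 < a" "a < (1 + \<gamma>) / 2"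
  obtains K where "0 \<le> K" "\<And>t. 0 < t \<Longrightarrow> integrable lborel (\<lambda>u. (rl_kernel a \<gamma> t u)\<^sup>2)"
    "\<And>t. 0 < t \<Longrightarrow> (\<integral>u. (rl_kernel a \<gamma> t u)\<^sup>2 \<partial>lborel) = K * t powr (2 * a - 1 - \<gamma>)"
proof -
  obtain K where K: "0 \<le> K"
    "\<And>t. 0 < t \<Longrightarrow> (\<integral>\<^sup>+ u. ennreal ((rl_kernel a \<gamma> t u)\<^sup>2) \<partial>lborel) = ennreal (K * t powr (2 * a - 1 - \<gamma>))"
    using rl_kernel_norm[OF assms] by blast
  show thesis
  proof (rule that[OF K(1)])
    fix t :: real assume t: "0 < t"
    show "integrable lborel (\<lambda>u. (rl_kernel a \<gamma> t u)\<^sup>2)"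
      using K(2)[OF t] by (intro integrableI_nonneg) auto
    show "(\<integral>u. (rl_kernel a \<gamma> t u)\<^sup>2 \<partial>lborel) = K * t powr (2 * a - 1 - \<gamma>)"
      using K(1) by (subst integral_eq_nn_integral) (auto simp: K(2)[OF t])
  qed
qed

text \<open>Increments of f are dominated by those of the integral of
  \<open>\<bar>y s\<bar>\<close>, which telescope.\<close>

lemma finite_variation_path_integral:
  assumes i: "\<And>t. 0 \<le> t \<Longrightarrow> set_integrable lborel {0<..t} y"
    and f: "\<And>t. 0 \<le> t \<Longrightarrow> f t = (LBINT s:{0<..t}. y s)"
  shows "finite_variation_path f"
  unfolding finite_variation_path_def
proof (intro allI impI)
  fix T :: real assume "0 \<le> T"
  define G where "G t = (LBINT s:{0<..t}. \<bar>y s\<bar>)" for t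
  have ia: "set_integrable lborel {0<..t} (\<lambda>s. \<bar>y s\<bar>)" if "0 \<le> t" for t
    using set_integrable_norm[OF i[OF that]] by simp
  have inc: "\<bar>f b - f a\<bar> \<le> G b - G a" if ab: "0 \<le> a" "a \<le> b" for a b
  proof -
    have b0: "0 \<le> b" using ab by simp
    have un: "{0<..b} = {0<..a} \<union> {a<..b}" using ab by auto
    have iy: "set_integrable lborel {a<..b} y" "set_integrable lborel {a<..b} (\<lambda>s. \<bar>y s\<bar>)"
      using ab by (auto intro!: set_integrable_subset[OF i[OF b0]] set_integrable_subset[OF ia[OF b0]])
    have "f b = f a + (LBINT s:{a<..b}. y s)"
      unfolding f[OF b0] f[OF ab(1)] un using i[OF ab(1)] iy(1) by (intro set_integral_Un) auto
    moreover have "G b = G a + (LBINT s:{a<..b}. \<bar>y s\<bar>)"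
      unfolding G_def un using ia[OF ab(1)] iy(2) by (intro set_integral_Un) auto
    moreover have "\<bar>LBINT s:{a<..b}. y s\<bar> \<le> (LBINT s:{a<..b}. \<bar>y s\<bar>)"
      using set_integral_norm_bound[OF iy(1)] by simp
    ultimately show ?thesis by simp
  qed
  show "\<exists>K. \<forall>(n::nat) p. 0 \<le> p 0 \<and> (\<forall>i<n. p i \<le> p (Suc i)) \<and> p n \<le> T \<longrightarrow>
     (\<Sum>i<n. \<bar>f (p (Suc i)) - f (p i)\<bar>) \<le> K"
  proof (intro exI[of _ "G T"] allI impI, elim conjE)
    fix n :: nat and p :: "nat \<Rightarrow> real"
    assume p: "0 \<le> p 0" "\<forall>i<n. p i \<le> p (Suc i)" "p n \<le> T"
    have nn: "0 \<le> p i" if "i \<le> n" for i using that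
    proof (induction i)
      case (Suc i)
      then have "0 \<le> p i" "p i \<le> p (Suc i)" using p(2) by auto
      then show ?case by simp
    qed (use p in auto)
    have "(\<Sum>i<n. \<bar>f (p (Suc i)) - f (p i)\<bar>) \<le> (\<Sum>i<n. G (p (Suc i)) - G (p i))"
      using p(2) nn by (intro sum_mono inc) auto
    also have "\<dots> = G (p n) - G (p 0)" by (rule sum_lessThan_telescope)
    also have "\<dots> \<le> G T"
    proof -
      have "0 \<le> G (p 0)" unfolding G_def set_lebesgue_integral_def by (intro Bochner_Integration.integral_nonneg) auto
      moreover have "G (p n) \<le> G T" using inc[of "p n" T] nn[of n] p(3) by linarith
      ultimately show ?thesis by simp
    qed
    finally show "(\<Sum>i<n. \<bar>f (p (Suc i)) - f (p i)\<bar>) \<le> G T" .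
  qed
qed

lemma finite_variation_path_shift:
  "finite_variation_path f \<Longrightarrow> finite_variation_path (\<lambda>t. f t - a)"
  unfolding finite_variation_path_def by simp

locale gfbm_smooth = gfbm_process +
  assumes \<gamma>_pos: "0 < \<gamma>" and \<alpha>_gt: "1 / 2 < \<alpha>"
begin

text \<open>Half of the room in \<open>1 / 2 < \<alpha>\<close>: difference quotients of the kernel of order \<open>\<alpha>\<close> are bounded by
  \<open>h powr \<theta>\<close> times the kernel of order \<open>\<alpha> - \<theta>\<close>, which is still square integrable.\<close>

definition \<theta> :: real where
  "\<theta> = (\<alpha> - 1 / 2) / 2"

lemma exponents:
  "0 < \<alpha>" "\<alpha> < 1" "\<alpha> < (1 + \<gamma>) / 2" "0 < \<theta>" "\<theta> < 1" "1 / 2 < \<alpha> - \<theta>" "\<alpha> - \<theta> < (1 + \<gamma>) / 2"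
  using \<alpha>_gt \<alpha>_upper \<gamma>_less by (auto simp: \<theta>_def field_simps)

text \<open>The second difference of the kernel is dominated by
  \<open>36 * c * h powr (1 + \<theta>)\<close> times a kernel of order
  \<open>\<alpha> - \<theta>\<close> at time \<open>t + h\<close>, whose norm is known by scaling.
  The exponent of \<open>t + h\<close> is negative, so the bound is uniform only away from time
  0.\<close>

lemma second_difference_variance:
  obtains K where "0 \<le> K" "\<And>t h. 0 < h \<Longrightarrow> h \<le> t \<Longrightarrow>
    \<exists>v. v \<le> K * h powr (2 + 2 * \<theta>) * (t + h) powr (2 * (\<alpha> - \<theta>) - 1 - \<gamma>) \<and>
      gaussian_rv v (\<lambda>\<omega>. X (t + h) \<omega> - 2 * X t \<omega> + X (t - h) \<omega>)"
proof -
  obtain K where K: "0 \<le> K" "\<And>t. 0 < t \<Longrightarrow> integrable lborel (\<lambda>u. (rl_kernel (\<alpha> - \<theta>) \<gamma> t u)\<^sup>2)"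
    "\<And>t. 0 < t \<Longrightarrow> (\<integral>u. (rl_kernel (\<alpha> - \<theta>) \<gamma> t u)\<^sup>2 \<partial>lborel) = K * t powr (2 * (\<alpha> - \<theta>) - 1 - \<gamma>)"
    using rl_kernel_integral[OF \<gamma>_pos \<gamma>_less exponents(6,7)] by blast
  show thesis
  proof (rule that[of "(36 * c)\<^sup>2 * K"])
    show "0 \<le> (36 * c)\<^sup>2 * K" using K(1) by simp
    fix t h :: real assume h: "0 < h" "h \<le> t"
    let ?f = "\<lambda>u. c * gfbm_inc \<alpha> \<gamma> t (t + h) u - c * gfbm_inc \<alpha> \<gamma> (t - h) t u"
    let ?g = "\<lambda>u. 36 * c * h powr (1 + \<theta>) * rl_kernel (\<alpha> - \<theta>) \<gamma> (t + h) u"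
    have "hwi ?f (\<lambda>\<omega>. (X (t + h) \<omega> - X t \<omega>) - (X t \<omega> - X (t - h) \<omega>))"
      using h by (intro hwi_diff hwi_inc) auto
    moreover have "(\<lambda>\<omega>. (X (t + h) \<omega> - X t \<omega>) - (X t \<omega> - X (t - h) \<omega>)) = (\<lambda>\<omega>. X (t + h) \<omega> - 2 * X t \<omega> + X (t - h) \<omega>)"
      by (auto simp: algebra_simps)
    ultimately have hw: "hwi ?f (\<lambda>\<omega>. X (t + h) \<omega> - 2 * X t \<omega> + X (t - h) \<omega>)" by simp
    have le: "\<bar>?f u\<bar> \<le> ?g u" for u
    proof -
      have "?f u = c * ((ppow \<alpha> (t + h - u) - 2 * ppow \<alpha> (t + h - u - h) + ppow \<alpha> (t + h - u - 2 * h)) * \<bar>u\<bar> powr (- \<gamma> / 2))"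
        by (simp add: gfbm_inc_def algebra_simps)
      also have "\<bar>\<dots>\<bar> = c * (\<bar>ppow \<alpha> (t + h - u) - 2 * ppow \<alpha> (t + h - u - h) + ppow \<alpha> (t + h - u - 2 * h)\<bar> * \<bar>u\<bar> powr (- \<gamma> / 2))"
        using c_pos by (simp add: abs_mult)
      also have "\<dots> \<le> c * ((36 * h powr (1 + \<theta>) * ppow (\<alpha> - \<theta> - 1) (t + h - u)) * \<bar>u\<bar> powr (- \<gamma> / 2))"
        using c_pos exponents h by (intro mult_left_mono mult_right_mono ppow_second_difference) auto
      also have "\<dots> = ?g u" by (simp add: rl_kernel_def)
      finally show ?thesis .
    qed
    have "(\<integral>u. (?f u)\<^sup>2 \<partial>lborel) \<le> (\<integral>u. (36 * c * h powr (1 + \<theta>))\<^sup>2 * (rl_kernel (\<alpha> - \<theta>) \<gamma> (t + h) u)\<^sup>2 \<partial>lborel)"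
    proof (rule integral_mono[OF hwi_gaussian(1)[OF hw]])
      show "integrable lborel (\<lambda>u. (36 * c * h powr (1 + \<theta>))\<^sup>2 * (rl_kernel (\<alpha> - \<theta>) \<gamma> (t + h) u)\<^sup>2)"
        using K(2)[of "t + h"] h by simp
      fix u
      show "(?f u)\<^sup>2 \<le> (36 * c * h powr (1 + \<theta>))\<^sup>2 * (rl_kernel (\<alpha> - \<theta>) \<gamma> (t + h) u)\<^sup>2"
        using square_le_abs_le[OF le[of u]] by (simp add: power_mult_distrib)
    qed
    also have "\<dots> = (36 * c)\<^sup>2 * K * h powr (2 + 2 * \<theta>) * (t + h) powr (2 * (\<alpha> - \<theta>) - 1 - \<gamma>)"
      using K(3)[of "t + h"] h by (simp add: power_mult_distrib power2_powr distrib_left)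
    finally show "\<exists>v. v \<le> (36 * c)\<^sup>2 * K * h powr (2 + 2 * \<theta>) * (t + h) powr (2 * (\<alpha> - \<theta>) - 1 - \<gamma>) \<and>
      gaussian_rv v (\<lambda>\<omega>. X (t + h) \<omega> - 2 * X t \<omega> + X (t - h) \<omega>)"
      using hwi_gaussian(2)[OF hw] by blast
  qed
qed

text \<open>Borel-Cantelli. A window has at most \<open>Suc N * 2 ^ n\<close> grid points of level
  n. The standard deviations there are of order \<open>2 powr (- (1 + \<theta>) * n)\<close>, the
  threshold is \<open>2 powr (- (1 + \<theta> / 2) * n)\<close>, and the ratio of the variance bound
  to the squared threshold is \<open>A * b ^ n\<close>.\<close>

lemma AE_second_differences_window:
  "AE \<omega> in M. \<exists>n0. \<forall>n\<ge>n0. \<forall>j::int. 1 / real (Suc N) \<le> of_int j / 2 ^ n \<and> of_int j / 2 ^ n \<le> real (Suc N) \<longrightarrow>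
      \<bar>X (of_int (j + 1) / 2 ^ n) \<omega> - 2 * X (of_int j / 2 ^ n) \<omega> + X (of_int (j - 1) / 2 ^ n) \<omega>\<bar> \<le> (2 powr (- \<theta> / 2)) ^ n / 2 ^ n"
proof -
  define r b where "r = 2 powr (- \<theta> / 2)" and "b = 2 powr (- \<theta>)"
  have r: "0 < r" "r\<^sup>2 = b" and b: "0 < b" by (auto simp: r_def b_def power2_powr)
  obtain K where K: "0 \<le> K" "\<And>t h. 0 < h \<Longrightarrow> h \<le> t \<Longrightarrow>
    \<exists>v. v \<le> K * h powr (2 + 2 * \<theta>) * (t + h) powr (2 * (\<alpha> - \<theta>) - 1 - \<gamma>) \<and>
      gaussian_rv v (\<lambda>\<omega>. X (t + h) \<omega> - 2 * X t \<omega> + X (t - h) \<omega>)"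
    using second_difference_variance by blast
  define e where "e = 2 * (\<alpha> - \<theta>) - 1 - \<gamma>"
  have e: "e < 0" using exponents by (simp add: e_def)
  define A where "A = K * (1 / real (Suc N)) powr e"
  have A: "0 \<le> A" using K(1) by (simp add: A_def)
  \<comment> \<open>Makes \<open>b ^ p\<close> at most 1/4, so that the tail bound, of order
    \<open>(1 / 4) ^ n\<close>, stays summable after multiplication by \<open>2 ^ n\<close>
    points.\<close>
  obtain p :: nat where p: "2 / \<theta> < real p" using reals_Archimedean2 by blast
  then have "2 \<le> \<theta> * real p" using exponents(4) by (simp add: pos_divide_less_eq mult.commute)
  then have "2 powr (- \<theta> * real p) \<le> 2 powr (- 2)" by (intro powr_mono) auto
  moreover have bpow: "b ^ k = 2 powr (- \<theta> * real k)" for k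
    using powr_realpow[OF b, of k] by (simp only: b_def powr_powr)
  ultimately have bp: "b ^ p \<le> 1 / 4" by (simp add: powr_minus_divide)
  define Q where "Q = fact (2 * p) / (2 ^ p * fact p) * A ^ p"
  have Q: "0 \<le> Q" using A by (simp add: Q_def)
  define l where "l n = r ^ n / 2 ^ n" for n
  have l: "0 < l n" for n using r by (simp add: l_def)
  define W where "W n j \<omega> = X (of_int (j + 1) / 2 ^ n) \<omega> - 2 * X (of_int j / 2 ^ n) \<omega> + X (of_int (j - 1) / 2 ^ n) \<omega>"
    for n and j :: int and \<omega>
  define J where "J n = {j::int. 1 / real (Suc N) \<le> of_int j / 2 ^ n \<and> of_int j / 2 ^ n \<le> real (Suc N)}" for n :: nat
  have Jsub: "J n \<subseteq> {1..int (Suc N) * 2 ^ n}" for n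
  proof
    fix j assume j: "j \<in> J n"
    then have "0 < of_int j / (2 ^ n :: real)" by (auto simp: J_def intro: less_le_trans[rotated])
    then have "0 < j" by (simp add: zero_less_divide_iff)
    moreover have "of_int j \<le> real (Suc N) * 2 ^ n" using j by (simp add: J_def pos_divide_le_eq)
    then have "real_of_int j \<le> real_of_int (int (Suc N) * 2 ^ n)" by simp
    then have "j \<le> int (Suc N) * 2 ^ n" by (simp only: of_int_le_iff)
    ultimately show "j \<in> {1..int (Suc N) * 2 ^ n}" by simp
  qed
  have finJ: "finite (J n)" for n by (rule finite_subset[OF Jsub]) simp
  have cardJ: "real (card (J n)) \<le> real (Suc N) * 2 ^ n" for n
  proof -
    have "card (J n) \<le> card {1..int (Suc N) * 2 ^ n}" by (rule card_mono[OF _ Jsub]) simp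
    also have "\<dots> = Suc N * 2 ^ n" by (simp add: nat_mult_distrib nat_power_eq del: of_nat_Suc)
    finally have "real (card (J n)) \<le> real (Suc N * 2 ^ n)" by (simp only: of_nat_le_iff)
    also have "real (Suc N * 2 ^ n) = real (Suc N) * 2 ^ n" by (simp only: of_nat_mult of_nat_power of_nat_numeral)
    finally show ?thesis .
  qed
  have Wj: "W n j \<in> borel_measurable M \<and> prob {\<omega>\<in>space M. l n < \<bar>W n j \<omega>\<bar>} \<le> Q * (1 / 4) ^ n" if j: "j \<in> J n" for n j
  proof -
    define t h where "t = (of_int j / 2 ^ n :: real)" and "h = (1 / 2 ^ n :: real)"
    have "1 \<le> j" using subsetD[OF Jsub j] by simp
    then have h: "0 < h" "h \<le> t" by (simp_all add: t_def h_def divide_right_mono)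
    have Weq: "W n j = (\<lambda>\<omega>. X (t + h) \<omega> - 2 * X t \<omega> + X (t - h) \<omega>)"
      by (simp add: W_def[abs_def] t_def h_def add_divide_distrib diff_divide_distrib)
    obtain v where v: "v \<le> K * h powr (2 + 2 * \<theta>) * (t + h) powr e" "gaussian_rv v (W n j)"
      using K(2)[OF h] unfolding Weq e_def by blast
    have "1 / real (Suc N) \<le> t" using j unfolding J_def t_def by blast
    then have "(t + h) powr e \<le> (1 / real (Suc N)) powr e"
      using e h by (intro powr_mono2') (simp_all only: less_imp_le add_increasing2 zero_less_divide_1_iff of_nat_0_less_iff zero_less_Suc)
    then have "K * h powr (2 + 2 * \<theta>) * (t + h) powr e \<le> K * h powr (2 + 2 * \<theta>) * (1 / real (Suc N)) powr e"
      using K(1) by (intro mult_left_mono) auto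
    then have vA: "v \<le> A * h powr (2 + 2 * \<theta>)" using v(1) by (simp add: A_def mult_ac)
    have hp: "h powr (2 + 2 * \<theta>) = h\<^sup>2 * (b ^ n * b ^ n)"
    proof -
      have "h powr (2 * \<theta>) = (h powr \<theta>)\<^sup>2" by (simp add: power2_powr)
      moreover have "h powr \<theta> = b ^ n"
      proof -
        have "h = 2 powr (- real n)" by (simp add: h_def powr_minus_divide powr_realpow)
        then have "h powr \<theta> = 2 powr (- real n * \<theta>)" by (simp only: powr_powr)
        also have "\<dots> = b ^ n" unfolding bpow by (simp add: mult.commute)
        finally show ?thesis .
      qed
      ultimately show ?thesis using h by (simp add: powr_add power2_eq_square)
    qed
    have l2: "(l n)\<^sup>2 = h\<^sup>2 * b ^ n"
    proof -
      have "(r ^ n)\<^sup>2 = b ^ n" unfolding r(2)[symmetric] by (simp add: mult.commute flip: power_mult)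
      then show ?thesis by (simp add: l_def h_def power_divide)
    qed
    have "prob {\<omega>\<in>space M. l n < \<bar>W n j \<omega>\<bar>} \<le> fact (2 * p) / (2 ^ p * fact p) * (A * h powr (2 + 2 * \<theta>) / (l n)\<^sup>2) ^ p"
      by (rule gaussian_rv_tail[OF v(2) vA l])
    also have "A * h powr (2 + 2 * \<theta>) / (l n)\<^sup>2 = A * b ^ n"
      unfolding hp l2 using b h by simp
    also have "(A * b ^ n) ^ p = A ^ p * (b ^ p) ^ n"
      by (simp add: power_mult_distrib mult.commute[of n p] flip: power_mult)
    also have "fact (2 * p) / (2 ^ p * fact p) * (A ^ p * (b ^ p) ^ n) = Q * (b ^ p) ^ n" by (simp add: Q_def)
    also have "\<dots> \<le> Q * (1 / 4) ^ n" using Q bp b by (intro mult_left_mono power_mono) auto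
    finally show ?thesis using v(2) by (simp add: gaussian_rv_def)
  qed
  define E where "E n = (\<Union>j\<in>J n. {\<omega>\<in>space M. l n < \<bar>W n j \<omega>\<bar>})" for n
  have Em: "{\<omega>\<in>space M. l n < \<bar>W n j \<omega>\<bar>} \<in> sets M" if "j \<in> J n" for n j
  proof -
    have [measurable]: "W n j \<in> borel_measurable M" using Wj[OF that] by blast
    show ?thesis by measurable
  qed
  have EM: "E n \<in> sets M" for n unfolding E_def using finJ Em by (intro sets.finite_UN) auto
  have PE: "prob (E n) \<le> real (Suc N) * Q * (1 / 2) ^ n" for n
  proof -
    have "prob (E n) \<le> (\<Sum>j\<in>J n. prob {\<omega>\<in>space M. l n < \<bar>W n j \<omega>\<bar>})"
      unfolding E_def using finJ Em by (intro finite_measure_subadditive_finite) auto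
    also have "\<dots> \<le> (\<Sum>j\<in>J n. Q * (1 / 4) ^ n)" using Wj by (intro sum_mono) auto
    also have "\<dots> = real (card (J n)) * (Q * (1 / 4) ^ n)" by simp
    also have "\<dots> \<le> (real (Suc N) * 2 ^ n) * (Q * (1 / 4) ^ n)"
      using Q by (intro mult_right_mono cardJ) auto
    also have "\<dots> = real (Suc N) * Q * (1 / 2) ^ n"
    proof -
      have "(2 :: real) ^ n * (1 / 4) ^ n = (1 / 2) ^ n" by (simp flip: power_mult_distrib)
      then show ?thesis by simp
    qed
    finally show ?thesis .
  qed
  have "summable (\<lambda>n. prob (E n))"
  proof (rule summable_comparison_test')
    show "summable (\<lambda>n. real (Suc N) * Q * (1 / 2) ^ n)" by (intro summable_mult summable_geometric) simp
    show "norm (prob (E n)) \<le> real (Suc N) * Q * (1 / 2) ^ n" if "0 \<le> n" for n using PE by simp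
  qed
  then have "AE \<omega> in M. \<forall>\<^sub>F n in sequentially. \<omega> \<in> space M - E n"
    using EM by (intro borel_cantelli_AE1) (auto simp: emeasure_eq_measure)
  then show ?thesis
  proof eventually_elim
    fix \<omega> assume "\<forall>\<^sub>F n in sequentially. \<omega> \<in> space M - E n"
    then obtain n0 where n0: "\<And>n. n0 \<le> n \<Longrightarrow> \<omega> \<in> space M - E n" by (auto simp: eventually_sequentially)
    have "\<bar>W n j \<omega>\<bar> \<le> l n" if "n0 \<le> n" "j \<in> J n" for n j
      using n0[OF that(1)] that(2) by (auto simp: E_def not_less)
    then show "\<exists>n0. \<forall>n\<ge>n0. \<forall>j::int. 1 / real (Suc N) \<le> of_int j / 2 ^ n \<and> of_int j / 2 ^ n \<le> real (Suc N) \<longrightarrow>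
      \<bar>X (of_int (j + 1) / 2 ^ n) \<omega> - 2 * X (of_int j / 2 ^ n) \<omega> + X (of_int (j - 1) / 2 ^ n) \<omega>\<bar> \<le> (2 powr (- \<theta> / 2)) ^ n / 2 ^ n"
      by (intro exI[of _ n0]) (auto simp: W_def J_def l_def r_def)
  qed
qed

text \<open>A limit of pathwise slopes at countably many times, hence jointly measurable in t and
  \<omega>, as Fubini's theorem demands below. \<open>max t 0\<close> keeps the sampling times in
  the range where X is known to be measurable.\<close>

definition Y :: "real \<Rightarrow> 'a \<Rightarrow> real" where
  "Y t \<omega> = lim (\<lambda>n. dyadic_slope (\<lambda>s. X s \<omega>) n \<lfloor>max t 0 * 2 ^ n\<rfloor>)"

lemma AE_derivative: "AE \<omega> in M. \<forall>t>0. ((\<lambda>s. X s \<omega>) has_real_derivative Y t \<omega>) (at t)"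
proof -
  have "AE \<omega> in M. \<forall>N. \<exists>n0. \<forall>n\<ge>n0. \<forall>j::int. 1 / real (Suc N) \<le> of_int j / 2 ^ n \<and> of_int j / 2 ^ n \<le> real (Suc N) \<longrightarrow>
      \<bar>X (of_int (j + 1) / 2 ^ n) \<omega> - 2 * X (of_int j / 2 ^ n) \<omega> + X (of_int (j - 1) / 2 ^ n) \<omega>\<bar> \<le> (2 powr (- \<theta> / 2)) ^ n / 2 ^ n"
    unfolding AE_all_countable using AE_second_differences_window by blast
  moreover have "AE \<omega> in M. continuous_on {0..} (\<lambda>t. X t \<omega>)" using continuous_X by (simp add: continuous_process_def)
  ultimately show ?thesis
  proof (eventually_elim, intro allI impI)
    fix \<omega> and t :: real
    assume sd: "\<forall>N. \<exists>n0. \<forall>n\<ge>n0. \<forall>j::int. 1 / real (Suc N) \<le> of_int j / 2 ^ n \<and> of_int j / 2 ^ n \<le> real (Suc N) \<longrightarrow>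
      \<bar>X (of_int (j + 1) / 2 ^ n) \<omega> - 2 * X (of_int j / 2 ^ n) \<omega> + X (of_int (j - 1) / 2 ^ n) \<omega>\<bar> \<le> (2 powr (- \<theta> / 2)) ^ n / 2 ^ n"
      and cont: "continuous_on {0..} (\<lambda>t. X t \<omega>)" and t: "0 < t"
    have r: "0 < (2 powr (- \<theta> / 2) :: real)" "2 powr (- \<theta> / 2) < (1 :: real)"
      using exponents(4) by (auto intro!: powr_less_one)
    have "((\<lambda>s. X s \<omega>) has_real_derivative lim (\<lambda>n. dyadic_slope (\<lambda>s. X s \<omega>) n \<lfloor>t * 2 ^ n\<rfloor>)) (at t)"
      by (rule dyadic_slopes_derivative[OF r cont sd[rule_format] t])
    then show "((\<lambda>s. X s \<omega>) has_real_derivative Y t \<omega>) (at t)" using t by (simp add: Y_def max_absorb1)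
  qed
qed

text \<open>For fixed n the integer part takes countably many values, so measurability of X at
  single times suffices.\<close>

lemma measurable_slope:
  "(\<lambda>p :: real \<times> 'a. dyadic_slope (\<lambda>s. X s (snd p)) n \<lfloor>max (fst p) 0 * 2 ^ n\<rfloor>) \<in> borel_measurable (lborel \<Otimes>\<^sub>M M)"
proof -
  have f: "(\<lambda>p. dyadic_slope (\<lambda>s. X s (snd p)) n (int i)) \<in> borel_measurable (lborel \<Otimes>\<^sub>M M)" for i
  proof -
    have [measurable]: "X (of_int (int i + 1) / 2 ^ n) \<in> borel_measurable M" "X (of_int (int i) / 2 ^ n) \<in> borel_measurable M"
      by (intro hwi_measurable(2)[OF hwi_X]; simp)+
    show ?thesis unfolding dyadic_slope_def by measurable
  qed
  have g: "(\<lambda>p :: real \<times> 'a. nat \<lfloor>max (fst p) 0 * 2 ^ n\<rfloor>) \<in> measurable (lborel \<Otimes>\<^sub>M M) (count_space UNIV)"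
    by measurable
  have "(\<lambda>p :: real \<times> 'a. dyadic_slope (\<lambda>s. X s (snd p)) n (int (nat \<lfloor>max (fst p) 0 * 2 ^ n\<rfloor>))) \<in> borel_measurable (lborel \<Otimes>\<^sub>M M)"
    by (rule measurable_compose_countable[OF f g])
  moreover have "int (nat \<lfloor>max (fst p) 0 * 2 ^ n\<rfloor>) = \<lfloor>max (fst p) 0 * 2 ^ n\<rfloor>" for p :: "real \<times> 'a"
    by simp
  ultimately show ?thesis by simp
qed

lemma measurable_Y_pair: "(\<lambda>p. Y (fst p) (snd p)) \<in> borel_measurable (lborel \<Otimes>\<^sub>M M)"
  unfolding Y_def by (rule borel_measurable_lim_metric[OF measurable_slope])

lemma measurable_Y: "Y t \<in> borel_measurable M"
proof -
  have "(\<lambda>\<omega>. (t, \<omega>)) \<in> measurable M (lborel \<Otimes>\<^sub>M M)" by simp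
  from measurable_compose[OF this measurable_Y_pair] show ?thesis by simp
qed

lemma measurable_Y_path:
  assumes "\<omega> \<in> space M"
  shows "(\<lambda>t. Y t \<omega>) \<in> borel_measurable lborel"
proof -
  have "(\<lambda>t. (t, \<omega>)) \<in> measurable lborel (lborel \<Otimes>\<^sub>M M)" using assms by simp
  from measurable_compose[OF this measurable_Y_pair] show ?thesis by simp
qed

text \<open>Along \<open>h n\<close> the difference quotients converge almost surely by
  differentiability, while their kernels converge in L2 to \<open>gfbm_Psi\<close>, with squared
  distance at most a multiple of \<open>h n powr (2 * \<theta>)\<close>. \<open>hwi_limit\<close>
  joins the two limits.\<close>

lemma hwi_Psi:
  assumes t: "0 < t"
  shows "hwi (gfbm_Psi \<alpha> \<gamma> t) (\<lambda>\<omega>. Y t \<omega> / c)"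
proof -
  define h :: "nat \<Rightarrow> real" where "h n = (1 / 2) ^ n" for n
  have h: "0 < h n" for n by (simp add: h_def)
  have h0: "h \<longlonglongrightarrow> 0" unfolding h_def by (rule LIMSEQ_power_zero) simp
  let ?f = "\<lambda>n u. (1 / (h n * c)) * (c * gfbm_inc \<alpha> \<gamma> t (t + h n) u)"
  let ?Z = "\<lambda>n \<omega>. (1 / (h n * c)) * (X (t + h n) \<omega> - X t \<omega>)"
  obtain K where K: "0 \<le> K" "\<And>t. 0 < t \<Longrightarrow> integrable lborel (\<lambda>u. (rl_kernel (\<alpha> - \<theta>) \<gamma> t u)\<^sup>2)"
    "\<And>t. 0 < t \<Longrightarrow> (\<integral>u. (rl_kernel (\<alpha> - \<theta>) \<gamma> t u)\<^sup>2 \<partial>lborel) = K * t powr (2 * (\<alpha> - \<theta>) - 1 - \<gamma>)"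
    using rl_kernel_integral[OF \<gamma>_pos \<gamma>_less exponents(6,7)] by blast
  define e where "e = 2 * (\<alpha> - \<theta>) - 1 - \<gamma>"
  have e: "e < 0" using exponents by (simp add: e_def)
  have bound: "l2dist lborel (gfbm_Psi \<alpha> \<gamma> t) (?f n) \<le> ennreal (4 * K * t powr e * h n powr (2 * \<theta>))" for n
  proof -
    let ?R = "\<lambda>u. h n powr (2 * \<theta>) * (2 * (rl_kernel (\<alpha> - \<theta>) \<gamma> (t + h n) u)\<^sup>2 + 2 * (rl_kernel (\<alpha> - \<theta>) \<gamma> t u)\<^sup>2)"
    have iR: "integrable lborel ?R" using K(2)[of t] K(2)[of "t + h n"] t h[of n] by simp
    have le: "(gfbm_Psi \<alpha> \<gamma> t u - ?f n u)\<^sup>2 \<le> ?R u" for u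
    proof -
      let ?a = "rl_kernel (\<alpha> - \<theta>) \<gamma> (t + h n) u" and ?b = "rl_kernel (\<alpha> - \<theta>) \<gamma> t u"
      have "gfbm_Psi \<alpha> \<gamma> t u - ?f n u =
          - (((ppow \<alpha> (t - u + h n) - ppow \<alpha> (t - u)) / h n - \<alpha> * ppow (\<alpha> - 1) (t - u)) * \<bar>u\<bar> powr (- \<gamma> / 2))"
        using c_pos h[of n] by (simp add: gfbm_Psi_rl_kernel rl_kernel_def gfbm_inc_def algebra_simps diff_divide_distrib)
      then have "\<bar>gfbm_Psi \<alpha> \<gamma> t u - ?f n u\<bar> =
          \<bar>(ppow \<alpha> (t - u + h n) - ppow \<alpha> (t - u)) / h n - \<alpha> * ppow (\<alpha> - 1) (t - u)\<bar> * \<bar>u\<bar> powr (- \<gamma> / 2)"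
        by (simp add: abs_mult)
      also have "\<dots> \<le> (h n powr \<theta> * ppow (\<alpha> - \<theta> - 1) (t - u + h n) + h n powr \<theta> * ppow (\<alpha> - \<theta> - 1) (t - u)) * \<bar>u\<bar> powr (- \<gamma> / 2)"
        using exponents h by (intro mult_right_mono ppow_difference_quotient) auto
      also have "\<dots> = h n powr \<theta> * (?a + ?b)"
        by (simp add: rl_kernel_def algebra_simps)
      finally have "(gfbm_Psi \<alpha> \<gamma> t u - ?f n u)\<^sup>2 \<le> (h n powr \<theta> * (?a + ?b))\<^sup>2"
        by (rule square_le_abs_le)
      also have "\<dots> = h n powr (2 * \<theta>) * (?a + ?b)\<^sup>2" by (simp add: power_mult_distrib power2_powr)
      also have "\<dots> \<le> ?R u"
        using square_diff_triangle[of ?a "- ?b" 0] by (intro mult_left_mono) auto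
      finally show ?thesis .
    qed
    have "l2dist lborel (gfbm_Psi \<alpha> \<gamma> t) (?f n) \<le> (\<integral>\<^sup>+ u. ennreal (?R u) \<partial>lborel)"
      unfolding l2dist_def by (intro nn_integral_mono ennreal_leI le)
    also have "\<dots> = ennreal (\<integral>u. ?R u \<partial>lborel)"
      by (rule nn_integral_eq_integral[OF iR]) simp
    also have "(\<integral>u. ?R u \<partial>lborel) = h n powr (2 * \<theta>) * (2 * (K * (t + h n) powr e) + 2 * (K * t powr e))"
      using K(2)[of t] K(2)[of "t + h n"] K(3)[of t] K(3)[of "t + h n"] t h[of n] by (simp add: e_def)
    also have "\<dots> \<le> h n powr (2 * \<theta>) * (2 * (K * t powr e) + 2 * (K * t powr e))"
      using K(1) e t h[of n] by (intro mult_left_mono add_mono order_refl powr_mono2') auto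
    also have "\<dots> = 4 * K * t powr e * h n powr (2 * \<theta>)" by simp
    finally show ?thesis by (simp add: ennreal_leI)
  qed
  have lim: "(\<lambda>n. ennreal (4 * K * t powr e * h n powr (2 * \<theta>))) \<longlonglongrightarrow> 0"
  proof -
    have "(\<lambda>n. h n powr (2 * \<theta>)) \<longlonglongrightarrow> 0"
      using exponents(4) h by (intro tendsto_zero_powrI[OF h0 tendsto_const]) (auto intro!: always_eventually less_imp_le)
    then have "(\<lambda>n. 4 * K * t powr e * h n powr (2 * \<theta>)) \<longlonglongrightarrow> 4 * K * t powr e * 0"
      by (intro tendsto_mult_left)
    then have "(\<lambda>n. ennreal (4 * K * t powr e * h n powr (2 * \<theta>))) \<longlonglongrightarrow> ennreal (4 * K * t powr e * 0)"
      by (rule tendsto_ennrealI)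
    then show ?thesis by simp
  qed
  show ?thesis
  proof (rule hwi_limit)
    show "hwi (?f n) (?Z n)" for n using t h[of n] by (intro hwi_cmult hwi_inc) auto
    show "gfbm_Psi \<alpha> \<gamma> t \<in> borel_measurable borel"
      unfolding gfbm_Psi_rl_kernel[abs_def] by measurable
    show "(\<lambda>\<omega>. Y t \<omega> / c) \<in> borel_measurable M" using measurable_Y by simp
    show "(\<lambda>n. l2dist lborel (gfbm_Psi \<alpha> \<gamma> t) (?f n)) \<longlonglongrightarrow> 0"
      by (rule tendsto_0_le_ennreal[OF bound lim])
    show "AE \<omega> in M. (\<lambda>n. ?Z n \<omega>) \<longlonglongrightarrow> Y t \<omega> / c"
      using AE_derivative
    proof eventually_elim
      fix \<omega> assume "\<forall>t>0. ((\<lambda>s. X s \<omega>) has_real_derivative Y t \<omega>) (at t)"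
      then have "((\<lambda>k. (X (t + k) \<omega> - X t \<omega>) / k) \<longlongrightarrow> Y t \<omega>) (at 0)" using t by (simp add: DERIV_def)
      moreover have "filterlim h (at 0) sequentially"
        using h0 h by (auto simp: filterlim_at less_imp_neq[symmetric] intro!: always_eventually)
      ultimately have "(\<lambda>n. (X (t + h n) \<omega> - X t \<omega>) / h n) \<longlonglongrightarrow> Y t \<omega>" by (rule filterlim_compose)
      then have "(\<lambda>n. (X (t + h n) \<omega> - X t \<omega>) / h n / c) \<longlonglongrightarrow> Y t \<omega> / c"
        by (rule tendsto_divide[OF _ tendsto_const]) (use c_pos in simp)
      then show "(\<lambda>n. ?Z n \<omega>) \<longlonglongrightarrow> Y t \<omega> / c" by simp
    qed
  qed
qed

text \<open>Used near time 0: the exponent is negative but greater than -1, so the bound is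
  integrable there.\<close>

lemma expectation_abs_Y:
  obtains C where "0 \<le> C" "\<And>t. 0 < t \<Longrightarrow> (\<integral>\<^sup>+ \<omega>. ennreal \<bar>Y t \<omega>\<bar> \<partial>M) \<le> ennreal (C * t powr ((2 * \<alpha> - 1 - \<gamma>) / 2))"
proof -
  obtain K where K: "0 \<le> K" "\<And>t. 0 < t \<Longrightarrow> integrable lborel (\<lambda>u. (rl_kernel \<alpha> \<gamma> t u)\<^sup>2)"
    "\<And>t. 0 < t \<Longrightarrow> (\<integral>u. (rl_kernel \<alpha> \<gamma> t u)\<^sup>2 \<partial>lborel) = K * t powr (2 * \<alpha> - 1 - \<gamma>)"
    using rl_kernel_integral[OF \<gamma>_pos \<gamma>_less \<alpha>_gt exponents(3)] by blast
  show thesis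
  proof (rule that[of "c * \<alpha> * sqrt K"])
    show "0 \<le> c * \<alpha> * sqrt K" using c_pos exponents K(1) by simp
    fix t :: real assume t: "0 < t"
    have "hwi (\<lambda>u. c * gfbm_Psi \<alpha> \<gamma> t u) (\<lambda>\<omega>. c * (Y t \<omega> / c))" by (rule hwi_cmult[OF hwi_Psi[OF t]])
    moreover have "(\<lambda>\<omega>. c * (Y t \<omega> / c)) = Y t" using c_pos by auto
    ultimately have g: "gaussian_rv (\<integral>u. (c * gfbm_Psi \<alpha> \<gamma> t u)\<^sup>2 \<partial>lborel) (Y t)" using hwi_gaussian(2) by simp
    note m = gaussian_rv_moment[OF g]
    have v: "(\<integral>u. (c * gfbm_Psi \<alpha> \<gamma> t u)\<^sup>2 \<partial>lborel) = (c * \<alpha>)\<^sup>2 * (K * t powr (2 * \<alpha> - 1 - \<gamma>))"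
      using K(3)[OF t] by (simp add: gfbm_Psi_rl_kernel power_mult_distrib)
    have "(\<integral>\<^sup>+ \<omega>. ennreal \<bar>Y t \<omega>\<bar> \<partial>M) = ennreal (expectation (\<lambda>\<omega>. \<bar>Y t \<omega>\<bar>))"
      using m(3) by (intro nn_integral_eq_integral) auto
    also have "\<dots> \<le> ennreal (sqrt ((c * \<alpha>)\<^sup>2 * (K * t powr (2 * \<alpha> - 1 - \<gamma>))))"
      using expectation_abs_le_sqrt[OF measurable_Y m(5)] unfolding m(6) v by (rule ennreal_leI)
    also have "sqrt ((c * \<alpha>)\<^sup>2 * (K * t powr (2 * \<alpha> - 1 - \<gamma>))) = c * \<alpha> * sqrt K * t powr ((2 * \<alpha> - 1 - \<gamma>) / 2)"
    proof -
      have "sqrt (t powr (2 * \<alpha> - 1 - \<gamma>)) = t powr ((2 * \<alpha> - 1 - \<gamma>) / 2)"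
        by (intro real_sqrt_unique) (simp_all add: power2_powr diff_divide_distrib)
      then show ?thesis using c_pos exponents by (simp add: real_sqrt_mult)
    qed
    finally show "(\<integral>\<^sup>+ \<omega>. ennreal \<bar>Y t \<omega>\<bar> \<partial>M) \<le> ennreal (c * \<alpha> * sqrt K * t powr ((2 * \<alpha> - 1 - \<gamma>) / 2))" .
  qed
qed

text \<open>Fubini's theorem for \<open>\<bar>Y s \<omega>\<bar>\<close> on (0,N]. The exceptional
  null set is collected over natural N and then serves all t.\<close>

lemma AE_set_integrable_Y: "AE \<omega> in M. \<forall>t\<ge>0. set_integrable lborel {0<..t} (\<lambda>s. Y s \<omega>)"
proof -
  interpret P: pair_sigma_finite lborel M
    by (intro pair_sigma_finite.intro sigma_finite_lborel sigma_finite_measure_axioms)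
  obtain C where C: "0 \<le> C" "\<And>t. 0 < t \<Longrightarrow> (\<integral>\<^sup>+ \<omega>. ennreal \<bar>Y t \<omega>\<bar> \<partial>M) \<le> ennreal (C * t powr ((2 * \<alpha> - 1 - \<gamma>) / 2))"
    using expectation_abs_Y by blast
  define q where "q = (2 * \<alpha> - 1 - \<gamma>) / 2"
  have q: "-1 < q" using \<alpha>_gt \<gamma>_less by (simp add: q_def)
  note [measurable] = measurable_Y measurable_Y_pair
  have "AE \<omega> in M. (\<integral>\<^sup>+ s. indicator {0<..real N} s * ennreal \<bar>Y s \<omega>\<bar> \<partial>lborel) \<noteq> \<infinity>" for N :: nat
  proof (rule nn_integral_noteq_infinite)
    let ?F = "\<lambda>p. indicator {0<..real N} (fst p) * ennreal \<bar>Y (fst p) (snd p)\<bar>"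
    have F: "?F \<in> borel_measurable (lborel \<Otimes>\<^sub>M M)" by measurable
    show "(\<lambda>\<omega>. \<integral>\<^sup>+ s. indicator {0<..real N} s * ennreal \<bar>Y s \<omega>\<bar> \<partial>lborel) \<in> borel_measurable M"
      using lborel.borel_measurable_nn_integral[of "\<lambda>\<omega> s. indicator {0<..real N} s * ennreal \<bar>Y s \<omega>\<bar>" M]
        measurable_compose[OF measurable_pair_swap' F] by (simp add: case_prod_beta)
    have "(\<integral>\<^sup>+ \<omega>. \<integral>\<^sup>+ s. indicator {0<..real N} s * ennreal \<bar>Y s \<omega>\<bar> \<partial>lborel \<partial>M)
        = (\<integral>\<^sup>+ s. \<integral>\<^sup>+ \<omega>. indicator {0<..real N} s * ennreal \<bar>Y s \<omega>\<bar> \<partial>M \<partial>lborel)"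
      using P.Fubini[OF F] by simp
    also have "\<dots> \<le> (\<integral>\<^sup>+ s. ennreal C * (ennreal (s powr q) * indicator {0..real N} s) \<partial>lborel)"
    proof (rule nn_integral_mono)
      fix s :: real
      have "(\<integral>\<^sup>+ \<omega>. indicator {0<..real N} s * ennreal \<bar>Y s \<omega>\<bar> \<partial>M) = indicator {0<..real N} s * (\<integral>\<^sup>+ \<omega>. ennreal \<bar>Y s \<omega>\<bar> \<partial>M)"
        by (rule nn_integral_cmult) measurable
      also have "\<dots> \<le> ennreal C * (ennreal (s powr q) * indicator {0..real N} s)"
        using C(2)[of s] C(1) by (auto simp: indicator_def q_def ennreal_mult)
      finally show "(\<integral>\<^sup>+ \<omega>. indicator {0<..real N} s * ennreal \<bar>Y s \<omega>\<bar> \<partial>M) \<le> ennreal C * (ennreal (s powr q) * indicator {0..real N} s)" .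
    qed
    also have "\<dots> = ennreal C * ennreal (real N powr (q + 1) / (q + 1))"
      using nn_integral_powr_from_0[OF q, of "real N"] by (simp add: nn_integral_cmult)
    also have "\<dots> < \<infinity>" by (simp add: ennreal_mult_less_top)
    finally show "(\<integral>\<^sup>+ \<omega>. \<integral>\<^sup>+ s. indicator {0<..real N} s * ennreal \<bar>Y s \<omega>\<bar> \<partial>lborel \<partial>M) \<noteq> \<infinity>" by simp
  qed
  then have "AE \<omega> in M. \<forall>N::nat. (\<integral>\<^sup>+ s. indicator {0<..real N} s * ennreal \<bar>Y s \<omega>\<bar> \<partial>lborel) \<noteq> \<infinity>"
    by (simp add: AE_all_countable)
  then show ?thesis
    using AE_space
  proof (eventually_elim, intro allI impI)
    fix \<omega> and t :: real
    assume fin: "\<forall>N::nat. (\<integral>\<^sup>+ s. indicator {0<..real N} s * ennreal \<bar>Y s \<omega>\<bar> \<partial>lborel) \<noteq> \<infinity>" and \<omega>: "\<omega> \<in> space M"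
    obtain N :: nat where N: "t \<le> real N" using real_arch_simple by blast
    have [measurable]: "(\<lambda>s. Y s \<omega>) \<in> borel_measurable lborel" by (rule measurable_Y_path[OF \<omega>])
    have "set_integrable lborel {0<..real N} (\<lambda>s. Y s \<omega>)"
      unfolding set_integrable_def
    proof (rule integrableI_bounded)
      have "(\<integral>\<^sup>+ s. ennreal (norm (indicator {0<..real N} s *\<^sub>R Y s \<omega>)) \<partial>lborel) =
          (\<integral>\<^sup>+ s. indicator {0<..real N} s * ennreal \<bar>Y s \<omega>\<bar> \<partial>lborel)"
        by (intro nn_integral_cong) (simp add: indicator_def)
      then show "(\<integral>\<^sup>+ s. ennreal (norm (indicator {0<..real N} s *\<^sub>R Y s \<omega>)) \<partial>lborel) < \<infinity>"
        using fin by (simp add: less_top)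
    qed measurable
    then show "set_integrable lborel {0<..t} (\<lambda>s. Y s \<omega>)"
      by (rule set_integrable_subset) (use N in auto)
  qed
qed

text \<open>The fundamental theorem for the gauge integral asks for a derivative only in the open
  interval, with continuity at the ends; this bridges the possible blow-up at 0. Absolute
  integrability turns the gauge integral into the Lebesgue integral.\<close>

lemma AE_integral_Y:
  "AE \<omega> in M. \<forall>t\<ge>0. set_integrable lborel {0<..t} (\<lambda>s. Y s \<omega>) \<and> X t \<omega> = (LBINT s:{0<..t}. Y s \<omega>)"
proof -
  have "AE \<omega> in M. continuous_on {0..} (\<lambda>t. X t \<omega>)" using continuous_X by (simp add: continuous_process_def)
  with AE_set_integrable_Y AE_derivative X_0 show ?thesis
  proof (eventually_elim, intro allI impI)
    fix \<omega> and t :: real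
    assume si: "\<forall>t\<ge>0. set_integrable lborel {0<..t} (\<lambda>s. Y s \<omega>)"
      and der: "\<forall>t>0. ((\<lambda>s. X s \<omega>) has_real_derivative Y t \<omega>) (at t)" and 0: "X 0 \<omega> = 0"
      and cont: "continuous_on {0..} (\<lambda>t. X t \<omega>)" and t: "0 \<le> t"
    have "((\<lambda>s. Y s \<omega>) has_integral (X t \<omega> - X 0 \<omega>)) {0..t}"
    proof (rule fundamental_theorem_of_calculus_interior[OF t])
      show "continuous_on {0..t} (\<lambda>t. X t \<omega>)" using cont by (rule continuous_on_subset) auto
      show "((\<lambda>t. X t \<omega>) has_vector_derivative Y s \<omega>) (at s)" if "s \<in> {0<..<t}" for s
        using der that by (simp add: has_real_derivative_iff_has_vector_derivative)
    qed
    then have "((\<lambda>s. Y s \<omega>) has_integral X t \<omega>) {0<..t}"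
      unfolding 0 diff_0_right
      by (rule has_integral_spike_set_eq[THEN iffD1, rotated 2])
        (rule negligible_subset[OF negligible_sing[of 0]], auto)+
    then have "integral {0<..t} (\<lambda>s. Y s \<omega>) = X t \<omega>" by (rule integral_unique)
    then show "set_integrable lborel {0<..t} (\<lambda>s. Y s \<omega>) \<and> X t \<omega> = (LBINT s:{0<..t}. Y s \<omega>)"
      using si t set_borel_integral_eq_integral(2)[of "{0<..t}" "\<lambda>s. Y s \<omega>"] by simp
  qed
qed

lemma AE_finite_variation_X: "AE \<omega> in M. finite_variation_path (\<lambda>t. X t \<omega>)"
  using AE_integral_Y by eventually_elim (rule finite_variation_path_integral, auto)

lemma finite_variation_process_X: "finite_variation_process M filt X"
  unfolding finite_variation_process_def adapted_process_def
  using X_filt AE_cadlag_X AE_finite_variation_X by (auto elim: eventually_elim2)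

lemma semimartingale_X: "semimartingale M filt X"
  unfolding semimartingale_def
proof (rule conjI)
  show "adapted_process filt X" unfolding adapted_process_def using X_filt by auto
next
  show "\<exists>N A. local_martingale M filt N \<and> finite_variation_process M filt A \<and>
        (AE \<omega> in M. N 0 \<omega> = 0 \<and> A 0 \<omega> = 0 \<and> (\<forall>t\<ge>0. X t \<omega> = X 0 \<omega> + N t \<omega> + A t \<omega>))"
  proof (rule exI[of _ "\<lambda>t \<omega>. 0"], rule exI[of _ "\<lambda>t \<omega>. X t \<omega> - X 0 \<omega>"], intro conjI)
    show "local_martingale M filt (\<lambda>t \<omega>. 0)"
      unfolding local_martingale_def
    proof (intro conjI exI[of _ "\<lambda>n _. real n"] allI)
      show "AE \<omega> in M. incseq (\<lambda>n. real n) \<and> filterlim (\<lambda>n. real n) at_top sequentially"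
        by (simp add: incseq_def filterlim_real_sequentially)
      show "martingale M filt (\<lambda>t \<omega>. 0 - 0)" for n :: nat
        by (rule martingaleI_orthogonal[OF subalgebra_filt]) (auto simp: adapted_process_def)
    qed (auto intro: stopping_time_const simp: adapted_process_def cadlag_path_def)
    show "finite_variation_process M filt (\<lambda>t \<omega>. X t \<omega> - X 0 \<omega>)"
      unfolding finite_variation_process_def adapted_process_def
    proof (intro conjI allI impI)
      show "(\<lambda>\<omega>. X t \<omega> - X 0 \<omega>) \<in> borel_measurable (filt t)" if "0 \<le> t" for t
        using that by (intro borel_measurable_diff X_filt) auto
      show "AE \<omega> in M. cadlag_path (\<lambda>t. X t \<omega> - X 0 \<omega>) \<and> finite_variation_path (\<lambda>t. X t \<omega> - X 0 \<omega>)"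
        using AE_cadlag_X AE_finite_variation_X by eventually_elim (intro conjI cadlag_shift finite_variation_path_shift)
    qed
  qed simp
qed

end

text \<open>The derivative is claimed for t > 0: at t = 0 the square of \<open>gfbm_Psi\<close> is a
  multiple of \<open>\<bar>s\<bar> powr (2 * \<alpha> - 2 - \<gamma>)\<close> for s < 0, with an
  exponent below -1, so its Wiener integral does not exist. The integral formula covers time 0
  instead. In the last case no filtration is singled out, so the claim is made for all of them. If
  \<gamma> = 2 * \<alpha>, then \<gamma> < 1 forces \<alpha> < 1/2.\<close>

theorem proposition3p1:
  fixes M :: "'a measure" and B :: "real set \<Rightarrow> 'a \<Rightarrow> real"
    and X :: "real \<Rightarrow> 'a \<Rightarrow> real" and \<alpha> \<gamma> :: real
  assumes B: "gaussian_random_measure M B"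
    and \<gamma>: "0 \<le> \<gamma>" "\<gamma> < 1"
    and \<alpha>: "- 1 / 2 + \<gamma> / 2 < \<alpha>" "\<alpha> < 1 / 2 + \<gamma> / 2"
    and X: "gfbm M B \<alpha> \<gamma> X"
  shows
    "(0 < \<gamma> \<and> 1 / 2 < \<alpha> \<longrightarrow>
        semimartingale M (generated_filtration M B) X \<and>
        finite_variation_process M (generated_filtration M B) X \<and>
        (\<exists>Y. (\<forall>t>0. \<exists>Z. has_wiener_integral M B (gfbm_Psi \<alpha> \<gamma> t) Z \<and>
                         Y t = (\<lambda>\<omega>. gfbm_const \<alpha> \<gamma> * Z \<omega>)) \<and>
             (AE \<omega> in M.
                (\<forall>t>0. ((\<lambda>r. X r \<omega>) has_real_derivative Y t \<omega>) (at t)) \<and>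
                (\<forall>t\<ge>0. set_integrable lborel {0<..t} (\<lambda>s. Y s \<omega>) \<and>
                        X t \<omega> = (LBINT s:{0<..t}. Y s \<omega>)))))
     \<and> (0 < \<gamma> \<and> \<alpha> < 1 / 2 \<and> \<alpha> \<noteq> 0 \<longrightarrow>
        \<not> semimartingale M (generated_filtration M B) X)
     \<and> (0 < \<gamma> \<and> \<gamma> = 2 * \<alpha> \<longrightarrow>
        \<not> semimartingale M (generated_filtration M B) X)
     \<and> (\<alpha> = 0 \<longrightarrow>
        (\<forall>t\<ge>0. \<exists>Z. has_wiener_integral M B (\<lambda>u. indicator {0..t} u * u powr (- \<gamma> / 2)) Z \<and>
                   X t = (\<lambda>\<omega>. gfbm_const 0 \<gamma> * Z \<omega>)) \<and>
        martingale M (generated_filtration M B) X \<and>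
        (\<forall>t\<ge>0. integrable M (\<lambda>\<omega>. (X t \<omega>)\<^sup>2)) \<and>
        semimartingale M (generated_filtration M B) X)
     \<and> (\<gamma> = 0 \<and> \<alpha> \<noteq> 0 \<longrightarrow>
        fractional_brownian_motion M (\<alpha> + 1 / 2) X \<and>
        (\<forall>F. filtration (space M) F \<and> (\<forall>t. subalgebra M (F t)) \<longrightarrow>
             \<not> semimartingale M F X))"
proof -
  interpret gaussian_random_measure M B by (rule B)
  interpret gfbm_process M B \<alpha> \<gamma> X by unfold_locales (use \<gamma> \<alpha> X in auto)
  have not_semi: "\<not> semimartingale M F X"
    if "filtration (space M) F" "\<And>t. subalgebra M (F t)" "\<alpha> < 1 / 2" "\<alpha> \<noteq> 0" for F
    using not_semimartingale_negative[OF that(1,2)] not_semimartingale_positive[OF that(1,2)] that(3,4) by linarith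
  show ?thesis
  proof (intro conjI impI)
    assume "0 < \<gamma> \<and> 1 / 2 < \<alpha>"
    then interpret gfbm_smooth M B \<alpha> \<gamma> X by unfold_locales auto
    show "semimartingale M (generated_filtration M B) X" by (rule semimartingale_X)
    show "finite_variation_process M (generated_filtration M B) X" by (rule finite_variation_process_X)
    show "\<exists>Y. (\<forall>t>0. \<exists>Z. has_wiener_integral M B (gfbm_Psi \<alpha> \<gamma> t) Z \<and>
                         Y t = (\<lambda>\<omega>. gfbm_const \<alpha> \<gamma> * Z \<omega>)) \<and>
             (AE \<omega> in M.
                (\<forall>t>0. ((\<lambda>r. X r \<omega>) has_real_derivative Y t \<omega>) (at t)) \<and>
                (\<forall>t\<ge>0. set_integrable lborel {0<..t} (\<lambda>s. Y s \<omega>) \<and>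
                        X t \<omega> = (LBINT s:{0<..t}. Y s \<omega>)))"
    proof (rule exI[of _ Y], intro conjI allI impI)
      fix t :: real assume "0 < t"
      then show "\<exists>Z. has_wiener_integral M B (gfbm_Psi \<alpha> \<gamma> t) Z \<and> Y t = (\<lambda>\<omega>. gfbm_const \<alpha> \<gamma> * Z \<omega>)"
        using hwi_Psi c_pos by (intro exI[of _ "\<lambda>\<omega>. Y t \<omega> / gfbm_const \<alpha> \<gamma>"]) auto
    next
      show "AE \<omega> in M.
                (\<forall>t>0. ((\<lambda>r. X r \<omega>) has_real_derivative Y t \<omega>) (at t)) \<and>
                (\<forall>t\<ge>0. set_integrable lborel {0<..t} (\<lambda>s. Y s \<omega>) \<and>
                        X t \<omega> = (LBINT s:{0<..t}. Y s \<omega>))"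
        using AE_derivative AE_integral_Y by eventually_elim (rule conjI)
    qed
  next
    assume "0 < \<gamma> \<and> \<alpha> < 1 / 2 \<and> \<alpha> \<noteq> 0"
    then show "\<not> semimartingale M (generated_filtration M B) X"
      by (intro not_semi filtration_filt subalgebra_filt) auto
  next
    assume "0 < \<gamma> \<and> \<gamma> = 2 * \<alpha>"
    then show "\<not> semimartingale M (generated_filtration M B) X"
      using \<gamma> by (intro not_semi filtration_filt subalgebra_filt) auto
  next
    assume 0: "\<alpha> = 0"
    show "\<forall>t\<ge>0. \<exists>Z. has_wiener_integral M B (\<lambda>u. indicator {0..t} u * u powr (- \<gamma> / 2)) Z \<and>
                   X t = (\<lambda>\<omega>. gfbm_const 0 \<gamma> * Z \<omega>)"
      using hwi_closed_interval[OF 0] by blast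
    show "martingale M (generated_filtration M B) X" by (rule martingale_X[OF 0])
    show "\<forall>t\<ge>0. integrable M (\<lambda>\<omega>. (X t \<omega>)\<^sup>2)" using X_integrable(2) by blast
    show "semimartingale M (generated_filtration M B) X" by (rule semimartingale_0[OF 0])
  next
    assume 0: "\<gamma> = 0 \<and> \<alpha> \<noteq> 0"
    then show "fractional_brownian_motion M (\<alpha> + 1 / 2) X" by (intro fractional_brownian_motion_0) simp
    show "\<forall>F. filtration (space M) F \<and> (\<forall>t. subalgebra M (F t)) \<longrightarrow> \<not> semimartingale M F X"
      using 0 \<alpha> by (intro allI impI not_semi) auto
  qed
qed

end
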